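(* Let $k$ be a field of characteristic different from $2$ and $3$, and let $\alpha=(\alpha_0:\cdots:\alpha_4)$ be a point on the Burkhardt quartic $B$ over $k$. Then the intersection of the cubic polar $P_\alpha^{(1)}$ of $B$ at $\alpha$ with the $j$-plane $J\colon y_0=y_1=0$ yields the plane cubic $$E_{J,\alpha}\colon\alpha_0(y_2^3+y_3^3+y_4^3)+3\alpha_1y_2y_3y_4=0.$$ Suppose moreover that $\alpha\notin\mathrm{He}(B)$, scaled so that $\alpha_0=1$, and that $\alpha_4\ne0$. Then the cover $E_{J,\alpha}\to\mathbb{P}^1$ obtained from projecting from $(y_2:y_3:y_4)=(\alpha_2:\alpha_3:\alpha_4)$ is equivalent (as a cubic cover of $\mathbb{P}^1$) to $$w^3+3\lambda_1H_1(x,z)w+\lambda_1G_1(x,z)=0.$$ The curve $C_\alpha$ (up to quadratic twist) arises as the discriminant of $E_{J,\alpha}\to\mathbb{P}^1$, and the fiber product $C_\alpha\times_{\mathbb{P}^1}E_{J,\alpha}$ is the unramified cover of $C_\alpha$ that capitalizes the order $3$ subgroup of $\mathcal{J}_\alpha$ determined by $J$.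
   Context: $B\subset\mathbb{P}^4$ is $f=0$ with $f=y_0(y_0^3+y_1^3+y_2^3+y_3^3+y_4^3)+3y_1y_2y_3y_4$; $\mathrm{He}(B)$ is the hypersurface $\frac1{486}\det(\partial^2f/\partial y_i\partial y_j)_{i,j}=0$; the cubic polar is $P_\alpha^{(1)}\colon\sum_i\alpha_i\frac{\partial f}{\partial y_i}=0$. The $j$-planes are the $40$ planes whose union is $B\cap\mathrm{He}(B)$ (geometrically). The curve $C_\alpha$: $B\setminus\mathrm{He}(B)$ is classically identified with the open part of the fine moduli space $\mathcal{A}_{2,3}$ of principally polarized Abelian surfaces with full level-$3$ structure $(\mathbb{Z}/3)^2\times(\mu_3)^2$ (with its natural pairing) that parametrizes Jacobians of genus $2$ curves; $C_\alpha$ is the genus $2$ curve and $\mathcal{J}_\alpha=\mathrm{Jac}(C_\alpha)$ the Abelian surface corresponding to $\alpha$. Explicitly, for $\alpha_0=1$ and $\alpha_4\neq0$, $C_\alpha$ is $y^2=F(x,z)$ with $F=G_3^2+4\lambda_3H_3^3$, where, with $N=\alpha_1^3\alpha_4^3-3\alpha_1\alpha_2\alpha_3\alpha_4-\alpha_2^3-\alpha_3^3$, $$\begin{aligned} H_3&=\alpha_2x^2-\alpha_3xz-\alpha_1\alpha_4z^2,\qquad \lambda_3=\alpha_4^3(\alpha_4^3+1)N,\\ G_3&=(\alpha_1^3\alpha_4^3+3\alpha_1\alpha_2\alpha_3\alpha_4^4+2\alpha_2^3\alpha_4^3+\alpha_2^3+\alpha_3^3\alpha_4^3)x^3+3\alpha_2(\alpha_4^3+1)(\alpha_1^2\alpha_4^2-\alpha_2\alpha_3)x^2z\\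 &\quad-3\alpha_3(\alpha_4^3+1)(\alpha_1^2\alpha_4^2-\alpha_2\alpha_3)xz^2+(-2\alpha_1^3\alpha_4^6-\alpha_1^3\alpha_4^3+3\alpha_1\alpha_2\alpha_3\alpha_4^4+\alpha_2^3\alpha_4^3-\alpha_3^3)z^3. \end{aligned}$$ The triple $(H_1,\lambda_1,G_1)$: the $j$-plane $J=J_1\colon y_0=y_1=0$ determines an order $3$ subgroup of $\mathcal{J}_\alpha$ (the projection of $J$ from $\alpha$ is a tangent plane of the dual Kummer surface of $C_\alpha$, hence gives a pair of opposite points of order $3$ on $\mathcal{J}_\alpha$). Writing one of these points as $[D-\kappa]$ with $D$ effective of degree $2$ and $\kappa$ canonical, the image $x_*(D)$ on the $(x:z)$-line is the zero divisor of a quadratic form $H_1$, and there are $\lambda_1\in k$ and a cubic form $G_1$ such that $F=G_1^2+4\lambda_1H_1^3$ (so $C_\alpha$ has the model $y^2+G_1y=\lambda_1H_1^3$). Explicitly $\lambda_1=-(\alpha_4^3+1)/N^2$, $$\begin{aligned} H_1&=(\alpha_1^3\alpha_3\alpha_4^3+\alpha_1^2\alpha_2^2\alpha_4^5+\alpha_1^2\alpha_2^2\alpha_4^2+2\alpha_1\alpha_2\alpha_3^2\alpha_4^4-\alpha_1\alpha_2\alpha_3^2\alpha_4-\alpha_2^3\alpha_3+\alpha_3^4\alpha_4^3)x^2\\ &\quad+(\alpha_1^4\alpha_4^4+2\alpha_1^2\alpha_2\alpha_3\alpha_4^5-\alpha_1^2\alpha_2\alpha_3\alpha_4^2+2\alpha_1\alpha_2^3\alpha_4^4+\alpha_1\alpha_2^3\alpha_4+2\alpha_1\alpha_3^3\alpha_4^4+\alpha_1\alpha_3^3\alpha_4+2\alpha_2^2\alpha_3^2\alpha_4^3+2\alpha_2^2\alpha_3^2)xz\\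 &\quad+(\alpha_1^3\alpha_2\alpha_4^3+\alpha_1^2\alpha_3^2\alpha_4^5+\alpha_1^2\alpha_3^2\alpha_4^2+2\alpha_1\alpha_2^2\alpha_3\alpha_4^4-\alpha_1\alpha_2^2\alpha_3\alpha_4+\alpha_2^4\alpha_4^3-\alpha_2\alpha_3^3)z^2, \end{aligned}$$ and $G_1$ is the cubic form with $G_1^2=F-4\lambda_1H_1^3$, determined up to sign (changing the sign of $G_1$ amounts to $w\mapsto-w$). The discriminant of a cubic cover $E\to\mathbb{P}^1$ given by a cubic equation in $w$ over $k[x,z]$ is the sextic form $\Delta(x,z)$ given by the discriminant with respect to $w$ (up to squares of constants), and the curve "arising as the discriminant" is $y^2=\Delta(x,z)$. The fiber product is taken as the smooth projective model (normalization). A cover $X\to C_\alpha$ capitalizes a subgroup of $\mathcal{J}_\alpha$ if the divisor classes in that subgroup become principal when pulled back to $X$. *)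

theory Defs
  imports
    "HOL-Library.Poly_Mapping"
    "HOL-Algebra.Algebraic_Closure_Type"
    "HOL-Algebra.Generated_Fields"
    "HOL-Algebra.Finite_Extensions"
    "HOL-Computational_Algebra.Fraction_Field"
    "Jordan_Normal_Form.Determinant"
begin

section \<open>Polynomials and forms\<close>

text \<open>Polynomials in variables indexed by the natural numbers. The five coordinates of
  projective 4-space are the variables \<open>0, \<dots>, 4\<close>; the coordinates of the plane
  \<open>y\<^sub>0 = y\<^sub>1 = 0\<close> are the variables \<open>2, 3, 4\<close>.\<close>

type_synonym 'k mpoly = "(nat \<Rightarrow>\<^sub>0 nat) \<Rightarrow>\<^sub>0 'k"

definition Var :: "nat \<Rightarrow> 'k::comm_ring_1 mpoly"
  where "Var i = Poly_Mapping.single (Poly_Mapping.single i 1) 1"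

definition Const :: "'k::comm_ring_1 \<Rightarrow> 'k mpoly"
  where "Const c = Poly_Mapping.single 0 c"

text \<open>Substitution of \<open>a i\<close> for the variable \<open>i\<close>, the coefficients being mapped along \<open>c\<close>.\<close>

definition subst_mpoly :: "('k::comm_ring_1 \<Rightarrow> 'r::comm_ring_1) \<Rightarrow> (nat \<Rightarrow> 'r) \<Rightarrow> 'k mpoly \<Rightarrow> 'r"
  where "subst_mpoly c a p =
    (\<Sum>m\<in>Poly_Mapping.keys p. c (Poly_Mapping.lookup p m) *
      (\<Prod>i\<in>Poly_Mapping.keys m. a i ^ Poly_Mapping.lookup m i))"

definition pdiff :: "nat \<Rightarrow> 'k::comm_ring_1 mpoly \<Rightarrow> 'k mpoly"
  where "pdiff i p =
    (\<Sum>m\<in>Poly_Mapping.keys p. Poly_Mapping.single (m - Poly_Mapping.single i 1)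
      (of_nat (Poly_Mapping.lookup m i) * Poly_Mapping.lookup p m))"

definition binary_form :: "nat \<Rightarrow> 'k::comm_ring_1 mpoly \<Rightarrow> bool"
  where "binary_form n p \<longleftrightarrow>
    (\<forall>m\<in>Poly_Mapping.keys p. Poly_Mapping.keys m \<subseteq> {0, 1} \<and>
      Poly_Mapping.lookup m 0 + Poly_Mapping.lookup m 1 = n)"


section \<open>The Burkhardt quartic, its Hessian and its cubic polars\<close>

definition burkhardt :: "'k::comm_ring_1 mpoly"
  where "burkhardt = Var 0 * (Var 0 ^ 3 + Var 1 ^ 3 + Var 2 ^ 3 + Var 3 ^ 3 + Var 4 ^ 3)
    + 3 * Var 1 * Var 2 * Var 3 * Var 4"

definition burkhardt_hessian :: "'k::field mpoly"
  where "burkhardt_hessian = Const (1 / 486) *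
    Determinant.det (Matrix.mat 5 5 (\<lambda>(i, j). pdiff i (pdiff j burkhardt)))"

definition cubic_polar :: "(nat \<Rightarrow> 'k::comm_ring_1) \<Rightarrow> 'k mpoly"
  where "cubic_polar \<alpha> = (\<Sum>i\<le>4. Const (\<alpha> i) * pdiff i burkhardt)"

text \<open>The equation of the intersection of a hypersurface with the plane \<open>y\<^sub>0 = y\<^sub>1 = 0\<close>.\<close>

definition restrict_to_J :: "'k::comm_ring_1 mpoly \<Rightarrow> 'k mpoly"
  where "restrict_to_J p = subst_mpoly Const (\<lambda>i. if i < 2 then 0 else Var i) p"

definition E_cubic :: "(nat \<Rightarrow> 'k::comm_ring_1) \<Rightarrow> 'k mpoly"
  where "E_cubic \<alpha> = Const (\<alpha> 0) * (Var 2 ^ 3 + Var 3 ^ 3 + Var 4 ^ 3)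
    + 3 * Const (\<alpha> 1) * Var 2 * Var 3 * Var 4"


section \<open>The genus 2 curve and the decomposition attached to the plane\<close>

text \<open>All of the following is for \<open>\<alpha> 0 = 1\<close>. Binary forms in \<open>x, z\<close> are polynomials in the
  variables \<open>0\<close> (for \<open>x\<close>) and \<open>1\<close> (for \<open>z\<close>).\<close>

abbreviation (input) vx :: "'k::comm_ring_1 mpoly" where "vx \<equiv> Var 0"
abbreviation (input) vz :: "'k::comm_ring_1 mpoly" where "vz \<equiv> Var 1"

definition N_of :: "(nat \<Rightarrow> 'k::field) \<Rightarrow> 'k"
  where "N_of \<alpha> = \<alpha> 1 ^ 3 * \<alpha> 4 ^ 3 - 3 * \<alpha> 1 * \<alpha> 2 * \<alpha> 3 * \<alpha> 4 - \<alpha> 2 ^ 3 - \<alpha> 3 ^ 3"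

definition H3 :: "(nat \<Rightarrow> 'k::field) \<Rightarrow> 'k mpoly"
  where "H3 \<alpha> = Const (\<alpha> 2) * vx ^ 2 - Const (\<alpha> 3) * vx * vz - Const (\<alpha> 1 * \<alpha> 4) * vz ^ 2"

definition lambda3 :: "(nat \<Rightarrow> 'k::field) \<Rightarrow> 'k"
  where "lambda3 \<alpha> = \<alpha> 4 ^ 3 * (\<alpha> 4 ^ 3 + 1) * N_of \<alpha>"

definition G3 :: "(nat \<Rightarrow> 'k::field) \<Rightarrow> 'k mpoly"
  where "G3 \<alpha> =
    Const (\<alpha> 1 ^ 3 * \<alpha> 4 ^ 3 + 3 * \<alpha> 1 * \<alpha> 2 * \<alpha> 3 * \<alpha> 4 ^ 4 + 2 * \<alpha> 2 ^ 3 * \<alpha> 4 ^ 3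
      + \<alpha> 2 ^ 3 + \<alpha> 3 ^ 3 * \<alpha> 4 ^ 3) * vx ^ 3
    + Const (3 * \<alpha> 2 * (\<alpha> 4 ^ 3 + 1) * (\<alpha> 1 ^ 2 * \<alpha> 4 ^ 2 - \<alpha> 2 * \<alpha> 3)) * vx ^ 2 * vz
    - Const (3 * \<alpha> 3 * (\<alpha> 4 ^ 3 + 1) * (\<alpha> 1 ^ 2 * \<alpha> 4 ^ 2 - \<alpha> 2 * \<alpha> 3)) * vx * vz ^ 2
    + Const (- 2 * \<alpha> 1 ^ 3 * \<alpha> 4 ^ 6 - \<alpha> 1 ^ 3 * \<alpha> 4 ^ 3 + 3 * \<alpha> 1 * \<alpha> 2 * \<alpha> 3 * \<alpha> 4 ^ 4
      + \<alpha> 2 ^ 3 * \<alpha> 4 ^ 3 - \<alpha> 3 ^ 3) * vz ^ 3"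

definition F_sextic :: "(nat \<Rightarrow> 'k::field) \<Rightarrow> 'k mpoly"
  where "F_sextic \<alpha> = G3 \<alpha> ^ 2 + 4 * Const (lambda3 \<alpha>) * H3 \<alpha> ^ 3"

definition lambda1 :: "(nat \<Rightarrow> 'k::field) \<Rightarrow> 'k"
  where "lambda1 \<alpha> = - (\<alpha> 4 ^ 3 + 1) / N_of \<alpha> ^ 2"

definition H1 :: "(nat \<Rightarrow> 'k::field) \<Rightarrow> 'k mpoly"
  where "H1 \<alpha> =
    Const (\<alpha> 1 ^ 3 * \<alpha> 3 * \<alpha> 4 ^ 3 + \<alpha> 1 ^ 2 * \<alpha> 2 ^ 2 * \<alpha> 4 ^ 5 + \<alpha> 1 ^ 2 * \<alpha> 2 ^ 2 * \<alpha> 4 ^ 2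
      + 2 * \<alpha> 1 * \<alpha> 2 * \<alpha> 3 ^ 2 * \<alpha> 4 ^ 4 - \<alpha> 1 * \<alpha> 2 * \<alpha> 3 ^ 2 * \<alpha> 4
      - \<alpha> 2 ^ 3 * \<alpha> 3 + \<alpha> 3 ^ 4 * \<alpha> 4 ^ 3) * vx ^ 2
    + Const (\<alpha> 1 ^ 4 * \<alpha> 4 ^ 4 + 2 * \<alpha> 1 ^ 2 * \<alpha> 2 * \<alpha> 3 * \<alpha> 4 ^ 5 - \<alpha> 1 ^ 2 * \<alpha> 2 * \<alpha> 3 * \<alpha> 4 ^ 2
      + 2 * \<alpha> 1 * \<alpha> 2 ^ 3 * \<alpha> 4 ^ 4 + \<alpha> 1 * \<alpha> 2 ^ 3 * \<alpha> 4
      + 2 * \<alpha> 1 * \<alpha> 3 ^ 3 * \<alpha> 4 ^ 4 + \<alpha> 1 * \<alpha> 3 ^ 3 * \<alpha> 4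
      + 2 * \<alpha> 2 ^ 2 * \<alpha> 3 ^ 2 * \<alpha> 4 ^ 3 + 2 * \<alpha> 2 ^ 2 * \<alpha> 3 ^ 2) * vx * vz
    + Const (\<alpha> 1 ^ 3 * \<alpha> 2 * \<alpha> 4 ^ 3 + \<alpha> 1 ^ 2 * \<alpha> 3 ^ 2 * \<alpha> 4 ^ 5 + \<alpha> 1 ^ 2 * \<alpha> 3 ^ 2 * \<alpha> 4 ^ 2
      + 2 * \<alpha> 1 * \<alpha> 2 ^ 2 * \<alpha> 3 * \<alpha> 4 ^ 4 - \<alpha> 1 * \<alpha> 2 ^ 2 * \<alpha> 3 * \<alpha> 4
      + \<alpha> 2 ^ 4 * \<alpha> 4 ^ 3 - \<alpha> 2 * \<alpha> 3 ^ 3) * vz ^ 2"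

definition is_G1 :: "(nat \<Rightarrow> 'k::field) \<Rightarrow> 'k mpoly \<Rightarrow> bool"
  where "is_G1 \<alpha> G1 \<longleftrightarrow>
    binary_form 3 G1 \<and> G1 ^ 2 = F_sextic \<alpha> - 4 * Const (lambda1 \<alpha>) * H1 \<alpha> ^ 3"


section \<open>The projection and its discriminant\<close>

text \<open>Projection from \<open>(\<alpha>\<^sub>2 : \<alpha>\<^sub>3 : \<alpha>\<^sub>4)\<close> is the map
  \<open>(x : z) = (\<alpha>\<^sub>4 y\<^sub>3 - \<alpha>\<^sub>3 y\<^sub>4 : \<alpha>\<^sub>4 y\<^sub>2 - \<alpha>\<^sub>2 y\<^sub>4)\<close>; the fibre over \<open>(x : z)\<close> is the line of the points
  \<open>(z + w \<alpha>\<^sub>2 : x + w \<alpha>\<^sub>3 : w \<alpha>\<^sub>4)\<close>. On that line the plane cubic becomes the following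
  cubic equation in \<open>w\<close> over \<open>k[x, z]\<close>.\<close>

definition E_equation :: "(nat \<Rightarrow> 'k::field) \<Rightarrow> 'k mpoly poly"
  where "E_equation \<alpha> = subst_mpoly (\<lambda>c. [:Const c:])
    (\<lambda>i. [:(if i = 2 then vz else if i = 3 then vx else 0), Const (\<alpha> i):]) (E_cubic \<alpha>)"

definition cubic_discriminant :: "'r::comm_ring_1 poly \<Rightarrow> 'r"
  where "cubic_discriminant p = (let a = coeff p 3; b = coeff p 2; c = coeff p 1; d = coeff p 0 in
    b ^ 2 * c ^ 2 - 4 * a * c ^ 3 - 4 * b ^ 3 * d - 27 * a ^ 2 * d ^ 2 + 18 * a * b * c * d)"

definition cardano_equation :: "(nat \<Rightarrow> 'k::field) \<Rightarrow> 'k mpoly \<Rightarrow> 'k mpoly poly"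
  where "cardano_equation \<alpha> G1 =
    [:Const (lambda1 \<alpha>) * G1, 3 * Const (lambda1 \<alpha>) * H1 \<alpha>, 0, 1:]"


section \<open>Curves as function fields\<close>

text \<open>A smooth projective curve over \<open>k\<close> is represented by its function field, its closed points
  by the discrete valuations of that field, and a finite cover by a finite extension of function
  fields. All function fields are subfields of the algebraic closure of \<open>k(t)\<close>, where
  \<open>t = x/z\<close> is the coordinate of the projective line.\<close>

type_synonym 'k geo = "'k poly fract alg_closure"

abbreviation \<Omega> :: "'k::field geo ring"
  where "\<Omega> \<equiv> ring_of_type_algebra"

definition cst :: "'k::field \<Rightarrow> 'k geo"
  where "cst c = to_ac (Fract [:c:] 1)"

definition tt :: "'k::field geo"
  where "tt = to_ac (Fract [:0, 1:] 1)"

text \<open>The value of a binary form at the generic point \<open>(x : z) = (t : 1)\<close>.\<close>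

definition at_generic :: "'k::field mpoly \<Rightarrow> 'k geo"
  where "at_generic p = subst_mpoly cst (\<lambda>i. if i = 0 then tt else 1) p"

definition line_field :: "'k::field geo set"
  where "line_field = generate_field \<Omega> (insert tt (range cst))"

definition constants_closure :: "'k::field geo set"
  where "constants_closure = {c. \<exists>p :: 'k poly. p \<noteq> 0 \<and> poly (map_poly cst p) c = 0}"

abbreviation ext_degree :: "'k::field geo set \<Rightarrow> 'k geo set \<Rightarrow> nat \<Rightarrow> bool"
  where "ext_degree K L n \<equiv> ring.dimension \<Omega> n K L"

text \<open>Covers of the line are equivalent if their function fields are isomorphic over \<open>k(t)\<close>.\<close>

definition equivalent_covers :: "'k::field geo set \<Rightarrow> 'k geo set \<Rightarrow> bool"
  where "equivalent_covers K L \<longleftrightarrow>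
    (\<exists>h \<in> ring_iso (\<Omega>\<lparr>carrier := K\<rparr>) (\<Omega>\<lparr>carrier := L\<rparr>). \<forall>a\<in>line_field. h a = a)"

text \<open>Homogeneous coordinates of the geometric points of the plane cubic that lie over the
  generic point \<open>(t : 1)\<close> of the line. The residue field of such a point, generated by the ratios of
  its coordinates, is the function field of the plane cubic, together with its
  embedding of \<open>k(t)\<close> given by the projection.\<close>

definition E_generic_points :: "(nat \<Rightarrow> 'k::field) \<Rightarrow> (nat \<Rightarrow> 'k geo) set"
  where "E_generic_points \<alpha> = {\<eta>. subst_mpoly cst \<eta> (E_cubic \<alpha>) = 0 \<and>
    cst (\<alpha> 4) * \<eta> 2 - cst (\<alpha> 2) * \<eta> 4 \<noteq> 0 \<and>
    cst (\<alpha> 4) * \<eta> 3 - cst (\<alpha> 3) * \<eta> 4 = tt * (cst (\<alpha> 4) * \<eta> 2 - cst (\<alpha> 2) * \<eta> 4)}"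

definition E_field :: "(nat \<Rightarrow> 'k::field geo) \<Rightarrow> 'k geo set"
  where "E_field \<eta> =
    generate_field \<Omega> (range cst \<union> {\<eta> i / \<eta> j | i j. i \<in> {2, 3, 4} \<and> j \<in> {2, 3, 4} \<and> \<eta> j \<noteq> 0})"

definition equation_roots :: "'k::field mpoly poly \<Rightarrow> 'k geo set"
  where "equation_roots p = {w. poly (map_poly at_generic p) w = 0}"

definition equation_field :: "'k::field geo \<Rightarrow> 'k geo set"
  where "equation_field w = generate_field \<Omega> (insert w line_field)"

definition C_field :: "'k::field geo \<Rightarrow> 'k geo set"
  where "C_field y = generate_field \<Omega> (insert y line_field)"

text \<open>A pair of points of two covers over the generic point of the line gives a point of their fibre
  product; its residue field is the compositum.\<close>

definition compositum :: "'k::field geo set \<Rightarrow> 'k geo set \<Rightarrow> 'k geo set"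
  where "compositum K L = generate_field \<Omega> (K \<union> L)"


section \<open>Points, divisors and unramified covers\<close>

text \<open>Discrete valuations of \<open>K\<close> that are trivial on \<open>k\<close>, normalised to have value group the
  integers. The value at \<open>0\<close> is the dummy \<open>0\<close>, as are the values outside \<open>K\<close>.\<close>

definition places :: "'k::field geo set \<Rightarrow> ('k geo \<Rightarrow> int) set"
  where "places K = {v.
    (\<forall>x. x \<notin> K \<or> x = 0 \<longrightarrow> v x = 0) \<and>
    (\<forall>x\<in>K - {0}. \<forall>y\<in>K - {0}. v (x * y) = v x + v y) \<and>
    (\<forall>x\<in>K - {0}. \<forall>y\<in>K - {0}. x + y \<noteq> 0 \<longrightarrow> min (v x) (v y) \<le> v (x + y)) \<and>
    (\<forall>c. v (cst c) = 0) \<and>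
    (\<exists>x\<in>K. v x = 1)}"

definition vanishes :: "('k::field geo \<Rightarrow> int) \<Rightarrow> 'k geo \<Rightarrow> bool"
  where "vanishes v x \<longleftrightarrow> x = 0 \<or> 0 < v x"

definition ram_index :: "'k::field geo set \<Rightarrow> ('k geo \<Rightarrow> int) \<Rightarrow> nat"
  where "ram_index K Q = (LEAST e. 0 < e \<and> (\<exists>x\<in>K. Q x = int e))"

definition place_below :: "'k::field geo set \<Rightarrow> ('k geo \<Rightarrow> int) \<Rightarrow> ('k geo \<Rightarrow> int)"
  where "place_below K Q = (\<lambda>x. if x \<in> K then Q x div int (ram_index K Q) else 0)"

text \<open>An element of the residue field is separable over the smaller residue field iff it is
  a simple root of some polynomial; here everything is lifted to the valuation rings.\<close>

definition separable_residue :: "'k::field geo set \<Rightarrow> 'k geo set \<Rightarrow> ('k geo \<Rightarrow> int) \<Rightarrow> bool"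
  where "separable_residue K L Q \<longleftrightarrow> (\<forall>a\<in>L. 0 \<le> Q a \<longrightarrow>
    (\<exists>p. (\<forall>i. coeff p i \<in> K \<and> 0 \<le> Q (coeff p i)) \<and>
      vanishes Q (poly p a) \<and> \<not> vanishes Q (poly (pderiv p) a)))"

definition unramified :: "'k::field geo set \<Rightarrow> 'k geo set \<Rightarrow> bool"
  where "unramified K L \<longleftrightarrow> (\<forall>Q\<in>places L. ram_index K Q = 1 \<and> separable_residue K L Q)"

type_synonym 'k divisor = "('k geo \<Rightarrow> int) \<Rightarrow> int"

definition divisors :: "'k::field geo set \<Rightarrow> 'k divisor set"
  where "divisors K = {D. finite {P. D P \<noteq> 0} \<and> {P. D P \<noteq> 0} \<subseteq> places K}"

definition principal_divisor :: "'k::field geo set \<Rightarrow> 'k geo \<Rightarrow> 'k divisor"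
  where "principal_divisor K g = (\<lambda>P. if P \<in> places K then P g else 0)"

definition divisor_class :: "'k::field geo set \<Rightarrow> 'k divisor \<Rightarrow> 'k divisor set"
  where "divisor_class K A =
    {B \<in> divisors K. \<exists>g\<in>K - {0}. \<forall>P. B P = A P + principal_divisor K g P}"

definition pullback_divisor :: "'k::field geo set \<Rightarrow> 'k geo set \<Rightarrow> 'k divisor \<Rightarrow> 'k divisor"
  where "pullback_divisor K L A =
    (\<lambda>Q. if Q \<in> places L then int (ram_index K Q) * A (place_below K Q) else 0)"

definition capitalizes :: "'k::field geo set \<Rightarrow> 'k geo set \<Rightarrow> 'k divisor set set \<Rightarrow> bool"
  where "capitalizes K L S \<longleftrightarrow>
    (\<forall>c\<in>S. \<forall>A\<in>c. \<exists>g\<in>L - {0}. pullback_divisor K L A = principal_divisor L g)"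

text \<open>The subgroup of the divisor class group generated by the class of \<open>A\<close>. It is used
  for torsion classes only; these have degree zero, so it then is a subgroup of the Jacobian.\<close>

definition generated_class_group :: "'k::field geo set \<Rightarrow> 'k divisor \<Rightarrow> 'k divisor set set"
  where "generated_class_group K A = {divisor_class K (\<lambda>P. n * A P) | n. True}"


section \<open>The order 3 subgroup attached to the plane\<close>

text \<open>The fibre of the hyperelliptic map over \<open>z = 0\<close>. On \<open>y\<^sup>2 = F(x, z)\<close> it is the divisor of the
  regular differential \<open>d(x/z) / (y/z\<^sup>3)\<close>, hence a canonical divisor.\<close>

definition kappa :: "'k::field geo set \<Rightarrow> 'k divisor"
  where "kappa K = (\<lambda>P. if P \<in> places K then max 0 (- P tt) else 0)"

text \<open>From \<open>(y - G\<^sub>1) (y + G\<^sub>1) = 4 \<lambda>\<^sub>1 H\<^sub>1\<^sup>3\<close>, the zero divisor of the section \<open>y - G\<^sub>1\<close> of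
  the third power of the line bundle of the fibres is \<open>3D\<close>, where \<open>D\<close> plus its hyperelliptic conjugate
  is the pullback of the zero divisor of \<open>H\<^sub>1\<close>: so \<open>D\<close> has degree 2 and pushes forward
  to that zero divisor. Changing the sign of \<open>G\<^sub>1\<close> (or of \<open>y\<close>) replaces \<open>D - \<kappa>\<close> by its inverse.\<close>

definition is_J_divisor :: "'k::field geo \<Rightarrow> 'k mpoly \<Rightarrow> 'k divisor \<Rightarrow> bool"
  where "is_J_divisor y G1 D \<longleftrightarrow> D \<in> divisors (C_field y) \<and> (\<forall>P. 0 \<le> D P) \<and>
    (\<forall>P. 3 * (D P - kappa (C_field y) P) = principal_divisor (C_field y) (y - at_generic G1) P)"

definition J_subgroup :: "'k::field geo \<Rightarrow> 'k divisor \<Rightarrow> 'k divisor set set"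
  where "J_subgroup y D =
    generated_class_group (C_field y) (\<lambda>P. D P - kappa (C_field y) P)"

text \<open>Uniqueness is geometric: over a field that is not algebraically closed,
  such a cover may be replaced by a twist.\<close>

definition is_the_capitalizing_cover ::
    "'k::field geo set \<Rightarrow> 'k geo set \<Rightarrow> 'k divisor set set \<Rightarrow> bool"
  where "is_the_capitalizing_cover K L S \<longleftrightarrow>
    ext_degree K L 3 \<and> unramified K L \<and> capitalizes K L S \<and>
    (\<forall>L'. subfield L' \<Omega> \<and> K \<subseteq> L' \<and> ext_degree K L' 3 \<and> unramified K L' \<and> capitalizes K L' S \<longrightarrow>
      compositum constants_closure L' = compositum constants_closure L)"

end

theory Submission
  imports Defs
begin

text \<open>
  Let \<open>\<alpha>\<^sub>0 = 1\<close>, \<open>u = 1 + \<alpha>\<^sub>1\<^sup>3\<close> and \<open>v = 1 + \<alpha>\<^sub>4\<^sup>3\<close>. On the line of the points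
  \<open>(z + w \<alpha>\<^sub>2 : x + w \<alpha>\<^sub>3 : w \<alpha>\<^sub>4)\<close> a substitution \<open>X = b - u w\<close> turns the plane cubic into a depressed cubic
  \<open>X\<^sup>3 + 3 p X + q\<close>, and the equation of the quartic gives \<open>H\<^sub>1 = - v p\<close>, \<open>F = (v / u)\<^sup>2 (q\<^sup>2 + 4 p\<^sup>3)\<close> and
  \<open>G\<^sub>1 = \<plusminus> (v / u) q\<close>.

  Over the function field \<open>K\<close> of \<open>C\<close>, the cubic is solved by Cardano's formula: with \<open>\<rho>\<^sup>2 = q\<^sup>2 + 4 p\<^sup>3\<close> and
  \<open>A = (\<rho> - q) / 2\<close> the fibre product has function field \<open>K(a)\<close>, \<open>a\<^sup>3 = A\<close>, and \<open>y - G\<^sub>1\<close> is a constant multiple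
  of \<open>A\<close>. Off the Hessian, \<open>p\<close> and \<open>q\<close> have no common zero; as \<open>A (A + q) = p\<^sup>3\<close>, the divisor of \<open>A\<close>
  is divisible by 3. So \<open>K(a)\<close> is unramified over \<open>K\<close>, and \<open>a\<close> trivializes the class of \<open>D - \<kappa>\<close>. That class
  is not trivial, because the smooth plane cubic contains no line and hence \<open>A\<close> is not a cube, even
  geometrically. Conversely, if the pullback of \<open>D - \<kappa>\<close> to some other cover is the divisor of \<open>g\<close>, then \<open>g\<^sup>3 / A\<close>
  has neither zeros nor poles. By Chevalley's extension theorem it is a constant, so the two covers agree
  geometrically.
\<close>

section \<open>Substitution and differentiation of polynomials\<close>

text \<open>The equation of the quartic says that the plane cubic takes the value \<open>- u\<close>
  at the projection centre. So the centre lies off the cubic, the cubic in \<open>w\<close> has a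
  constant leading coefficient, and its roots are integral over k[x, z].

  In characteristic other than 2 and 3 the Hessian, at a point of the quartic with first coordinate
  1, is -9 times the product of the four factors \<open>1 + \<alpha> i ^ 3\<close>. The factor i = 1
  makes the plane cubic smooth. The other three keep the centre off the tangents at the inflection
  points, which lie on the sides of the coordinate triangle; a common zero of \<open>p\<close> and
  \<open>q\<close> would be such a tangent.

  The base field is arbitrary, so residue fields of places may be proper extensions of k. As the
  degrees involved are at most 3, separability follows from the characteristic alone. Places are
  handled through values; where an actual point is wanted, it is taken in the algebraic closure.

  The valuation ring behind Chevalley's theorem is not known to be discrete beforehand. It becomes
  so by comparing twelfth powers of its elements with elements of k(t).\<close>

definition eval_mon :: "(nat \<Rightarrow> 'r::comm_ring_1) \<Rightarrow> (nat \<Rightarrow>\<^sub>0 nat) \<Rightarrow> 'r"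
  where "eval_mon a m = (\<Prod>i\<in>Poly_Mapping.keys m. a i ^ Poly_Mapping.lookup m i)"

lemma eval_mon_superset:
  assumes "finite S" "Poly_Mapping.keys m \<subseteq> S"
  shows "eval_mon a m = (\<Prod>i\<in>S. a i ^ Poly_Mapping.lookup m i)"
  unfolding eval_mon_def
  by (rule prod.mono_neutral_left[OF assms]) (auto simp: in_keys_iff)

lemma eval_mon_zero [simp]: "eval_mon a 0 = 1"
  by (simp add: eval_mon_def)

lemma eval_mon_single [simp]: "eval_mon a (Poly_Mapping.single i n) = a i ^ n"
  by (cases "n = 0") (auto simp: eval_mon_def)

lemma eval_mon_add: "eval_mon a (m + n) = eval_mon a m * eval_mon a n"
proof -
  let ?S = "Poly_Mapping.keys m \<union> Poly_Mapping.keys n"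
  have "eval_mon a (m + n) = (\<Prod>i\<in>?S. a i ^ Poly_Mapping.lookup (m + n) i)"
    by (rule eval_mon_superset) (use Poly_Mapping.keys_add[of m n] in auto)
  also have "\<dots> = eval_mon a m * eval_mon a n"
    by (simp add: lookup_add power_add prod.distrib eval_mon_superset[of ?S])
  finally show ?thesis .
qed

context comm_ring_hom
begin

text \<open>Cancellation can make the support of a sum smaller than the union of the supports, so
  sums over \<open>keys\<close> are first extended to a common index set. The same device serves for
  \<open>eval_mon\<close> and \<open>pdiff\<close>.\<close>

lemma subst_mpoly_superset:
  assumes "finite S" "Poly_Mapping.keys p \<subseteq> S"
  shows "subst_mpoly hom a p = (\<Sum>m\<in>S. hom (Poly_Mapping.lookup p m) * eval_mon a m)"
  unfolding subst_mpoly_def eval_mon_def[symmetric]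
  by (rule sum.mono_neutral_left[OF assms]) (auto simp: in_keys_iff)

lemma subst_mpoly_single:
  "subst_mpoly hom a (Poly_Mapping.single m c) = hom c * eval_mon a m"
  by (subst subst_mpoly_superset[of "{m}"]) auto

lemma subst_mpoly_add: "subst_mpoly hom a (p + q) = subst_mpoly hom a p + subst_mpoly hom a q"
proof -
  let ?S = "Poly_Mapping.keys p \<union> Poly_Mapping.keys q"
  have "subst_mpoly hom a (p + q) = (\<Sum>m\<in>?S. hom (Poly_Mapping.lookup (p + q) m) * eval_mon a m)"
    by (rule subst_mpoly_superset) (use Poly_Mapping.keys_add[of p q] in auto)
  also have "\<dots> = subst_mpoly hom a p + subst_mpoly hom a q"
    by (simp add: lookup_add hom_add algebra_simps sum.distrib subst_mpoly_superset[of ?S])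
  finally show ?thesis .
qed

lemma subst_mpoly_zero: "subst_mpoly hom a 0 = 0"
  by (simp add: subst_mpoly_def)

lemma subst_mpoly_sum: "subst_mpoly hom a (sum f A) = (\<Sum>x\<in>A. subst_mpoly hom a (f x))"
  by (induction A rule: infinite_finite_induct) (auto simp: subst_mpoly_add subst_mpoly_zero)

lemma subst_mpoly_mult: "subst_mpoly hom a (p * q) = subst_mpoly hom a p * subst_mpoly hom a q"
proof -
  \<comment> \<open>Both factors are written as sums of monomials; bilinearity then leaves only
    \<open>mult_single\<close>.\<close>
  define M where "M p = (\<Sum>m\<in>Poly_Mapping.keys p. Poly_Mapping.single m (Poly_Mapping.lookup p m))"
    for p :: "'a mpoly"
  have M: "M p = p" for p
    by (rule poly_mapping_eqI) (auto simp: M_def lookup_sum lookup_single when_def in_keys_iff)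
  have "subst_mpoly hom a (M p * M q) = subst_mpoly hom a (M p) * subst_mpoly hom a (M q)"
    by (simp add: M_def sum_product mult_single subst_mpoly_sum subst_mpoly_single eval_mon_add
      hom_mult algebra_simps)
  then show ?thesis by (simp add: M)
qed

lemma subst_mpoly_one: "subst_mpoly hom a 1 = 1"
  using subst_mpoly_single[of a 0 1] by simp

lemma subst_mpoly_comm_ring_hom: "comm_ring_hom (subst_mpoly hom a)"
  by unfold_locales (auto simp: subst_mpoly_add subst_mpoly_mult subst_mpoly_one subst_mpoly_zero)

lemma subst_mpoly_Var: "subst_mpoly hom a (Var i) = a i"
  by (simp add: Var_def subst_mpoly_single)

lemma subst_mpoly_Const: "subst_mpoly hom a (Const c) = hom c"
  by (simp add: Const_def subst_mpoly_single)

end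

interpretation Const: comm_ring_hom Const
  by unfold_locales (auto simp: Const_def single_add mult_single)

lemma mpoly_sum_monomials:
  "(\<Sum>m\<in>Poly_Mapping.keys p. Poly_Mapping.single m (Poly_Mapping.lookup p m)) = p"
  by (rule poly_mapping_eqI) (auto simp: lookup_sum lookup_single when_def in_keys_iff)

lemma pdiff_superset:
  assumes "finite S" "Poly_Mapping.keys p \<subseteq> S"
  shows "pdiff i p = (\<Sum>m\<in>S. Poly_Mapping.single (m - Poly_Mapping.single i 1)
      (of_nat (Poly_Mapping.lookup m i) * Poly_Mapping.lookup p m))"
  unfolding pdiff_def
  by (rule sum.mono_neutral_left[OF assms]) (auto simp: in_keys_iff)

lemma pdiff_single: "pdiff i (Poly_Mapping.single m c) =
    Poly_Mapping.single (m - Poly_Mapping.single i 1) (of_nat (Poly_Mapping.lookup m i) * c)"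
  by (subst pdiff_superset[of "{m}"]) auto

lemma pdiff_add: "pdiff i (p + q) = pdiff i p + pdiff i q"
proof -
  let ?S = "Poly_Mapping.keys p \<union> Poly_Mapping.keys q"
  have "pdiff i (p + q) = (\<Sum>m\<in>?S. Poly_Mapping.single (m - Poly_Mapping.single i 1)
      (of_nat (Poly_Mapping.lookup m i) * Poly_Mapping.lookup (p + q) m))"
    by (rule pdiff_superset) (use Poly_Mapping.keys_add[of p q] in auto)
  also have "\<dots> = pdiff i p + pdiff i q"
    by (simp add: lookup_add algebra_simps sum.distrib single_add pdiff_superset[of ?S])
  finally show ?thesis .
qed

lemma pdiff_zero: "pdiff i 0 = 0"
  by (simp add: pdiff_def)

lemma pdiff_sum: "pdiff i (sum f A) = (\<Sum>x\<in>A. pdiff i (f x))"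
  by (induction A rule: infinite_finite_induct) (auto simp: pdiff_add pdiff_zero)

lemma diff_single_add:
  fixes m n :: "nat \<Rightarrow>\<^sub>0 nat"
  assumes "Poly_Mapping.lookup m i \<noteq> 0"
  shows "m + n - Poly_Mapping.single i 1 = (m - Poly_Mapping.single i 1) + n"
  using assms by (intro poly_mapping_eqI) (auto simp: lookup_add lookup_minus lookup_single when_def)

text \<open>Subtraction of exponents is truncated. It shifts correctly only where the variable i
  occurs; elsewhere the coefficient \<open>of_nat 0\<close> removes the term. Hence the four
  cases.\<close>

lemma pdiff_mult_single:
  "pdiff i (Poly_Mapping.single m c * Poly_Mapping.single n d) =
    pdiff i (Poly_Mapping.single m c) * Poly_Mapping.single n d
    + Poly_Mapping.single m c * pdiff i (Poly_Mapping.single n d)"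
  using diff_single_add[of m i n] diff_single_add[of n i m]
  by (cases "Poly_Mapping.lookup m i = 0"; cases "Poly_Mapping.lookup n i = 0")
    (auto simp: mult_single pdiff_single lookup_add algebra_simps single_add[symmetric])

lemma pdiff_mult: "pdiff i (p * q) = pdiff i p * q + p * pdiff i q"
proof -
  define M where "M p = (\<Sum>m\<in>Poly_Mapping.keys p. Poly_Mapping.single m (Poly_Mapping.lookup p m))"
    for p :: "'a mpoly"
  have "pdiff i (M p * M q) = pdiff i (M p) * M q + M p * pdiff i (M q)"
    by (simp add: M_def sum_product pdiff_sum pdiff_mult_single sum.distrib)
  then show ?thesis by (simp add: M_def mpoly_sum_monomials)
qed

lemma pdiff_Const [simp]: "pdiff i (Const c) = 0"
  by (simp add: Const_def pdiff_single)

lemma pdiff_one [simp]: "pdiff i 1 = 0"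
  using pdiff_Const[of i 1] by simp

lemma pdiff_numeral [simp]: "pdiff i (numeral k) = 0"
  using pdiff_Const[of i "numeral k"] by (simp add: Const.hom_numeral)

lemma pdiff_Var: "pdiff i (Var j) = (if i = j then 1 else 0)"
  by (auto simp: Var_def pdiff_single lookup_single when_def)

lemma pdiff_power: "pdiff i (p ^ n) = of_nat n * p ^ (n - 1) * pdiff i p"
proof (induction n)
  case (Suc n)
  then show ?case by (cases n) (auto simp: pdiff_mult algebra_simps)
qed simp

lemmas pdiff_simps = pdiff_add pdiff_mult pdiff_power pdiff_Var

lemma pdiff_burkhardt:
  "pdiff 0 burkhardt = 4 * Var 0 ^ 3 + Var 1 ^ 3 + Var 2 ^ 3 + Var 3 ^ 3 + Var 4 ^ 3"
  "pdiff 1 burkhardt = 3 * Var 0 * Var 1 ^ 2 + 3 * Var 2 * Var 3 * Var 4"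
  "pdiff 2 burkhardt = 3 * Var 0 * Var 2 ^ 2 + 3 * Var 1 * Var 3 * Var 4"
  "pdiff 3 burkhardt = 3 * Var 0 * Var 3 ^ 2 + 3 * Var 1 * Var 2 * Var 4"
  "pdiff 4 burkhardt = 3 * Var 0 * Var 4 ^ 2 + 3 * Var 1 * Var 2 * Var 3"
  by (simp_all add: burkhardt_def pdiff_simps, simp_all add: algebra_simps power2_eq_square power3_eq_cube)

lemma restrict_to_J_cubic_polar: "restrict_to_J (cubic_polar \<alpha>) = E_cubic \<alpha>"
proof -
  interpret S: comm_ring_hom "subst_mpoly Const (\<lambda>i. if i < 2 then 0 else Var i :: 'a mpoly)"
    by (rule Const.subst_mpoly_comm_ring_hom)
  have *: "{..4::nat} = {0,1,2,3,4}" by auto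
  show ?thesis
    unfolding restrict_to_J_def cubic_polar_def E_cubic_def *
    by (simp add: pdiff_burkhardt[unfolded One_nat_def] S.hom_add S.hom_mult S.hom_power S.hom_numeral Const.subst_mpoly_Var
      Const.subst_mpoly_Const)
qed

section \<open>Identities on the quartic\<close>

text \<open>Makes the denominator \<open>N_of\<close> of \<open>lambda1\<close> a product of two of
  the factors of the Hessian.\<close>

lemma burkhardt_N:
  fixes a1 a2 a3 a4 :: "'r::idom"
  assumes "1 + a1^3 + a2^3 + a3^3 + a4^3 + 3*a1*a2*a3*a4 = 0"
  shows "a1^3 * a4^3 - 3*a1*a2*a3*a4 - a2^3 - a3^3 = (1 + a1^3) * (1 + a4^3)"
  using assms by Groebner_Basis.algebra

text \<open>On a projecting line the plane cubic is a w^3 + 3 b w^2 + 3 c w + d. On the quartic a =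
  -(1 + a1^3), so the second factor on the right is b^2 - a c.\<close>

lemma burkhardt_H1:
  fixes a1 a2 a3 a4 x z :: "'r::idom"
  assumes "1 + a1^3 + a2^3 + a3^3 + a4^3 + 3*a1*a2*a3*a4 = 0"
  shows "(a1^3*a3*a4^3 + a1^2*a2^2*a4^5 + a1^2*a2^2*a4^2 + 2*a1*a2*a3^2*a4^4
      - a1*a2*a3^2*a4 - a2^3*a3 + a3^4*a4^3) * x^2
    + (a1^4*a4^4 + 2*a1^2*a2*a3*a4^5 - a1^2*a2*a3*a4^2 + 2*a1*a2^3*a4^4 + a1*a2^3*a4
      + 2*a1*a3^3*a4^4 + a1*a3^3*a4 + 2*a2^2*a3^2*a4^3 + 2*a2^2*a3^2) * x * z
    + (a1^3*a2*a4^3 + a1^2*a3^2*a4^5 + a1^2*a3^2*a4^2 + 2*a1*a2^2*a3*a4^4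
      - a1*a2^2*a3*a4 + a2^4*a4^3 - a2*a3^3) * z^2
    = (1 + a4^3) * ((a2^2*z + a3^2*x + a1*a4*(a2*x + a3*z))^2
        + (1 + a1^3) * (a2*z^2 + a3*x^2 + a1*a4*x*z))"
  using assms by Groebner_Basis.algebra

text \<open>The last factor is -1/27 of the discriminant of a w^3 + 3 b w^2 + 3 c w + d, the cubic
  on a projecting line.\<close>

lemma burkhardt_F:
  fixes a1 a2 a3 a4 x z :: "'r::idom"
  assumes "1 + a1^3 + a2^3 + a3^3 + a4^3 + 3*a1*a2*a3*a4 = 0"
  defines "b \<equiv> a2^2*z + a3^2*x + a1*a4*(a2*x + a3*z)"
    and "c \<equiv> a2*z^2 + a3*x^2 + a1*a4*x*z"
    and "d \<equiv> x^3 + z^3"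
    and "a \<equiv> a2^3 + a3^3 + a4^3 + 3*a1*a2*a3*a4"
  shows "((a1^3*a4^3 + 3*a1*a2*a3*a4^4 + 2*a2^3*a4^3 + a2^3 + a3^3*a4^3) * x^3
      + (3*a2*(a4^3 + 1)*(a1^2*a4^2 - a2*a3)) * x^2 * z
      - (3*a3*(a4^3 + 1)*(a1^2*a4^2 - a2*a3)) * x * z^2
      + (-2*a1^3*a4^6 - a1^3*a4^3 + 3*a1*a2*a3*a4^4 + a2^3*a4^3 - a3^3) * z^3)^2
    + 4 * (a4^3*(a4^3 + 1)*(a1^3*a4^3 - 3*a1*a2*a3*a4 - a2^3 - a3^3))
      * (a2*x^2 - a3*x*z - a1*a4*z^2)^3
    = (1 + a4^3)^2 * (a^2*d^2 - 6*a*b*c*d + 4*a*c^3 + 4*b^3*d - 3*b^2*c^2)"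
  using assms(1) unfolding assms(2-5) by Groebner_Basis.algebra

section \<open>The Hessian on the quartic\<close>

lemma det_mat_Suc:
  "Determinant.det (Matrix.mat (Suc n) (Suc n) f) =
    (\<Sum>j<Suc n. f (0, j) * ((-1) ^ j *
      Determinant.det (Matrix.mat n n (\<lambda>(i, k). f (Suc i, if k < j then k else Suc k)))))"
proof -
  let ?A = "Matrix.mat (Suc n) (Suc n) f"
  have "mat_delete ?A 0 j = Matrix.mat n n (\<lambda>(i, k). f (Suc i, if k < j then k else Suc k))" for j
    unfolding mat_delete_def by (rule eq_matI) auto
  then show ?thesis
    using laplace_expansion_row[of ?A "Suc n" 0] by (simp add: cofactor_def)
qed

text \<open>The second derivatives of the quartic at (1 : a1 : a2 : a3 : a4), row by row.\<close>

definition hess_rows :: "'r::comm_ring_1 \<Rightarrow> 'r \<Rightarrow> 'r \<Rightarrow> 'r \<Rightarrow> 'r list list" where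
  "hess_rows a1 a2 a3 a4 =
     [[12, 3*a1^2, 3*a2^2, 3*a3^2, 3*a4^2],
      [3*a1^2, 6*a1, 3*a3*a4, 3*a2*a4, 3*a2*a3],
      [3*a2^2, 3*a3*a4, 6*a2, 3*a1*a4, 3*a1*a3],
      [3*a3^2, 3*a2*a4, 3*a1*a4, 6*a3, 3*a1*a2],
      [3*a4^2, 3*a2*a3, 3*a1*a3, 3*a1*a2, 6*a4]]"

lemma det_mat_3: "Determinant.det (Matrix.mat 3 3 f) =
   f (0,0) * (f (1,1) * f (2,2) - f (1,2) * f (2,1)) - f (0,1) * (f (1,0) * f (2,2) - f (1,2) * f (2,0))
   + f (0,2) * (f (1,0) * f (2,1) - f (1,1) * f (2,0))"
  unfolding numeral_3_eq_3
  by (simp add: det_mat_Suc numeral_2_eq_2 algebra_simps)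

lemma det_mat_4: "Determinant.det (Matrix.mat 4 4 f) =
   f (0,0) * Determinant.det (Matrix.mat 3 3 (\<lambda>(i, j). f (Suc i, Suc j)))
   - f (0,1) * Determinant.det (Matrix.mat 3 3 (\<lambda>(i, j). f (Suc i, if j < 1 then j else Suc j)))
   + f (0,2) * Determinant.det (Matrix.mat 3 3 (\<lambda>(i, j). f (Suc i, if j < 2 then j else Suc j)))
   - f (0,3) * Determinant.det (Matrix.mat 3 3 (\<lambda>(i, j). f (Suc i, if j < 3 then j else Suc j)))"
  using det_mat_Suc[of 3 f] by (simp add: eval_nat_numeral)

lemma det_mat_5: "Determinant.det (Matrix.mat 5 5 f) =
   f (0,0) * Determinant.det (Matrix.mat 4 4 (\<lambda>(i, j). f (Suc i, Suc j)))
   - f (0,1) * Determinant.det (Matrix.mat 4 4 (\<lambda>(i, j). f (Suc i, if j < 1 then j else Suc j)))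
   + f (0,2) * Determinant.det (Matrix.mat 4 4 (\<lambda>(i, j). f (Suc i, if j < 2 then j else Suc j)))
   - f (0,3) * Determinant.det (Matrix.mat 4 4 (\<lambda>(i, j). f (Suc i, if j < 3 then j else Suc j)))
   + f (0,4) * Determinant.det (Matrix.mat 4 4 (\<lambda>(i, j). f (Suc i, if j < 4 then j else Suc j)))"
  using det_mat_Suc[of 4 f] by (simp add: eval_nat_numeral)

lemma nth_numerals: "nth (x # xs) 1 = nth xs 0" "nth (x # xs) 2 = nth xs 1" "nth (x # xs) 3 = nth xs 2" "nth (x # xs) 4 = nth xs 3"
  by (simp_all add: eval_nat_numeral)

lemma less_numerals: "(0::nat) < 1" "(0::nat) < 2" "(0::nat) < 3" "(0::nat) < 4" "(1::nat) < 2" "(1::nat) < 3" "(1::nat) < 4"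
  "(2::nat) < 3" "(2::nat) < 4" "(3::nat) < 4" "\<not> (1::nat) < 1" "\<not> (2::nat) < 1" "\<not> (2::nat) < 2" "\<not> (3::nat) < 1" "\<not> (3::nat) < 2" "\<not> (3::nat) < 3"
  "Suc 0 = 1" "Suc 1 = 2" "Suc 2 = 3" "Suc 3 = 4" by auto

lemma burkhardt_hessian_matrix: fixes a1 :: "'r::idom"
  assumes "1 + a1^3 + a2^3 + a3^3 + a4^3 + 3*a1*a2*a3*a4 = 0"
  shows "Determinant.det (Matrix.mat 5 5 (\<lambda>(i, j). nth (nth (hess_rows a1 a2 a3 a4) i) j)) =
   - 4374 * ((1 + a1^3) * (1 + a2^3) * (1 + a3^3) * (1 + a4^3))"
proof -
  \<comment> \<open>The long factor is the quotient of the difference of the two sides by the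
    quartic. With it written out, the equation is an identity in free variables.\<close>
  have "Determinant.det (Matrix.mat 5 5 (\<lambda>(i, j). nth (nth (hess_rows a1 a2 a3 a4) i) j)) =
   - 4374 * ((1 + a1^3) * (1 + a2^3) * (1 + a3^3) * (1 + a4^3)) + (- 486*a1^4*a2*a3*a4 + 486*a1^3*a2^3 + 486*a1^3*a3^3 + 486*a1^3*a4^3 + 1458*a1^2*a2^2*a3^2*a4^2 - 486*a1*a2^4*a3*a4 - 486*a1*a2*a3^4*a4 - 486*a1*a2*a3*a4^4 + 2430*a1*a2*a3*a4 + 486*a2^3*a3^3 + 486*a2^3*a4^3 + 486*a3^3*a4^3 + 4374) * (1 + a1^3 + a2^3 + a3^3 + a4^3 + 3*a1*a2*a3*a4)"
    unfolding hess_rows_def det_mat_5 det_mat_4 det_mat_3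
    apply (simp only: prod.case if_True if_False less_numerals nth_numerals nth_Cons_0)
    by Groebner_Basis.algebra
  then show ?thesis using assms by simp
qed

section \<open>Binary forms\<close>

lemma binary_form_add: "binary_form n p \<Longrightarrow> binary_form n q \<Longrightarrow> binary_form n (p + q)"
  using Poly_Mapping.keys_add[of p q] unfolding binary_form_def by blast

lemma binary_form_mult:
  assumes "binary_form m p" "binary_form n q"
  shows "binary_form (m + n) (p * q)"
  unfolding binary_form_def
proof
  fix k assume "k \<in> Poly_Mapping.keys (p * q)"
  then obtain a b where k: "k = a + b" "a \<in> Poly_Mapping.keys p" "b \<in> Poly_Mapping.keys q"
    using keys_mult[of p q] by blast
  then show "Poly_Mapping.keys k \<subseteq> {0, 1} \<and> Poly_Mapping.lookup k 0 + Poly_Mapping.lookup k 1 = m + n"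
    using assms Poly_Mapping.keys_add[of a b] unfolding binary_form_def k(1) lookup_add by fastforce
qed

lemma binary_form_Const: "binary_form 0 (Const c)"
  by (auto simp: binary_form_def Const_def)

lemma binary_form_Var: "i < 2 \<Longrightarrow> binary_form 1 (Var i :: 'k::comm_ring_1 mpoly)"
  by (auto simp: binary_form_def Var_def lookup_single when_def)

lemma binary_form_Const_mult: "binary_form n p \<Longrightarrow> binary_form n (Const c * p)"
  using binary_form_mult[OF binary_form_Const, of n p c] by simp

lemma binary_form_power: "binary_form n p \<Longrightarrow> binary_form (k * n) (p ^ k)"
  for p :: "'k::comm_ring_1 mpoly"
proof (induction k)
  case 0
  then show ?case using binary_form_Const[of 1] by simp
next
  case (Suc k)
  then show ?case using binary_form_mult[of n p "k * n" "p ^ k"] by simp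
qed

interpretation id_hom: comm_ring_hom "id :: 'k::comm_ring_1 \<Rightarrow> 'k"
  by unfold_locales auto

lemma pdiff_pdiff_burkhardt:
  fixes \<alpha> :: "nat \<Rightarrow> 'k::comm_ring_1"
  assumes "\<alpha> 0 = 1" "i < 5" "j < 5"
  shows "subst_mpoly id \<alpha> (pdiff i (pdiff j burkhardt)) =
    nth (nth (hess_rows (\<alpha> 1) (\<alpha> 2) (\<alpha> 3) (\<alpha> 4)) i) j"
proof -
  interpret S: comm_ring_hom "subst_mpoly id \<alpha>"
    by (rule id_hom.subst_mpoly_comm_ring_hom)
  have 5: "i \<in> {0,1,2,3,4}" "j \<in> {0,1,2,3,4}" using assms by auto
  show ?thesis
    using 5 unfolding insert_iff empty_iff
    by (elim disjE FalseE; simp only: pdiff_burkhardt hess_rows_def nth_numerals nth_Cons_0)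
      (simp_all add: pdiff_simps S.hom_add S.hom_mult S.hom_power S.hom_numeral
        id_hom.subst_mpoly_Var assms(1) power2_eq_square algebra_simps)
qed

lemma subst_burkhardt:
  "\<alpha> 0 = 1 \<Longrightarrow> subst_mpoly id \<alpha> burkhardt =
    1 + \<alpha> 1^3 + \<alpha> 2^3 + \<alpha> 3^3 + \<alpha> 4^3 + 3 * \<alpha> 1 * \<alpha> 2 * \<alpha> 3 * \<alpha> 4"
proof -
  interpret S: comm_ring_hom "subst_mpoly id \<alpha>"
    by (rule id_hom.subst_mpoly_comm_ring_hom)
  show "\<alpha> 0 = 1 \<Longrightarrow> ?thesis"
    by (simp add: burkhardt_def S.hom_add S.hom_mult S.hom_power S.hom_numeral id_hom.subst_mpoly_Var)
qed

text \<open>Substitution commutes with determinants, so the entries may be evaluated first. Outside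
  characteristic 2 and 3 the scalar is -4374/486 = -9.\<close>

lemma subst_burkhardt_hessian:
  fixes \<alpha> :: "nat \<Rightarrow> 'k::field"
  assumes "\<alpha> 0 = 1" "subst_mpoly id \<alpha> burkhardt = 0"
  shows "subst_mpoly id \<alpha> burkhardt_hessian =
    1 / 486 * (- 4374 * ((1 + \<alpha> 1^3) * (1 + \<alpha> 2^3) * (1 + \<alpha> 3^3) * (1 + \<alpha> 4^3)))"
proof -
  interpret S: comm_ring_hom "subst_mpoly id \<alpha>"
    by (rule id_hom.subst_mpoly_comm_ring_hom)
  have "map_mat (subst_mpoly id \<alpha>) (Matrix.mat 5 5 (\<lambda>(i, j). pdiff i (pdiff j burkhardt))) =
      Matrix.mat 5 5 (\<lambda>(i, j). nth (nth (hess_rows (\<alpha> 1) (\<alpha> 2) (\<alpha> 3) (\<alpha> 4)) i) j)"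
    by (rule eq_matI) (simp_all add: pdiff_pdiff_burkhardt assms)
  moreover have "1 + \<alpha> 1^3 + \<alpha> 2^3 + \<alpha> 3^3 + \<alpha> 4^3 + 3 * \<alpha> 1 * \<alpha> 2 * \<alpha> 3 * \<alpha> 4 = 0"
    using subst_burkhardt[of \<alpha>] assms by simp
  ultimately show ?thesis
    unfolding burkhardt_hessian_def S.hom_mult S.hom_det[symmetric] id_hom.subst_mpoly_Const
    by (simp only: burkhardt_hessian_matrix id_apply)
qed

section \<open>The cubic in w, its discriminant and the form G1\<close>

lemma E_equation_eq:
  fixes \<alpha> :: "nat \<Rightarrow> 'k::field"
  assumes "\<alpha> 0 = 1"
  shows "E_equation \<alpha> =
    [:Var 0 ^ 3 + Var 1 ^ 3,
      3 * (Const (\<alpha> 2) * Var 1 ^ 2 + Const (\<alpha> 3) * Var 0 ^ 2 + Const (\<alpha> 1) * Const (\<alpha> 4) * Var 0 * Var 1),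
      3 * (Const (\<alpha> 2) ^ 2 * Var 1 + Const (\<alpha> 3) ^ 2 * Var 0
        + Const (\<alpha> 1) * Const (\<alpha> 4) * (Const (\<alpha> 2) * Var 0 + Const (\<alpha> 3) * Var 1)),
      Const (\<alpha> 2) ^ 3 + Const (\<alpha> 3) ^ 3 + Const (\<alpha> 4) ^ 3
        + 3 * Const (\<alpha> 1) * Const (\<alpha> 2) * Const (\<alpha> 3) * Const (\<alpha> 4):]"
proof -
  interpret C: comm_ring_hom "\<lambda>c. [:Const c:] :: 'k mpoly poly"
    by unfold_locales (simp_all add: Const.hom_add Const.hom_mult one_pCons)
  let ?a = "\<lambda>i. [:(if i = 2 then vz else if i = 3 then vx else 0), Const (\<alpha> i):] :: 'k mpoly poly"
  interpret S: comm_ring_hom "subst_mpoly (\<lambda>c. [:Const c:]) ?a"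
    by (rule C.subst_mpoly_comm_ring_hom)
  have [simp]: "numeral n = [:numeral n :: 'k mpoly:]" for n
    by (simp add: numeral_poly)
  show ?thesis
    unfolding E_equation_def E_cubic_def
    by (simp only: S.hom_add S.hom_mult S.hom_power S.hom_numeral C.subst_mpoly_Var
      C.subst_mpoly_Const assms)
      (simp add: power3_eq_cube power2_eq_square algebra_simps)
qed

text \<open>The factor -27 is -3 times a square and the denominator is a square: the discriminant
  curve is the quadratic twist of C by -3.\<close>

lemma disc_E_equation:
  fixes \<alpha> :: "nat \<Rightarrow> 'k::field"
  assumes "\<alpha> 0 = 1" "subst_mpoly id \<alpha> burkhardt = 0" "1 + \<alpha> 4 ^ 3 \<noteq> 0"
  shows "cubic_discriminant (E_equation \<alpha>) = Const (- 27 / (1 + \<alpha> 4 ^ 3) ^ 2) * F_sextic \<alpha>"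
proof -
  define A where "A i = Const (\<alpha> i)" for i
  have rel: "1 + A 1^3 + A 2^3 + A 3^3 + A 4^3 + 3 * A 1 * A 2 * A 3 * A 4 = 0"
    using arg_cong[OF assms(2), of Const] unfolding subst_burkhardt[of \<alpha>, OF assms(1)]
    by (simp add: A_def hom_distribs)
  define b where "b = A 2 ^ 2 * Var 1 + A 3 ^ 2 * Var 0 + A 1 * A 4 * (A 2 * Var 0 + A 3 * Var 1)"
  define c where "c = A 2 * Var 1 ^ 2 + A 3 * Var 0 ^ 2 + A 1 * A 4 * Var 0 * Var 1"
  define d where "d = Var 0 ^ 3 + (Var 1 :: 'k mpoly) ^ 3"
  define a where "a = A 2^3 + A 3^3 + A 4^3 + 3 * A 1 * A 2 * A 3 * A 4"
  have F: "F_sextic \<alpha> = (1 + A 4 ^ 3) ^ 2 * (a^2*d^2 - 6*a*b*c*d + 4*a*c^3 + 4*b^3*d - 3*b^2*c^2)"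
    unfolding b_def c_def d_def a_def burkhardt_F[OF rel, symmetric]
    by (simp add: F_sextic_def G3_def H3_def lambda3_def N_of_def A_def hom_distribs)
  have E: "E_equation \<alpha> = [:d, 3 * c, 3 * b, a:]"
    unfolding E_equation_eq[of \<alpha>, OF assms(1)] a_def b_def c_def d_def A_def by (simp only: )
  have "cubic_discriminant (E_equation \<alpha>) =
      - 27 * (a^2*d^2 - 6*a*b*c*d + 4*a*c^3 + 4*b^3*d - 3*b^2*c^2)"
    unfolding cubic_discriminant_def E
    by (simp add: numeral_eq_Suc algebra_simps)
  moreover have "Const (- 27 / (1 + \<alpha> 4 ^ 3) ^ 2) * (1 + A 4 ^ 3) ^ 2 = - 27"
  proof -
    have "Const (- 27 / (1 + \<alpha> 4 ^ 3) ^ 2) * (1 + A 4 ^ 3) ^ 2 =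
        Const (- 27 / (1 + \<alpha> 4 ^ 3) ^ 2 * (1 + \<alpha> 4 ^ 3) ^ 2)"
      unfolding A_def by (simp only: Const.hom_mult Const.hom_add Const.hom_power Const.hom_one)
    also have "\<dots> = Const (- 27)" using assms(3) by simp
    finally show ?thesis by (simp add: hom_distribs)
  qed
  ultimately show ?thesis unfolding F mult.assoc[symmetric] by simp
qed

text \<open>Free of denominators, so that polynomial identities can use \<open>lambda1\<close>
  through this relation alone.\<close>

lemma lambda1_mult:
  fixes \<alpha> :: "nat \<Rightarrow> 'k::field"
  assumes "1 + \<alpha> 1^3 + \<alpha> 2^3 + \<alpha> 3^3 + \<alpha> 4^3 + 3 * \<alpha> 1 * \<alpha> 2 * \<alpha> 3 * \<alpha> 4 = 0"
    and "1 + \<alpha> 1 ^ 3 \<noteq> 0" "1 + \<alpha> 4 ^ 3 \<noteq> 0"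
  shows "lambda1 \<alpha> * (1 + \<alpha> 1 ^ 3) ^ 2 * (1 + \<alpha> 4 ^ 3) = - 1"
proof -
  have N: "N_of \<alpha> = (1 + \<alpha> 1 ^ 3) * (1 + \<alpha> 4 ^ 3)"
    unfolding N_of_def by (rule burkhardt_N[OF assms(1)])
  have *: "- v / (u * v) ^ 2 * u ^ 2 * v = - 1" if "u \<noteq> 0" "v \<noteq> 0" for u v :: 'k
    using that by (simp add: power2_eq_square)
  show ?thesis
    unfolding lambda1_def N using *[OF assms(2,3)] by (simp add: add.commute)
qed

text \<open>The witness is (1 + a4^3) / (1 + a1^3) times the constant term of the depressed
  cubic.\<close>

lemma ex_G1:
  fixes \<alpha> :: "nat \<Rightarrow> 'k::field"
  assumes "\<alpha> 0 = 1" "subst_mpoly id \<alpha> burkhardt = 0" "1 + \<alpha> 4 ^ 3 \<noteq> 0" "1 + \<alpha> 1 ^ 3 \<noteq> 0"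
  shows "\<exists>G1. is_G1 \<alpha> G1"
proof -
  define A where "A i = Const (\<alpha> i)" for i
  have rel0: "1 + \<alpha> 1^3 + \<alpha> 2^3 + \<alpha> 3^3 + \<alpha> 4^3 + 3 * \<alpha> 1 * \<alpha> 2 * \<alpha> 3 * \<alpha> 4 = 0"
    using assms(2) unfolding subst_burkhardt[of \<alpha>, OF assms(1)] .
  have rel: "1 + A 1^3 + A 2^3 + A 3^3 + A 4^3 + 3 * A 1 * A 2 * A 3 * A 4 = 0"
    using arg_cong[OF rel0, of Const] by (simp add: A_def hom_distribs)
  define b where "b = A 2 ^ 2 * Var 1 + A 3 ^ 2 * Var 0 + A 1 * A 4 * (A 2 * Var 0 + A 3 * Var 1)"
  define c where "c = A 2 * Var 1 ^ 2 + A 3 * Var 0 ^ 2 + A 1 * A 4 * Var 0 * Var 1"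
  define d where "d = Var 0 ^ 3 + (Var 1 :: 'k mpoly) ^ 3"
  define a where "a = A 2^3 + A 3^3 + A 4^3 + 3 * A 1 * A 2 * A 3 * A 4"
  define u where "u = 1 + A 1 ^ 3"
  define v where "v = 1 + A 4 ^ 3"
  define K where "K = Const ((1 + \<alpha> 4 ^ 3) / (1 + \<alpha> 1 ^ 3))"
  define G where "G = K * (a ^ 2 * d - 3 * a * b * c + 2 * b ^ 3)"
  have au: "a = - u" using rel unfolding a_def u_def by Groebner_Basis.algebra
  have F: "F_sextic \<alpha> = v ^ 2 * (a^2*d^2 - 6*a*b*c*d + 4*a*c^3 + 4*b^3*d - 3*b^2*c^2)"
    unfolding v_def b_def c_def d_def a_def burkhardt_F[OF rel, symmetric]
    by (simp add: F_sextic_def G3_def H3_def lambda3_def N_of_def A_def hom_distribs)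
  have H: "H1 \<alpha> = v * (b ^ 2 + u * c)"
    unfolding v_def u_def b_def c_def burkhardt_H1[OF rel, symmetric]
    by (simp add: H1_def A_def hom_distribs)
  have u0: "u \<noteq> 0"
  proof
    assume "u = 0"
    then have "Const (1 + \<alpha> 1 ^ 3) = 0" by (simp add: u_def A_def hom_distribs)
    then show False using assms(4) unfolding Const_def by (metis lookup_single_eq lookup_zero)
  qed
  have Ku: "K * u = v"
  proof -
    have "K * u = Const ((1 + \<alpha> 4 ^ 3) / (1 + \<alpha> 1 ^ 3) * (1 + \<alpha> 1 ^ 3))"
      unfolding K_def u_def A_def by (simp only: Const.hom_mult Const.hom_add Const.hom_power Const.hom_one)
    also have "\<dots> = Const (1 + \<alpha> 4 ^ 3)" using assms(4) by simp
    finally show ?thesis by (simp add: v_def A_def hom_distribs)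
  qed
  have L: "Const (lambda1 \<alpha>) * u ^ 2 * v = - 1"
  proof -
    have "Const (lambda1 \<alpha>) * u ^ 2 * v = Const (lambda1 \<alpha> * (1 + \<alpha> 1 ^ 3) ^ 2 * (1 + \<alpha> 4 ^ 3))"
      by (simp add: A_def u_def v_def hom_distribs)
    also have "lambda1 \<alpha> * (1 + \<alpha> 1 ^ 3) ^ 2 * (1 + \<alpha> 4 ^ 3) = - 1"
      by (rule lambda1_mult) fact+
    finally show ?thesis by (simp add: hom_distribs)
  qed
  \<comment> \<open>The factor u^2 clears the denominators in \<open>K\<close> and in
    \<open>lambda1\<close>; it can be cancelled because the polynomial ring is a domain.\<close>
  have "u ^ 2 * (G ^ 2) = u ^ 2 * (F_sextic \<alpha> - 4 * Const (lambda1 \<alpha>) * H1 \<alpha> ^ 3)"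
  proof -
    define q where "q = a ^ 2 * d - 3 * a * b * c + 2 * b ^ 3"
    define r where "r = b ^ 2 + u * c"
    define e where "e = a^2*d^2 - 6*a*b*c*d + 4*a*c^3 + 4*b^3*d - 3*b^2*c^2"
    \<comment> \<open>The classical syzygy between the covariants of a cubic with leading
      coefficient a: q^2 - 4 r^3 is a^2 times \<open>e\<close>, and here a^2 = u^2.\<close>
    have qe: "q ^ 2 = u ^ 2 * e + 4 * r ^ 3"
      unfolding q_def r_def e_def au by Groebner_Basis.algebra
    have "u ^ 2 * G ^ 2 = v ^ 2 * q ^ 2"
      unfolding G_def q_def[symmetric] Ku[symmetric] by Groebner_Basis.algebra
    also have "\<dots> = v ^ 2 * (u ^ 2 * e + 4 * r ^ 3)"
      unfolding qe ..
    also have "\<dots> = u ^ 2 * (v ^ 2 * e) - 4 * (Const (lambda1 \<alpha>) * u ^ 2 * v) * v ^ 2 * r ^ 3"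
      unfolding L by Groebner_Basis.algebra
    also have "\<dots> = u ^ 2 * (v ^ 2 * e - 4 * Const (lambda1 \<alpha>) * (v * r) ^ 3)"
      by Groebner_Basis.algebra
    finally show ?thesis unfolding F H r_def e_def .
  qed
  then have "G ^ 2 = F_sextic \<alpha> - 4 * Const (lambda1 \<alpha>) * H1 \<alpha> ^ 3"
    using u0 by simp
  moreover have "binary_form 3 G"
  proof -
    have b1: "binary_form 1 b"
    proof -
      have "b = Const (\<alpha> 3 ^ 2 + \<alpha> 1 * \<alpha> 4 * \<alpha> 2) * Var 0 + Const (\<alpha> 2 ^ 2 + \<alpha> 1 * \<alpha> 4 * \<alpha> 3) * Var 1"
        by (simp add: b_def A_def hom_distribs algebra_simps)
      then show ?thesis
        using binary_form_Var[where 'k='k]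
        by (simp only:) (intro binary_form_add binary_form_Const_mult, auto)
    qed
    have c2: "binary_form 2 c"
    proof -
      have "c = Const (\<alpha> 2) * Var 1 ^ 2 + Const (\<alpha> 3) * Var 0 ^ 2 + Const (\<alpha> 1 * \<alpha> 4) * (Var 0 * Var 1)"
        by (simp add: c_def A_def hom_distribs algebra_simps)
      then show ?thesis
        using binary_form_power[of 1 "Var 0" 2] binary_form_power[of 1 "Var 1" 2] binary_form_mult[of 1 "Var 0" 1 "Var 1"]
          binary_form_Var[of 0, where 'k='k] binary_form_Var[of 1, where 'k='k]
        by (simp only:) (intro binary_form_add binary_form_Const_mult, auto simp: numeral_2_eq_2)
    qed
    have d3: "binary_form 3 d"
      unfolding d_def using binary_form_power[of 1 "Var 0" 3] binary_form_power[of 1 "Var 1" 3]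
          binary_form_Var[of 0, where 'k='k] binary_form_Var[of 1, where 'k='k]
      by (intro binary_form_add) auto
    have "G = K * (Const ((1 + \<alpha> 1 ^ 3) ^ 2) * d + Const (3 * (1 + \<alpha> 1 ^ 3)) * (b * c) + Const 2 * b ^ 3)"
    proof -
      have "G = K * (u ^ 2 * d + 3 * u * (b * c) + 2 * b ^ 3)"
        unfolding G_def au by Groebner_Basis.algebra
      then show ?thesis
        by (simp only: u_def A_def Const.hom_mult Const.hom_add Const.hom_power Const.hom_one Const.hom_numeral)
    qed
    moreover have "binary_form (1 + 2) (b * c)"
      by (rule binary_form_mult[OF b1 c2])
    then have "binary_form 3 (b * c)"
      by (simp only: one_plus_numeral semiring_norm)
    moreover have "binary_form (3 * 1) (b ^ 3)"
      by (rule binary_form_power[OF b1])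
    then have "binary_form 3 (b ^ 3)"
      by (simp only: mult_1_right)
    ultimately show ?thesis
      using d3 unfolding K_def
      by (simp only:) (rule binary_form_Const_mult binary_form_add | assumption)+
  qed
  ultimately show ?thesis unfolding is_G1_def by blast
qed

section \<open>Constants and evaluation at the generic point of the line\<close>

interpretation cst: field_hom "cst :: 'k::field \<Rightarrow> 'k geo"
proof -
  have "cst (a + b) = cst a + cst b" "cst (a * b) = cst a * cst b" for a b :: 'k
    unfolding cst_def to_ac_add[symmetric] to_ac_mult[symmetric] by (simp_all add: mult.commute)
  then show "field_hom (cst :: 'k::field \<Rightarrow> 'k geo)"
    by unfold_locales (simp_all, simp_all add: cst_def Zero_fract_def[symmetric]
      One_fract_def[symmetric] pCons_one)
qed

lemma at_generic_simps:
  fixes p q :: "'k::field mpoly"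
  shows "at_generic (p + q) = at_generic p + at_generic q"
  "at_generic (p * q) = at_generic p * at_generic q"
  "at_generic (p - q) = at_generic p - at_generic q"
  "at_generic (- p) = - at_generic p"
  "at_generic (p ^ n) = at_generic p ^ n"
  "at_generic (numeral k :: 'k mpoly) = numeral k"
  "at_generic (0 :: 'k mpoly) = 0" "at_generic (1 :: 'k mpoly) = 1"
  "at_generic (Const c) = cst (c :: 'k)"
  "at_generic (Var 0 :: 'k mpoly) = tt" "at_generic (Var 1 :: 'k mpoly) = 1"
proof -
  interpret S: comm_ring_hom "at_generic :: 'k mpoly \<Rightarrow> 'k geo"
    unfolding at_generic_def by (rule cst.subst_mpoly_comm_ring_hom)
  show "at_generic (p + q) = at_generic p + at_generic q"
  "at_generic (p * q) = at_generic p * at_generic q"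
  "at_generic (p - q) = at_generic p - at_generic q"
  "at_generic (- p) = - at_generic p"
  "at_generic (p ^ n) = at_generic p ^ n"
  "at_generic (numeral k :: 'k mpoly) = numeral k"
  "at_generic (0 :: 'k mpoly) = 0" "at_generic (1 :: 'k mpoly) = 1"
    by (simp_all add: hom_distribs)
  show "at_generic (Const c) = cst (c :: 'k)"
  "at_generic (Var 0 :: 'k mpoly) = tt" "at_generic (Var 1 :: 'k mpoly) = 1"
    by (simp_all add: at_generic_def cst.subst_mpoly_Const cst.subst_mpoly_Var)
qed

section \<open>The plane cubic as a cover of the line\<close>

text \<open>The cubic in w has leading coefficient -u, so b - u w is the substitution a w + b that
  removes the quadratic term after multiplication by a^2 = u^2.\<close>

lemma depressed_cubic_on_line:
  fixes a1 a2 a3 a4 x z w :: "'r::idom"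
  assumes "1 + a1^3 + a2^3 + a3^3 + a4^3 + 3*a1*a2*a3*a4 = 0"
  defines "u \<equiv> 1 + a1^3"
    and "b \<equiv> a2^2*z + a3^2*x + a1*a4*(a2*x + a3*z)"
    and "c \<equiv> a2*z^2 + a3*x^2 + a1*a4*x*z"
    and "d \<equiv> x^3 + z^3"
  shows "(b - u*w)^3 + 3 * (- (u*c) - b^2) * (b - u*w) + (u^2*d + 3*u*b*c + 2*b^3)
    = u^2 * ((z + w*a2)^3 + (x + w*a3)^3 + (w*a4)^3 + 3*a1*(z + w*a2)*(x + w*a3)*(w*a4))"
  using assms(1) unfolding assms(2-5) by Groebner_Basis.algebra

text \<open>Stated over an algebraically closed field so that it can be interpreted in the closure
  of k(t), once for each of the two charts of the line.\<close>

locale burkhardt_point =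
  fixes a1 a2 a3 a4 :: "'a::alg_closed_field"
  assumes two: "(2::'a) \<noteq> 0" and three: "(3::'a) \<noteq> 0"
    and rel: "1 + a1^3 + a2^3 + a3^3 + a4^3 + 3*a1*a2*a3*a4 = 0"
    and a4_nz: "a4 \<noteq> 0"
    and nz1: "1 + a1^3 \<noteq> 0" and nz2: "1 + a2^3 \<noteq> 0" and nz3: "1 + a3^3 \<noteq> 0"
    and nz4: "1 + a4^3 \<noteq> 0"
begin

definition "u = 1 + a1^3"
definition "v = 1 + a4^3"
definition "b x z = a2^2*z + a3^2*x + a1*a4*(a2*x + a3*z)"
definition "c x z = a2*z^2 + a3*x^2 + a1*a4*x*z"
definition "d x z = x^3 + (z::'a)^3"
definition "p x z = - (u * c x z) - b x z ^ 2"
definition "q x z = u^2 * d x z + 3 * u * b x z * c x z + 2 * b x z ^ 3"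
definition "E y2 y3 y4 = y2^3 + y3^3 + y4^3 + 3*a1*y2*y3*y4"

lemma u_nz: "u \<noteq> 0" using nz1 by (simp add: u_def)
lemma cubic_on_line:
  "(b x z - u*w)^3 + 3 * p x z * (b x z - u*w) + q x z = u^2 * E (z + w*a2) (x + w*a3) (w*a4)"
  using depressed_cubic_on_line[OF rel, of z x w]
  unfolding p_def q_def b_def c_def d_def u_def E_def by simp

text \<open>The point with coordinates Y, Z on a side of the triangle is an inflection point of the
  cubic, and the last equation puts (s : t : r) on its tangent. Cubing t Y^2 + r Z^2 = -s a1 Y Z and
  inserting Z^3 = -Y^3 and the quartic gives Y^6 (1 + a1^3)(1 + s^3) = 0.\<close>

lemma flex_tangent:
  assumes r: "1 + a1^3 + s^3 + t^3 + r^3 + 3*a1*s*t*r = 0" and "1 + s^3 \<noteq> 0"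
    and "Y^3 + Z^3 = 0" "s*a1*Y*Z + t*Y^2 + r*Z^2 = 0"
  shows "Y = 0 \<and> Z = 0"
proof -
  have 1: "Z^3 = - (Y^3)" "t*Y^2 + r*Z^2 = - (s*a1*Y*Z)"
    using assms(3,4) by Groebner_Basis.algebra+
  have "(t*Y^2 + r*Z^2)^3 = t^3*Y^6 + r^3*(Z^3)^2 + 3*t*r*Y^2*Z^2*(t*Y^2 + r*Z^2)"
    by Groebner_Basis.algebra
  also have "\<dots> = t^3*Y^6 + r^3*(Z^3)^2 + 3*t*r*Y^2*Z^2*(- (s*a1*Y*Z))"
    by (simp only: 1(2))
  also have "\<dots> = t^3*Y^6 + r^3*(Z^3)^2 - 3*a1*s*t*r*Y^3*Z^3"
    by Groebner_Basis.algebra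
  also have "\<dots> = t^3*Y^6 + r^3*(- (Y^3))^2 - 3*a1*s*t*r*Y^3*(- (Y^3))"
    by (simp only: 1(1))
  also have "\<dots> = Y^6 * (t^3 + r^3 + 3*a1*s*t*r)"
    by Groebner_Basis.algebra
  finally have "(- (s*a1*Y*Z))^3 = Y^6 * (t^3 + r^3 + 3*a1*s*t*r)"
    unfolding 1 .
  note fin = this
  have "s^3*a1^3*Y^6 = - (s^3*a1^3*Y^3) * Z^3"
    unfolding 1 by Groebner_Basis.algebra
  also have "\<dots> = (- (s*a1*Y*Z))^3"
    by Groebner_Basis.algebra
  also note fin
  finally have "s^3*a1^3*Y^6 = Y^6 * (t^3 + r^3 + 3*a1*s*t*r)" .
  then have "Y^6 * ((1 + a1^3) * (1 + s^3)) = 0"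
    using r by Groebner_Basis.algebra
  then have "Y = 0" using nz1 assms(2) by simp
  then show ?thesis using assms(3) by simp
qed

text \<open>A common zero of \<open>p\<close> and \<open>q\<close> is a line through the point that meets the plane cubic in
  a single point \<open>Q\<close>. The second polar of \<open>Q\<close> then vanishes identically on this line, so \<open>Q\<close> lies on
  the Hessian triangle, and the line is the tangent at an inflection point.\<close>

lemma p_q_no_common_zero:
  assumes p: "p x z = 0" and q: "q x z = 0"
  shows "x = 0 \<and> z = 0"
proof -
  \<comment> \<open>For p = q = 0 the depressed cubic is X^3 with X = b - u w, so this is the
    parameter of the triple point Q.\<close>
  define r where "r = b x z / u"
  define Q1 where "Q1 = z + r*a2"
  define Q2 where "Q2 = x + r*a3"
  define Q3 where "Q3 = r*a4"
  have ur: "u * r = b x z" using u_nz by (simp add: r_def)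
  \<comment> \<open>With E read as a symmetric trilinear form and c the centre, \<open>c0\<close>,
    \<open>c1\<close> and \<open>c2\<close> express E(Q,Q,Q) = E(Q,Q,c) = E(Q,c,c) = 0.\<close>
  have c0: "Q1^3 + Q2^3 + Q3^3 + 3*a1*Q1*Q2*Q3 = 0"
    using cubic_on_line[of x z r] p q ur u_nz unfolding Q1_def Q2_def Q3_def E_def by simp
  have c2: "Q1*(a2^2 + a1*a3*a4) + Q2*(a3^2 + a1*a2*a4) + Q3*(a4^2 + a1*a2*a3) = 0"
    using ur rel unfolding Q1_def Q2_def Q3_def b_def u_def by Groebner_Basis.algebra
  have "u * (a2*(Q1^2 + a1*Q2*Q3) + a3*(Q2^2 + a1*Q1*Q3) + a4*(Q3^2 + a1*Q1*Q2))
      = u * (- (u * r^2) + 2 * b x z * r + c x z)"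
    using rel unfolding Q1_def Q2_def Q3_def b_def u_def c_def by Groebner_Basis.algebra
  also have "\<dots> = - p x z"
    unfolding p_def ur[symmetric] by Groebner_Basis.algebra
  finally have c1: "a2*(Q1^2 + a1*Q2*Q3) + a3*(Q2^2 + a1*Q1*Q3) + a4*(Q3^2 + a1*Q1*Q2) = 0"
    using p u_nz by simp
  \<comment> \<open>M is one third of the matrix of second derivatives of E at Q, and D is its
    determinant. The equations \<open>g11\<close>, \<open>g12\<close>, \<open>g22\<close> say that
    the form M vanishes on the span of Q and c.\<close>
  define M11 where "M11 = 2*Q1" define M22 where "M22 = 2*Q2" define M33 where "M33 = 2*Q3"
  define M12 where "M12 = a1*Q3" define M13 where "M13 = a1*Q2" define M23 where "M23 = a1*Q1"
  define D where "D = M11*(M22*M33 - M23^2) - M12*(M12*M33 - M13*M23) + M13*(M12*M23 - M13*M22)"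
  have g11: "Q1*(M11*Q1 + M12*Q2 + M13*Q3) + Q2*(M12*Q1 + M22*Q2 + M23*Q3) + Q3*(M13*Q1 + M23*Q2 + M33*Q3) = 0"
    using c0 unfolding M11_def M22_def M33_def M12_def M13_def M23_def by Groebner_Basis.algebra
  have g12: "a2*(M11*Q1 + M12*Q2 + M13*Q3) + a3*(M12*Q1 + M22*Q2 + M23*Q3) + a4*(M13*Q1 + M23*Q2 + M33*Q3) = 0"
    using c1 unfolding M11_def M22_def M33_def M12_def M13_def M23_def by Groebner_Basis.algebra
  have g22: "a2*(M11*a2 + M12*a3 + M13*a4) + a3*(M12*a2 + M22*a3 + M23*a4) + a4*(M13*a2 + M23*a3 + M33*a4) = 0"
    using c2 unfolding M11_def M22_def M33_def M12_def M13_def M23_def by Groebner_Basis.algebra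
  \<comment> \<open>The Gram determinant of Q, c and the first basis vector, expanded along its
    first row. It vanishes because its upper left block of size 2 is zero. The second basis vector
    follows in the same way.\<close>
  have "D * (Q2*a4 - Q3*a3)^2 =
      (Q1*(M11*Q1 + M12*Q2 + M13*Q3) + Q2*(M12*Q1 + M22*Q2 + M23*Q3) + Q3*(M13*Q1 + M23*Q2 + M33*Q3)) *
        ((a2*(M11*a2 + M12*a3 + M13*a4) + a3*(M12*a2 + M22*a3 + M23*a4) + a4*(M13*a2 + M23*a3 + M33*a4)) * M11 - (M11*a2 + M12*a3 + M13*a4)^2)
      - (a2*(M11*Q1 + M12*Q2 + M13*Q3) + a3*(M12*Q1 + M22*Q2 + M23*Q3) + a4*(M13*Q1 + M23*Q2 + M33*Q3)) *
        ((a2*(M11*Q1 + M12*Q2 + M13*Q3) + a3*(M12*Q1 + M22*Q2 + M23*Q3) + a4*(M13*Q1 + M23*Q2 + M33*Q3)) * M11 - (M11*a2 + M12*a3 + M13*a4) * (M11*Q1 + M12*Q2 + M13*Q3))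
      + (M11*Q1 + M12*Q2 + M13*Q3) * ((a2*(M11*Q1 + M12*Q2 + M13*Q3) + a3*(M12*Q1 + M22*Q2 + M23*Q3) + a4*(M13*Q1 + M23*Q2 + M33*Q3)) * (M11*a2 + M12*a3 + M13*a4)
        - (a2*(M11*a2 + M12*a3 + M13*a4) + a3*(M12*a2 + M22*a3 + M23*a4) + a4*(M13*a2 + M23*a3 + M33*a4)) * (M11*Q1 + M12*Q2 + M13*Q3))"
    unfolding D_def by Groebner_Basis.algebra
  then have gram1: "D * (Q2*a4 - Q3*a3)^2 = 0"
    unfolding g11 g12 g22 by simp
  have "D * (Q3*a2 - Q1*a4)^2 =
      (Q1*(M11*Q1 + M12*Q2 + M13*Q3) + Q2*(M12*Q1 + M22*Q2 + M23*Q3) + Q3*(M13*Q1 + M23*Q2 + M33*Q3)) *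
        ((a2*(M11*a2 + M12*a3 + M13*a4) + a3*(M12*a2 + M22*a3 + M23*a4) + a4*(M13*a2 + M23*a3 + M33*a4)) * M22 - (M12*a2 + M22*a3 + M23*a4)^2)
      - (a2*(M11*Q1 + M12*Q2 + M13*Q3) + a3*(M12*Q1 + M22*Q2 + M23*Q3) + a4*(M13*Q1 + M23*Q2 + M33*Q3)) *
        ((a2*(M11*Q1 + M12*Q2 + M13*Q3) + a3*(M12*Q1 + M22*Q2 + M23*Q3) + a4*(M13*Q1 + M23*Q2 + M33*Q3)) * M22 - (M12*a2 + M22*a3 + M23*a4) * (M12*Q1 + M22*Q2 + M23*Q3))
      + (M12*Q1 + M22*Q2 + M23*Q3) * ((a2*(M11*Q1 + M12*Q2 + M13*Q3) + a3*(M12*Q1 + M22*Q2 + M23*Q3) + a4*(M13*Q1 + M23*Q2 + M33*Q3)) * (M12*a2 + M22*a3 + M23*a4)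
        - (a2*(M11*a2 + M12*a3 + M13*a4) + a3*(M12*a2 + M22*a3 + M23*a4) + a4*(M13*a2 + M23*a3 + M33*a4)) * (M12*Q1 + M22*Q2 + M23*Q3))"
    unfolding D_def by Groebner_Basis.algebra
  then have gram2: "D * (Q3*a2 - Q1*a4)^2 = 0"
    unfolding g11 g12 g22 by simp
  \<comment> \<open>On the cubic itself its Hessian reduces to the coordinate triangle.\<close>
  have D8: "D = 8 * u * (Q1*Q2*Q3)"
    using c0 unfolding D_def u_def M11_def M22_def M33_def M12_def M13_def M23_def
    by Groebner_Basis.algebra
  have m: "Q2*a4 - Q3*a3 = x*a4" "Q3*a2 - Q1*a4 = - (z*a4)"
    unfolding Q1_def Q2_def Q3_def by Groebner_Basis.algebra+
  show ?thesis
  proof (rule ccontr)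
    assume n: "\<not> (x = 0 \<and> z = 0)"
    then have "D = 0" using gram1 gram2 a4_nz unfolding m by auto
    moreover have "(8::'a) = 2^3" by simp
    then have "(8::'a) \<noteq> 0" using two by (metis power_not_zero)
    ultimately have "Q1*Q2*Q3 = 0" using u_nz unfolding D8 by simp
    then consider "Q1 = 0" | "Q2 = 0" | "Q3 = 0" by auto
    then have "Q1 = 0 \<and> Q2 = 0 \<and> Q3 = 0"
    proof cases
      case 1
      have "Q2 = 0 \<and> Q3 = 0"
        by (rule flex_tangent[of a2 a3 a4]) (use rel nz2 c0 c1 1 in \<open>auto simp: algebra_simps\<close>)
      then show ?thesis using 1 by simp
    next
      case 2
      have "Q1 = 0 \<and> Q3 = 0"
        by (rule flex_tangent[of a3 a2 a4]) (use rel nz3 c0 c1 2 in \<open>auto simp: algebra_simps\<close>)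
      then show ?thesis using 2 by simp
    next
      case 3
      have "Q1 = 0 \<and> Q2 = 0"
        by (rule flex_tangent[of a4 a2 a3]) (use rel nz4 c0 c1 3 in \<open>auto simp: algebra_simps\<close>)
      then show ?thesis using 3 by simp
    qed
    then show False using m n a4_nz by auto
  qed
qed

text \<open>On such a line y4 is a linear form in y2 and y3, say with coefficients e'/k and f'/k.
  Comparing coefficients gives e'^3 = f'^3 = -k^3 and e' f' = -a1 k^2, hence k^6 (1 + a1^3) =
  0.\<close>

lemma E_contains_no_line:
  assumes "\<And>s t. E (s + (e*s + f*t)*a2) (t + (e*s + f*t)*a3) ((e*s + f*t)*a4) = 0"
  shows False
proof -
  \<comment> \<open>The determinant of the map from (s, t) to the first two coordinates. The values
    of s and t used next come from its adjugate, which makes these coordinates k and 0, and so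
    on.\<close>
  define k where "k = 1 + e*a2 + f*a3"
  define e' where "e' = e*a4" define f' where "f' = f*a4"
  have 1: "E k 0 e' = 0"
    using assms[of "1 + f*a3" "- (e*a3)"] unfolding k_def e'_def by (simp add: algebra_simps)
  have 2: "E 0 k f' = 0"
    using assms[of "- (f*a2)" "1 + e*a2"] unfolding k_def f'_def by (simp add: algebra_simps)
  have 3: "E k k (e' + f') = 0"
    using assms[of "1 + f*a3 - f*a2" "1 + e*a2 - e*a3"] unfolding k_def e'_def f'_def
    by (simp add: algebra_simps)
  have 4: "E k (- k) (e' - f') = 0"
    using assms[of "1 + f*a3 + f*a2" "- 1 - e*a2 - e*a3"] unfolding k_def e'_def f'_def
    by (simp add: algebra_simps)
  have k0: "k \<noteq> 0"
  proof
    assume "k = 0"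
    then have "e' = 0" "f' = 0" using 1 2 by (auto simp: E_def)
    then show False using \<open>k = 0\<close> a4_nz by (auto simp: k_def e'_def f'_def)
  qed
  have ef: "e'^3 = - (k^3)" "f'^3 = - (k^3)"
    using 1 2 unfolding E_def by (simp_all add: add_eq_0_iff)
  have "3 * ((e' + f') * (e'*f' + a1*k^2)) = 0"
    using 3 ef unfolding E_def by Groebner_Basis.algebra
  moreover have "3 * ((e' - f') * (e'*f' + a1*k^2)) = 0"
    using 4 ef unfolding E_def by Groebner_Basis.algebra
  moreover have "2 * e' = 0 \<Longrightarrow> False"
    using two ef(1) k0 by auto
  ultimately have "e'*f' + a1*k^2 = 0"
    using three by (metis add_diff_eq add_eq_0_iff2 diff_add_cancel mult_2 mult_eq_0_iff right_minus_eq)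
  then have "e'*f' = - (a1*k^2)" by Groebner_Basis.algebra
  then have "e'^3 * f'^3 = (- (a1*k^2))^3" by (metis power_mult_distrib)
  then have "k^6 * (1 + a1^3) = 0" unfolding ef by Groebner_Basis.algebra
  then show False using k0 nz1 by simp
qed

definition "pp = [:- (u*a2) - (a2^2 + a1*a3*a4)^2, - (u*a1*a4) - 2 * (a2^2 + a1*a3*a4) * (a3^2 + a1*a2*a4),
    - (u*a3) - (a3^2 + a1*a2*a4)^2:]"
definition "bp = [:a2^2 + a1*a3*a4, a3^2 + a1*a2*a4:]"
definition "cp = [:a2, a1*a4, a3:]"
definition "qp = smult (u^2) [:1, 0, 0, 1:] + smult (3*u) (bp * cp) + smult 2 (bp^3)"

lemma poly_pp: "poly pp x = p x 1"
  by (simp add: pp_def p_def c_def b_def algebra_simps power2_eq_square)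

lemma poly_bp: "poly bp x = b x 1" and poly_cp: "poly cp x = c x 1"
  by (simp_all add: bp_def cp_def c_def b_def algebra_simps power2_eq_square)

lemma poly_qp: "poly qp x = q x 1"
  by (simp add: qp_def q_def poly_bp poly_cp d_def algebra_simps power3_eq_cube)

lemma pp_eq: "pp = - smult u cp - bp^2"
  by (simp add: pp_def bp_def cp_def power2_eq_square algebra_simps)

lemma degree_pp: "degree pp \<le> 2"
  by (simp add: pp_def)

lemma degree_qp: "degree qp \<le> 3"
proof -
  have "degree bp \<le> 1" "degree cp \<le> 2" by (simp_all add: bp_def cp_def)
  then have "degree (bp * cp) \<le> 3" "degree (bp ^ 3) \<le> 3"
    using degree_mult_le[of bp cp] degree_power_le[of bp 3] by linarith+
  moreover have "degree [:1, 0, 0, 1 :: 'a:] \<le> 3" by simp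
  ultimately show ?thesis
    unfolding qp_def by (meson degree_add_le degree_smult_le order_trans)
qed

text \<open>A root in the rational function field is a polynomial of degree at most 1, by integrality and
  comparison of degrees, and would give a line contained in the smooth plane cubic.\<close>

lemma no_polynomial_root:
  assumes S: "S^3 + 3 * pp * S + qp = 0"
  shows False
proof -
  have deg: "degree S \<le> 1"
  proof (rule ccontr)
    assume "\<not> degree S \<le> 1"
    then have n: "degree S \<ge> 2" by simp
    have "degree (3 * pp * S) \<le> degree S + 2"
      using degree_mult_le[of "3 * pp" S] degree_mult_le[of 3 pp] degree_pp by simp
    then have "degree (3 * pp * S + qp) < 3 * degree S"
      using n degree_qp degree_add_le[of "3 * pp * S" "degree S + 2" qp]
      by (intro degree_add_less) auto
    moreover have "degree (S^3) = 3 * degree S" using n by (intro degree_power_eq) auto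
    moreover have "S^3 = - (3 * pp * S + qp)" using S by Groebner_Basis.algebra
    then have "degree (S^3) = degree (3 * pp * S + qp)" by (simp only: degree_minus)
    ultimately show False by simp
  qed
  \<comment> \<open>Undoes S = b - u w: the root S becomes a linear polynomial w that parametrizes
    points of the cubic.\<close>
  define w where "w = smult (1 / u) (bp - S)"
  have uw: "[:u:] * w = bp - S" using u_nz by (simp add: w_def)
  have "degree w \<le> 1" using deg by (auto simp: w_def bp_def intro!: degree_diff_le)
  then have "w = [:coeff w 0, coeff w 1:]"
    by (intro poly_eqI) (auto simp: coeff_pCons coeff_eq_0 split: nat.splits)
  then obtain e f where w: "w = [:e, f:]" by blast
  have rel': "1 + [:a1:]^3 + [:a2:]^3 + [:a3:]^3 + [:a4:]^3 + 3*[:a1:]*[:a2:]*[:a3:]*[:a4:] = 0"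
    using rel by (simp add: numeral_poly one_pCons power3_eq_cube algebra_simps)
  let ?x = "[:0, 1::'a:]"
  have bp': "[:a2:]^2*1 + [:a3:]^2*?x + [:a1:]*[:a4:]*([:a2:]*?x + [:a3:]*1) = bp"
    by (simp add: bp_def power2_eq_square algebra_simps)
  have cp': "[:a2:]*1^2 + [:a3:]*?x^2 + [:a1:]*[:a4:]*?x*1 = cp"
    by (simp add: cp_def power2_eq_square algebra_simps)
  have u': "1 + [:a1:]^3 = [:u:]" by (simp add: u_def one_pCons power3_eq_cube)
  define Ep where "Ep = (1 + w*[:a2:])^3 + (?x + w*[:a3:])^3 + (w*[:a4:])^3
    + 3*[:a1:]*(1 + w*[:a2:])*(?x + w*[:a3:])*(w*[:a4:])"
  have "[:u:]^2 * Ep = (bp - [:u:] * w)^3 + 3 * (- ([:u:] * cp) - bp^2) * (bp - [:u:] * w)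
      + ([:u:]^2 * (?x^3 + 1^3) + 3*[:u:]*bp*cp + 2*bp^3)"
    using depressed_cubic_on_line[OF rel', of 1 ?x w] unfolding Ep_def bp' cp' u' by simp
  also have "\<dots> = S^3 + 3 * pp * S + qp"
  proof -
    have "[:u:] * cp = smult u cp" by simp
    moreover have "[:u:]^2 * (?x^3 + 1^3) + 3*[:u:]*bp*cp + 2*bp^3 = qp"
      by (simp add: qp_def power2_eq_square power3_eq_cube numeral_poly one_pCons mult.commute)
    ultimately show ?thesis unfolding uw pp_eq by simp
  qed
  finally have Ep0: "Ep = 0" using S u_nz by simp
  have Ep: "Ep = [:1 + e*a2, f*a2:]^3 + [:e*a3, 1 + f*a3:]^3 + [:e*a4, f*a4:]^3
    + [:3*a1:] * ([:1 + e*a2, f*a2:] * [:e*a3, 1 + f*a3:] * [:e*a4, f*a4:])"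
    unfolding Ep_def w by (simp add: one_pCons numeral_poly algebra_simps)
  have "E (s + (e*s + f*t)*a2) (t + (e*s + f*t)*a3) ((e*s + f*t)*a4) = 0" for s t
  proof (cases "s = 0")
    case False
    have "E (s + (e*s + f*t)*a2) (t + (e*s + f*t)*a3) ((e*s + f*t)*a4) = s^3 * poly Ep (t / s)"
      unfolding Ep E_def using False by (simp add: field_simps power3_eq_cube)
    then show ?thesis using Ep0 by simp
  next
    case True
    \<comment> \<open>The point s = 0 of the line is seen by the leading coefficient in place of a
      value of \<open>Ep\<close>.\<close>
    have "coeff Ep 3 = (f*a2)^3 + (1 + f*a3)^3 + (f*a4)^3 + 3*a1*(f*a2)*(1 + f*a3)*(f*a4)"
      unfolding Ep by (simp add: power3_eq_cube numeral_3_eq_3)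
    then have "t^3 * ((f*a2)^3 + (1 + f*a3)^3 + (f*a4)^3 + 3*a1*(f*a2)*(1 + f*a3)*(f*a4)) = 0"
      using Ep0 by simp
    moreover have "t^3 * ((f*a2)^3 + (1 + f*a3)^3 + (f*a4)^3 + 3*a1*(f*a2)*(1 + f*a3)*(f*a4))
        = E (f*t*a2) (t + f*t*a3) (f*t*a4)"
      unfolding E_def by Groebner_Basis.algebra
    ultimately show ?thesis using True by simp
  qed
  then show False by (rule E_contains_no_line)
qed

text \<open>P/Q is a root with denominators cleared. A zero of Q is a zero of P, so linear factors
  cancel until Q is constant.\<close>

lemma no_rational_root:
  assumes "P^3 + 3 * pp * P * Q^2 + qp * Q^3 = 0" and "Q \<noteq> 0"
  shows False
  using assms
proof (induction "degree Q" arbitrary: P Q rule: less_induct)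
  case less
  show False
  proof (cases "degree Q > 0")
    case True
    then obtain r where "poly Q r = 0" using alg_closed_imp_poly_has_root by blast
    moreover have "poly (P^3 + 3 * pp * P * Q^2 + qp * Q^3) r = 0" unfolding less.prems(1) by simp
    ultimately have "poly P r = 0" "poly Q r = 0" by simp_all
    then obtain P' Q' where PQ': "P = [:- r, 1:] * P'" "Q = [:- r, 1:] * Q'"
      unfolding poly_eq_0_iff_dvd dvd_def by blast
    have "[:- r, 1:]^3 * (P'^3 + 3 * pp * P' * Q'^2 + qp * Q'^3) = 0"
      using less.prems(1) unfolding PQ' by Groebner_Basis.algebra
    then have "P'^3 + 3 * pp * P' * Q'^2 + qp * Q'^3 = 0" by simp
    moreover have Q': "Q' \<noteq> 0" using less.prems(2) PQ'(2) by auto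
    moreover have "degree Q' < degree Q" unfolding PQ'(2) using Q' by (subst degree_mult_eq) auto
    ultimately show False using less.hyps by blast
  next
    case False
    then obtain e where e: "Q = [:e:]" by (metis degree_eq_zeroE not_gr_zero)
    define R where "R = [:inverse e:]"
    have R: "1 = Q * R" using less.prems(2) by (simp add: e R_def one_pCons)
    have "(P * R)^3 + 3 * pp * (P * R) + qp = R^3 * (P^3 + 3 * pp * P * Q^2 + qp * Q^3)"
      using R by Groebner_Basis.algebra
    then show False using less.prems(1) no_polynomial_root[of "P * R"] by simp
  qed
qed

end

section \<open>Subfields and simple extensions\<close>

lemma \<Omega>_simps [simp]:
  fixes x y :: "'a::field"
  shows "carrier (ring_of_type_algebra :: 'a ring) = UNIV"
    and "x \<otimes>\<^bsub>ring_of_type_algebra\<^esub> y = x * y"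
    and "x \<oplus>\<^bsub>ring_of_type_algebra\<^esub> y = x + y"
    and "\<one>\<^bsub>ring_of_type_algebra\<^esub> = (1::'a)"
    and "\<zero>\<^bsub>ring_of_type_algebra\<^esub> = (0::'a)"
  by (simp_all add: ring_of_type_algebra_def)

lemmas \<Omega>_ring = ring_from_type_algebra and \<Omega>_field = field_from_type_algebra

lemma \<Omega>_a_inv [simp]: "\<ominus>\<^bsub>ring_of_type_algebra\<^esub> x = - (x :: 'a::field)"
  using abelian_group.minus_equality[OF ring.is_abelian_group[OF \<Omega>_ring], of "- x" x] by simp

lemma \<Omega>_m_inv [simp]:
  "(x :: 'a::field) \<noteq> 0 \<Longrightarrow> inv\<^bsub>ring_of_type_algebra\<^esub> x = inverse x"
  using comm_monoid.comm_inv_char[OF cring.axioms(2)[OF cring_from_type_algebra], of x "inverse x"] by simp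

text \<open>Equivalent to \<open>subfield\<close> in the type-class structure, without its record
  operations. Closure under \<open>inverse\<close> can be unconditional because
  \<open>inverse 0 = 0\<close>.\<close>

definition is_subfield :: "'a::field set \<Rightarrow> bool"
  where "is_subfield K \<longleftrightarrow> 0 \<in> K \<and> 1 \<in> K \<and> (\<forall>x\<in>K. \<forall>y\<in>K. x + y \<in> K \<and> x * y \<in> K) \<and>
    (\<forall>x\<in>K. - x \<in> K \<and> inverse x \<in> K)"

lemma is_subfieldI:
  assumes "0 \<in> K" "1 \<in> K" "\<And>x y. x \<in> K \<Longrightarrow> y \<in> K \<Longrightarrow> x + y \<in> K"
    "\<And>x y. x \<in> K \<Longrightarrow> y \<in> K \<Longrightarrow> x * y \<in> K" "\<And>x. x \<in> K \<Longrightarrow> - x \<in> K"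
    "\<And>x. x \<in> K \<Longrightarrow> x \<noteq> 0 \<Longrightarrow> inverse x \<in> K"
  shows "is_subfield K"
  using assms unfolding is_subfield_def by (metis inverse_zero)

context
  fixes K :: "'a::field set"
  assumes K: "is_subfield K"
begin

lemma subfield_0: "0 \<in> K" and subfield_1: "1 \<in> K"
  and subfield_add: "x \<in> K \<Longrightarrow> y \<in> K \<Longrightarrow> x + y \<in> K"
  and subfield_mult: "x \<in> K \<Longrightarrow> y \<in> K \<Longrightarrow> x * y \<in> K"
  and subfield_uminus: "x \<in> K \<Longrightarrow> - x \<in> K"
  and subfield_inverse: "x \<in> K \<Longrightarrow> inverse x \<in> K"
  using K by (auto simp: is_subfield_def)

lemma subfield_diff: "x \<in> K \<Longrightarrow> y \<in> K \<Longrightarrow> x - y \<in> K"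
  using subfield_add[of x "- y"] subfield_uminus[of y] by simp

lemma subfield_divide: "x \<in> K \<Longrightarrow> y \<in> K \<Longrightarrow> x / y \<in> K"
  using subfield_mult[of x "inverse y"] subfield_inverse[of y] by (simp add: divide_inverse)

lemma subfield_power: "x \<in> K \<Longrightarrow> x ^ n \<in> K"
  by (induction n) (auto intro: subfield_1 subfield_mult)

lemma subfield_of_nat: "of_nat n \<in> K"
  by (induction n) (auto intro: subfield_0 subfield_1 subfield_add)

lemma subfield_numeral: "numeral n \<in> K"
  using subfield_of_nat[of "numeral n"] by simp

lemma subfield_sum: "(\<And>i. i \<in> I \<Longrightarrow> f i \<in> K) \<Longrightarrow> sum f I \<in> K"
  by (induction I rule: infinite_finite_induct) (auto intro: subfield_0 subfield_add)

lemmas subfield_intros = subfield_0 subfield_1 subfield_add subfield_mult subfield_uminus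
  subfield_inverse subfield_diff subfield_divide subfield_power subfield_numeral subfield_sum

end

lemma subfield_iff_is_subfield:
  "subfield K (ring_of_type_algebra :: 'a ring) \<longleftrightarrow> is_subfield (K :: 'a::Fields.field set)"
proof
  assume S: "subfield K (ring_of_type_algebra :: 'a ring)"
  note cl = subringE[OF subfieldE(1)[OF S]]
  show "is_subfield K"
  proof (rule is_subfieldI)
    show "0 \<in> K" "1 \<in> K" using cl(2,3) by simp_all
    fix x assume x: "x \<in> K"
    show "- x \<in> K" using cl(5)[OF x] by simp
    show "inverse x \<in> K" if "x \<noteq> 0"
      using ring.subfield_m_inv(1)[OF \<Omega>_ring S, of x] x that by simp
    fix y assume "y \<in> K"
    then show "x + y \<in> K" "x * y \<in> K" using cl(6,7)[OF x, of y] by simp_all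
  qed
next
  assume K: "is_subfield K"
  show "subfield K (ring_of_type_algebra :: 'a ring)"
  proof (rule field.subfieldI'[OF \<Omega>_field])
    show "subring K (ring_of_type_algebra :: 'a ring)"
      by (rule ring.subringI[OF \<Omega>_ring]) (auto intro: subfield_intros[OF K])
    show "inv\<^bsub>ring_of_type_algebra\<^esub> k \<in> K" if "k \<in> K - {\<zero>\<^bsub>ring_of_type_algebra\<^esub>}" for k :: 'a
      using that by (auto intro: subfield_intros[OF K])
  qed
qed

abbreviation gen_field :: "'a::field set \<Rightarrow> 'a set"
  where "gen_field S \<equiv> generate_field ring_of_type_algebra S"

lemma gen_field_is_subfield: "is_subfield (gen_field S)"
  using field.generate_field_is_subfield[OF \<Omega>_field, of S] by (simp add: subfield_iff_is_subfield)

lemma gen_field_incl: "S \<subseteq> gen_field S"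
  by (auto intro: generate_field.incl)

lemma gen_field_min:
  assumes "is_subfield K" "S \<subseteq> K"
  shows "gen_field S \<subseteq> K"
  using field.generate_field_min_subfield1[OF \<Omega>_field, of S K] assms by (simp add: subfield_iff_is_subfield)

lemma gen_field_mono: "S \<subseteq> T \<Longrightarrow> gen_field S \<subseteq> gen_field T"
  by (intro gen_field_min gen_field_is_subfield) (use gen_field_incl in blast)

section \<open>Polynomials with coefficients in a subring\<close>

definition coeffs_in :: "'a::field set \<Rightarrow> 'a poly \<Rightarrow> bool"
  where "coeffs_in K p \<longleftrightarrow> (\<forall>i. coeff p i \<in> K)"

lemma coeffs_in_mono: "coeffs_in K p \<Longrightarrow> K \<subseteq> L \<Longrightarrow> coeffs_in L p"
  by (auto simp: coeffs_in_def)

definition is_subring :: "'a::comm_ring_1 set \<Rightarrow> bool"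
  where "is_subring R \<longleftrightarrow> 0 \<in> R \<and> 1 \<in> R \<and> (\<forall>x\<in>R. \<forall>y\<in>R. x + y \<in> R \<and> x * y \<in> R) \<and> (\<forall>x\<in>R. - x \<in> R)"

lemma is_subfield_imp_subring: "is_subfield K \<Longrightarrow> is_subring K"
  by (auto simp: is_subfield_def is_subring_def)

context
  fixes R :: "'a::field set"
  assumes R: "is_subring R"
begin

lemma subring_0: "0 \<in> R" and subring_1: "1 \<in> R"
  and subring_add: "x \<in> R \<Longrightarrow> y \<in> R \<Longrightarrow> x + y \<in> R"
  and subring_mult: "x \<in> R \<Longrightarrow> y \<in> R \<Longrightarrow> x * y \<in> R"
  and subring_uminus: "x \<in> R \<Longrightarrow> - x \<in> R"
  using R by (auto simp: is_subring_def)

lemma subring_diff: "x \<in> R \<Longrightarrow> y \<in> R \<Longrightarrow> x - y \<in> R"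
  using subring_add[of x "- y"] subring_uminus[of y] by simp

lemma subring_of_nat: "of_nat n \<in> R"
  by (induction n) (auto intro: subring_0 subring_1 subring_add)

lemma subring_power: "x \<in> R \<Longrightarrow> x ^ n \<in> R"
  by (induction n) (auto intro: subring_1 subring_mult)

lemma subring_sum: "(\<And>i. i \<in> I \<Longrightarrow> f i \<in> R) \<Longrightarrow> sum f I \<in> R"
  by (induction I rule: infinite_finite_induct) (auto intro: subring_0 subring_add)

lemmas subring_intros = subring_0 subring_1 subring_add subring_mult subring_uminus subring_diff
  subring_of_nat subring_power subring_sum

lemma coeffs_in_0: "coeffs_in R 0"
  by (auto simp: coeffs_in_def intro: subring_intros)

lemma coeffs_in_pCons: "coeffs_in R (pCons a p) \<longleftrightarrow> a \<in> R \<and> coeffs_in R p"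
  unfolding coeffs_in_def by (metis coeff_pCons_0 coeff_pCons_Suc not0_implies_Suc)

lemma coeffs_in_1: "coeffs_in R 1"
  by (simp add: one_pCons coeffs_in_pCons coeffs_in_0 subring_1)

lemma coeffs_in_add: "coeffs_in R p \<Longrightarrow> coeffs_in R q \<Longrightarrow> coeffs_in R (p + q)"
  by (auto simp: coeffs_in_def intro: subring_intros)

lemma coeffs_in_uminus: "coeffs_in R p \<Longrightarrow> coeffs_in R (- p)"
  by (auto simp: coeffs_in_def intro: subring_intros)

lemma coeffs_in_diff: "coeffs_in R p \<Longrightarrow> coeffs_in R q \<Longrightarrow> coeffs_in R (p - q)"
  by (auto simp: coeffs_in_def intro: subring_intros)

lemma coeffs_in_mult: "coeffs_in R p \<Longrightarrow> coeffs_in R q \<Longrightarrow> coeffs_in R (p * q)"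
  by (auto simp: coeffs_in_def coeff_mult intro!: subring_intros)

lemma coeffs_in_smult: "a \<in> R \<Longrightarrow> coeffs_in R p \<Longrightarrow> coeffs_in R (smult a p)"
  by (auto simp: coeffs_in_def intro: subring_intros)

lemma coeffs_in_power: "coeffs_in R p \<Longrightarrow> coeffs_in R (p ^ n)"
  by (induction n) (auto intro: coeffs_in_1 coeffs_in_mult)

lemma coeffs_in_monom: "a \<in> R \<Longrightarrow> coeffs_in R (monom a n)"
  by (auto simp: coeffs_in_def intro: subring_intros)

lemma coeffs_in_pderiv: "coeffs_in R p \<Longrightarrow> coeffs_in R (pderiv p)"
  unfolding coeffs_in_def coeff_pderiv by (intro allI subring_mult subring_of_nat) auto

lemma poly_in_subring: "coeffs_in R p \<Longrightarrow> x \<in> R \<Longrightarrow> poly p x \<in> R"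
  unfolding poly_altdef by (intro subring_intros) (auto simp: coeffs_in_def)

text \<open>Long division only divides by the leading coefficient of g. This covers subfields and
  also valuation rings in which that coefficient is a unit.\<close>

lemma coeffs_in_division:
  assumes "coeffs_in R f" "coeffs_in R g" "g \<noteq> 0"
    and inv: "\<And>a. a \<in> R \<Longrightarrow> a / lead_coeff g \<in> R"
  shows "\<exists>q r. coeffs_in R q \<and> coeffs_in R r \<and> f = q * g + r \<and> (r = 0 \<or> degree r < degree g)"
  using assms(1)
proof (induction "degree f" arbitrary: f rule: less_induct)
  case less
  show ?case
  proof (cases "f = 0 \<or> degree f < degree g")
    case True
    then show ?thesis using less.prems coeffs_in_0
      by (intro exI[of _ 0] exI[of _ f]) auto
  next
    case False
    define m where "m = monom (lead_coeff f / lead_coeff g) (degree f - degree g)"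
    define h where "h = f - m * g"
    have f0: "f \<noteq> 0" using False by simp
    have m: "coeffs_in R m"
      unfolding m_def using less.prems assms(2)
      by (intro coeffs_in_monom inv) (auto simp: coeffs_in_def)
    have h: "coeffs_in R h"
      unfolding h_def by (intro coeffs_in_diff coeffs_in_mult m less.prems assms(2))
    have "m \<noteq> 0" "lead_coeff m = lead_coeff f / lead_coeff g" "degree m = degree f - degree g"
      using f0 assms(3) by (simp_all add: m_def degree_monom_eq)
    then have dm: "degree (m * g) = degree f" "lead_coeff (m * g) = lead_coeff f"
      using False assms(3) unfolding lead_coeff_mult by (simp_all add: degree_mult_eq)
    have "h = 0 \<or> degree h < degree f"
    proof (cases "degree f = 0")
      case True
      then have "degree h = 0" unfolding h_def using dm by (metis degree_diff_le le_zero_eq order_refl)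
      moreover have "coeff h 0 = 0" unfolding h_def using dm True by simp
      ultimately show ?thesis by (metis leading_coeff_0_iff)
    next
      case False
      have "degree h \<le> degree f" unfolding h_def using dm by (intro degree_diff_le) auto
      moreover have "coeff h (degree f) = 0" unfolding h_def using dm by simp
      ultimately show ?thesis
        by (metis leading_coeff_0_iff order_le_imp_less_or_eq)
    qed
    then show ?thesis
    proof
      assume "h = 0"
      then have "f = m * g + 0" by (simp add: h_def)
      then show ?thesis using m coeffs_in_0 by blast
    next
      assume "degree h < degree f"
      then obtain q r where "coeffs_in R q" "coeffs_in R r" "h = q * g + r" "r = 0 \<or> degree r < degree g"
        using less.hyps h by blast
      moreover from this have "f = (q + m) * g + r" by (simp add: h_def algebra_simps)
      ultimately show ?thesis using m coeffs_in_add by blast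
    qed
  qed
qed

end

section \<open>Simple algebraic extensions\<close>

context
  fixes K :: "'a::field set"
  assumes K: "is_subfield K"
begin

lemmas coeffs_in_subfield_0 = coeffs_in_0[OF is_subfield_imp_subring[OF K]]
  and coeffs_in_subfield_1 = coeffs_in_1[OF is_subfield_imp_subring[OF K]]
  and coeffs_in_subfield_pCons = coeffs_in_pCons[OF is_subfield_imp_subring[OF K]]
  and coeffs_in_subfield_add = coeffs_in_add[OF is_subfield_imp_subring[OF K]]
  and coeffs_in_subfield_mult = coeffs_in_mult[OF is_subfield_imp_subring[OF K]]
  and coeffs_in_subfield_uminus = coeffs_in_uminus[OF is_subfield_imp_subring[OF K]]

lemma poly_in_subfield:
  "is_subfield L \<Longrightarrow> K \<subseteq> L \<Longrightarrow> coeffs_in K p \<Longrightarrow> x \<in> L \<Longrightarrow> poly p x \<in> L"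
  using poly_in_subring[OF is_subfield_imp_subring] coeffs_in_mono by blast

lemma coeffs_in_subfield_division:
  assumes "coeffs_in K f" "coeffs_in K g" "g \<noteq> 0"
  shows "\<exists>q r. coeffs_in K q \<and> coeffs_in K r \<and> f = q * g + r \<and> (r = 0 \<or> degree r < degree g)"
  using assms by (intro coeffs_in_division is_subfield_imp_subring[OF K] subfield_divide[OF K])
    (auto simp: coeffs_in_def)

definition "adjoin w = {poly f w | f. coeffs_in K f}"

text \<open>Euclid's algorithm: m = q f + r gives f(w) q(w) = -r(w), so an inverse of the shorter
  r(w) yields one of f(w). Minimality of m keeps r(w) from vanishing.\<close>

lemma adjoin_inverse_reduced:
  assumes m: "coeffs_in K m" "m \<noteq> 0" "poly m w = 0"
    and min: "\<And>f. coeffs_in K f \<Longrightarrow> f \<noteq> 0 \<Longrightarrow> poly f w = 0 \<Longrightarrow> degree m \<le> degree f"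
    and f: "coeffs_in K f" "poly f w \<noteq> 0" "degree f < degree m"
  shows "\<exists>g. coeffs_in K g \<and> poly f w * poly g w = 1"
  using f
proof (induction "degree f" arbitrary: f rule: less_induct)
  case less
  have f0: "f \<noteq> 0" using less.prems by auto
  show ?case
  proof (cases "degree f = 0")
    case True
    then obtain c where c: "f = [:c:]" by (metis degree_0_id)
    then have "coeffs_in K [:inverse c:] \<and> poly f w * poly [:inverse c:] w = 1"
      using less.prems coeffs_in_subfield_0 by (auto simp: coeffs_in_subfield_pCons intro: subfield_intros[OF K])
    then show ?thesis by blast
  next
    case False
    obtain q r where qr: "coeffs_in K q" "coeffs_in K r" "m = q * f + r" "r = 0 \<or> degree r < degree f"
      using coeffs_in_subfield_division[OF m(1) less.prems(1) f0] by blast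
    have e: "poly f w * poly q w = - poly r w"
      using m(3) unfolding qr(3) by (simp add: eq_neg_iff_add_eq_0 mult.commute)
    have "poly r w \<noteq> 0"
    proof
      assume r0: "poly r w = 0"
      then have r: "r = 0" using min[OF qr(2) _ r0] qr(4) less.prems(3) by linarith
      have "poly q w = 0" using e r0 less.prems(2) by simp
      moreover have "q \<noteq> 0" using qr(3) r m(2) by auto
      moreover have "degree q < degree m"
        using qr(3) r f0 False \<open>q \<noteq> 0\<close> by (simp add: degree_mult_eq)
      ultimately show False using min[OF qr(1)] by auto
    qed
    moreover have "degree r < degree f" using calculation qr(4) by auto
    ultimately obtain g where "coeffs_in K g" "poly r w * poly g w = 1"
      using less.hyps[of r] qr(2) less.prems(3) by auto
    then have "coeffs_in K (- (q * g))" "poly f w * poly (- (q * g)) w = 1"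
      using e qr(1) by (auto intro: coeffs_in_subfield_uminus coeffs_in_subfield_mult simp: mult.assoc[symmetric])
    then show ?thesis by blast
  qed
qed

lemma adjoin_is_subfield:
  assumes "coeffs_in K m" "m \<noteq> 0" "poly m w = 0"
  shows "is_subfield (adjoin w)"
proof -
  define P where "P n \<longleftrightarrow> (\<exists>m. coeffs_in K m \<and> m \<noteq> 0 \<and> poly m w = 0 \<and> degree m = n)" for n
  have "P (degree m)" using assms unfolding P_def by blast
  then have "P (LEAST n. P n)" by (rule LeastI)
  then obtain m where m: "coeffs_in K m" "m \<noteq> 0" "poly m w = 0" and d: "degree m = (LEAST n. P n)"
    unfolding P_def by blast
  have min: "degree m \<le> degree f" if "coeffs_in K f" "f \<noteq> 0" "poly f w = 0" for f
    unfolding d by (rule Least_le) (use that in \<open>auto simp: P_def\<close>)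
  show ?thesis
  proof (rule is_subfieldI)
    show "0 \<in> adjoin w" using coeffs_in_subfield_0 poly_0 unfolding adjoin_def by (metis (mono_tags, lifting) mem_Collect_eq)
    show "1 \<in> adjoin w" using coeffs_in_subfield_1 poly_1 unfolding adjoin_def by (metis (mono_tags, lifting) mem_Collect_eq)
    fix x assume "x \<in> adjoin w"
    then obtain f where f: "coeffs_in K f" "x = poly f w" unfolding adjoin_def by blast
    show "- x \<in> adjoin w" using coeffs_in_subfield_uminus[OF f(1)] f(2) unfolding adjoin_def
      by (metis (mono_tags, lifting) mem_Collect_eq poly_minus)
    show "inverse x \<in> adjoin w" if "x \<noteq> 0"
    proof -
      obtain q r where qr: "coeffs_in K q" "coeffs_in K r" "f = q * m + r" "r = 0 \<or> degree r < degree m"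
        using coeffs_in_subfield_division[OF f(1) m(1,2)] by blast
      have rw: "poly r w = x" using m(3) qr(3) f(2) by simp
      then have "degree r < degree m" using that qr(4) by auto
      then have "\<exists>g. coeffs_in K g \<and> poly r w * poly g w = 1"
        using qr(2) rw that by (intro adjoin_inverse_reduced[OF m] min) auto
      then obtain g where g: "coeffs_in K g" "x * poly g w = 1" unfolding rw by blast
      have "inverse x = poly g w" by (rule inverse_unique[OF g(2)])
      then show ?thesis unfolding adjoin_def using g(1) by blast
    qed
    fix y assume "y \<in> adjoin w"
    then obtain g where g: "coeffs_in K g" "y = poly g w" unfolding adjoin_def by blast
    show "x + y \<in> adjoin w" using coeffs_in_subfield_add[OF f(1) g(1)] f(2) g(2) unfolding adjoin_def
      by (metis (mono_tags, lifting) mem_Collect_eq poly_add)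
    show "x * y \<in> adjoin w" using coeffs_in_subfield_mult[OF f(1) g(1)] f(2) g(2) unfolding adjoin_def
      by (metis (mono_tags, lifting) mem_Collect_eq poly_mult)
  qed
qed

lemma adjoin_incl: "K \<subseteq> adjoin w" and adjoin_mem: "w \<in> adjoin w"
proof -
  show "K \<subseteq> adjoin w"
  proof
    fix a assume "a \<in> K"
    then have "coeffs_in K [:a:]" "poly [:a:] w = a" by (simp_all add: coeffs_in_subfield_pCons coeffs_in_subfield_0)
    then show "a \<in> adjoin w" unfolding adjoin_def by (metis (mono_tags, lifting) mem_Collect_eq)
  qed
  have "coeffs_in K [:0, 1:]" "poly [:0, 1:] w = w"
    by (simp_all add: coeffs_in_subfield_pCons coeffs_in_subfield_0 subfield_intros[OF K])
  then show "w \<in> adjoin w" unfolding adjoin_def by (metis (mono_tags, lifting) mem_Collect_eq)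
qed

lemma adjoin_min: "is_subfield L \<Longrightarrow> K \<subseteq> L \<Longrightarrow> w \<in> L \<Longrightarrow> adjoin w \<subseteq> L"
  unfolding adjoin_def using poly_in_subfield by blast

lemma gen_field_insert:
  assumes "coeffs_in K m" "m \<noteq> 0" "poly m w = 0"
  shows "gen_field (insert w K) = adjoin w"
proof
  show "gen_field (insert w K) \<subseteq> adjoin w"
    by (intro gen_field_min adjoin_is_subfield[OF assms]) (use adjoin_incl adjoin_mem in auto)
  show "adjoin w \<subseteq> gen_field (insert w K)"
    by (intro adjoin_min gen_field_is_subfield) (use gen_field_incl in blast)+
qed

lemma adjoin_reduce:
  assumes m: "coeffs_in K m" "m \<noteq> 0" "poly m w = 0" and x: "x \<in> adjoin w"
  obtains r where "coeffs_in K r" "x = poly r w" "r = 0 \<or> degree r < degree m"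
proof -
  obtain f where f: "coeffs_in K f" "x = poly f w" using x unfolding adjoin_def by blast
  obtain q r where "coeffs_in K q" "coeffs_in K r" "f = q * m + r" "r = 0 \<or> degree r < degree m"
    using coeffs_in_subfield_division[OF f(1) m(1,2)] by blast
  then show ?thesis using that[of r] m(3) f(2) by simp
qed

lemma adjoin_sqrt:
  assumes "y ^ 2 \<in> K"
  shows "adjoin y = {r + s * y | r s. r \<in> K \<and> s \<in> K}"
proof
  have m: "coeffs_in K [:- (y^2), 0, 1:]" "[:- (y^2), 0, 1:] \<noteq> 0" "poly [:- (y^2), 0, 1:] y = 0"
    using assms by (auto simp: coeffs_in_subfield_pCons coeffs_in_subfield_0 power2_eq_square intro: subfield_intros[OF K])
  show "adjoin y \<subseteq> {r + s * y | r s. r \<in> K \<and> s \<in> K}"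
  proof
    fix x assume "x \<in> adjoin y"
    then obtain r where r: "coeffs_in K r" "x = poly r y" "r = 0 \<or> degree r < degree [:- (y^2), 0, 1:]"
      by (rule adjoin_reduce[OF m])
    then have "r = [:coeff r 0, coeff r 1:]"
      by (intro poly_eqI) (auto simp: coeff_pCons coeff_eq_0 split: nat.splits)
    then have "x = coeff r 0 + coeff r 1 * y" using r(2) by (metis (no_types) mult.commute add.right_neutral mult_zero_right poly_0 poly_pCons)
    then show "x \<in> {r + s * y | r s. r \<in> K \<and> s \<in> K}" using r(1) unfolding coeffs_in_def by blast
  qed
  have "is_subfield (adjoin y)" by (rule adjoin_is_subfield[OF m])
  then show "{r + s * y | r s. r \<in> K \<and> s \<in> K} \<subseteq> adjoin y"
    using adjoin_incl adjoin_mem by (auto intro!: subfield_add subfield_mult)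
qed

text \<open>A shortest annihilator m of w divides g. If its degree is 1 or 2, then m or its cofactor
  is linear and has a root in K.\<close>

lemma rootless_cubic_minimal:
  assumes g: "coeffs_in K g" "degree g = 3" "poly g w = 0"
    and noroot: "\<And>x. x \<in> K \<Longrightarrow> poly g x \<noteq> 0"
    and f: "coeffs_in K f" "f \<noteq> 0" "poly f w = 0"
  shows "degree f \<ge> 3"
proof (rule ccontr)
  assume n: "\<not> degree f \<ge> 3"
  have lin: False if "coeffs_in K h" "degree h = 1" "h dvd g" for h
  proof -
    have h: "h = [:coeff h 0, coeff h 1:]"
      using that by (intro poly_eqI) (auto simp: coeff_pCons coeff_eq_0 split: nat.splits)
    have h1: "coeff h 1 \<noteq> 0" using that by (metis leading_coeff_0_iff degree_0 zero_neq_one)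
    have "poly h (- coeff h 0 / coeff h 1) = 0" by (subst h) (use h1 in simp)
    then have "poly g (- coeff h 0 / coeff h 1) = 0" using that(3) by (metis dvdE mult_zero_left poly_mult)
    moreover have "- coeff h 0 / coeff h 1 \<in> K"
      using that(1) unfolding coeffs_in_def by (intro subfield_intros[OF K]) auto
    ultimately show False using noroot by blast
  qed
  define P where "P n \<longleftrightarrow> (\<exists>m. coeffs_in K m \<and> m \<noteq> 0 \<and> poly m w = 0 \<and> degree m = n)" for n
  have "P (degree f)" using f unfolding P_def by blast
  then have "P (LEAST n. P n)" and le: "(LEAST n. P n) \<le> degree f" by (auto intro: LeastI Least_le)
  then obtain m where m: "coeffs_in K m" "m \<noteq> 0" "poly m w = 0" and d: "degree m = (LEAST n. P n)"
    unfolding P_def by blast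
  have min: "degree m \<le> degree f" if "coeffs_in K f" "f \<noteq> 0" "poly f w = 0" for f
    unfolding d by (rule Least_le) (use that in \<open>auto simp: P_def\<close>)
  obtain q r where qr: "coeffs_in K q" "coeffs_in K r" "g = q * m + r" "r = 0 \<or> degree r < degree m"
    using coeffs_in_subfield_division[OF g(1) m(1,2)] by blast
  have "poly r w = 0" using g(3) m(3) qr(3) by simp
  then have "r = 0" using min[OF qr(2)] qr(4) by fastforce
  then have gq: "g = q * m" using qr(3) by simp
  have q0: "q \<noteq> 0" using gq g(2) by auto
  have deg: "degree q + degree m = 3" using gq g(2) q0 m(2) by (simp add: degree_mult_eq)
  have "degree m \<noteq> 0"
  proof
    assume "degree m = 0"
    then obtain c where "m = [:c:]" by (metis degree_0_id)
    then show False using m(2,3) by simp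
  qed
  then consider "degree m = 1" | "degree q = 1" using deg le d n by linarith
  then show False using lin[OF m(1)] lin[OF qr(1)] gq by cases auto
qed

end

text \<open>The dimension is built by line extensions through K, K + K w and K + K w + K w^2; the
  bound on annihilators provides the independence at each stage.\<close>

lemma ext_degree_3:
  fixes w :: "'a::Fields.field"
  assumes K: "is_subfield K" and g: "coeffs_in K g" "degree g = 3" "poly g w = 0"
    and min: "\<And>f. coeffs_in K f \<Longrightarrow> f \<noteq> 0 \<Longrightarrow> poly f w = 0 \<Longrightarrow> degree f \<ge> 3"
  shows "ring.dimension ring_of_type_algebra 3 K (adjoin K w)"
    and "adjoin K w = {c0 + c1 * w + c2 * w^2 | c0 c1 c2. c0 \<in> K \<and> c1 \<in> K \<and> c2 \<in> K}"
proof -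
  have lin: "c2 = 0 \<and> c1 = 0 \<and> c0 = 0"
    if "c0 \<in> K" "c1 \<in> K" "c2 \<in> K" "c0 + c1 * w + c2 * w^2 = 0" for c0 c1 c2
  proof (rule ccontr)
    assume n: "\<not> ?thesis"
    have "coeffs_in K [:c0, c1, c2:]" using that by (simp add: coeffs_in_subfield_pCons[OF K] coeffs_in_subfield_0[OF K])
    moreover have "[:c0, c1, c2:] \<noteq> 0" using n by auto
    moreover have "poly [:c0, c1, c2:] w = 0" using that(4) by (simp add: algebra_simps power2_eq_square)
    ultimately have "degree [:c0, c1, c2:] \<ge> 3" by (rule min)
    then show False by (simp split: if_splits)
  qed
  have g0: "g \<noteq> 0" using g(2) by auto
  show *: "adjoin K w = {c0 + c1 * w + c2 * w^2 | c0 c1 c2. c0 \<in> K \<and> c1 \<in> K \<and> c2 \<in> K}" (is "_ = ?R")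
  proof
    show "adjoin K w \<subseteq> ?R"
    proof
      fix x assume "x \<in> adjoin K w"
      then obtain r where r: "coeffs_in K r" "x = poly r w" "r = 0 \<or> degree r < degree g"
        by (rule adjoin_reduce[OF K g(1) g0 g(3)])
      then have "r = [:coeff r 0, coeff r 1, coeff r 2:]"
        using g(2) by (intro poly_eqI) (auto simp: coeff_pCons coeff_eq_0 numeral_2_eq_2 split: nat.splits)
      then have "x = poly [:coeff r 0, coeff r 1, coeff r 2:] w" using r(2) by simp
      then have "x = coeff r 0 + coeff r 1 * w + coeff r 2 * w^2"
        by (simp add: algebra_simps power2_eq_square)
      then show "x \<in> ?R" using r(1) unfolding coeffs_in_def by blast
    qed
    have "is_subfield (adjoin K w)" by (rule adjoin_is_subfield[OF K g(1) g0 g(3)])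
    then show "?R \<subseteq> adjoin K w"
      using adjoin_incl[OF K] adjoin_mem[OF K]
      by (auto intro!: subfield_add subfield_mult subfield_power)
  qed
  let ?O = "ring_of_type_algebra :: 'a ring"
  have le: "ring.line_extension ?O K a E = {k * a + e | k e. k \<in> K \<and> e \<in> E}" for a E
    by (rule Set.set_eqI) (auto simp: ring.line_extension_mem_iff[OF \<Omega>_ring])
  have E1: "ring.line_extension ?O K 1 {0} = K" by (auto simp: le)
  have E2: "ring.line_extension ?O K w K = {k * w + e | k e. k \<in> K \<and> e \<in> K}" by (simp add: le)
  have E3: "ring.line_extension ?O K (w^2) {k * w + e | k e. k \<in> K \<and> e \<in> K} = adjoin K w"
    unfolding le * by (force simp: algebra_simps)
  have d1: "ring.dimension ?O 1 K K"
    using ring.Suc_dim[OF \<Omega>_ring, of 1 "{0}" 0 K] ring.zero_dim[OF \<Omega>_ring, of K] E1 by simp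
  have "w \<notin> K"
    using lin[of "- w" 1 0] by (auto intro: subfield_intros[OF K])
  then have d2: "ring.dimension ?O 2 K {k * w + e | k e. k \<in> K \<and> e \<in> K}"
    using ring.Suc_dim[OF \<Omega>_ring, of w K 1 K] d1 E2 by (simp add: numeral_2_eq_2)
  have "w^2 \<notin> {k * w + e | k e. k \<in> K \<and> e \<in> K}"
  proof
    assume "w^2 \<in> {k * w + e | k e. k \<in> K \<and> e \<in> K}"
    then obtain k e where "k \<in> K" "e \<in> K" "w^2 = k * w + e" by blast
    then show False using lin[of "- e" "- k" 1] by (simp add: subfield_intros[OF K])
  qed
  then show "ring.dimension ?O 3 K (adjoin K w)"
    using ring.Suc_dim[OF \<Omega>_ring, of "w^2" "{k * w + e | k e. k \<in> K \<and> e \<in> K}" 2 K] d2 E3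
    by (simp add: numeral_3_eq_3 numeral_2_eq_2)
qed

section \<open>Places\<close>

definition cpoly :: "'k::field poly \<Rightarrow> 'k geo poly"
  where "cpoly f = map_poly cst f"

lemma coeff_cpoly [simp]: "coeff (cpoly f) i = cst (coeff f i)"
  by (simp add: cpoly_def coeff_map_poly)

lemma degree_cpoly [simp]: "degree (cpoly f) = degree f"
  unfolding cpoly_def by (rule degree_map_poly) simp

lemma cpoly_hom [simp]:
  "cpoly 0 = 0" "cpoly 1 = 1" "cpoly (f + g) = cpoly f + cpoly g" "cpoly (f * g) = cpoly f * cpoly g"
  "cpoly (- f) = - cpoly f" "cpoly (f - g) = cpoly f - cpoly g" "cpoly (pCons a f) = pCons (cst a) (cpoly f)"
  by (rule poly_eqI; simp add: coeff_mult cst.hom_sum cst.hom_mult cst.hom_add cst.hom_uminus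
      cst.hom_minus coeff_pCons one_pCons split: nat.splits)+

lemma cpoly_eq_0_iff [simp]: "cpoly f = 0 \<longleftrightarrow> f = 0"
  by (auto simp: poly_eq_iff)

locale place =
  fixes K :: "'k::field geo set" and P :: "'k geo \<Rightarrow> int"
  assumes K: "is_subfield K" and cst_in: "cst c \<in> K" and P: "P \<in> places K"
begin

lemma P_0 [simp]: "P 0 = 0"
  using P by (auto simp: places_def)

lemma P_outside: "x \<notin> K \<Longrightarrow> P x = 0"
  using P by (auto simp: places_def)

lemma P_cst [simp]: "P (cst c) = 0"
  using P by (auto simp: places_def)

lemma P_mult: "x \<in> K \<Longrightarrow> y \<in> K \<Longrightarrow> x \<noteq> 0 \<Longrightarrow> y \<noteq> 0 \<Longrightarrow> P (x * y) = P x + P y"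
  using P by (auto simp: places_def)

lemma P_add: "x \<in> K \<Longrightarrow> y \<in> K \<Longrightarrow> x \<noteq> 0 \<Longrightarrow> y \<noteq> 0 \<Longrightarrow> x + y \<noteq> 0 \<Longrightarrow> min (P x) (P y) \<le> P (x + y)"
  using P by (auto simp: places_def)

lemma P_attains_1: "\<exists>x\<in>K. P x = 1"
  using P by (auto simp: places_def)

lemma P_1 [simp]: "P 1 = 0"
  using P_cst[of 1] by simp

lemma P_uminus [simp]: "P (- x) = P x"
proof (cases "x \<in> K \<and> x \<noteq> 0")
  case True
  have "P (- 1) = 0" "- 1 \<in> K"
    using P_cst[of "- 1"] cst_in[of "- 1"] unfolding cst.hom_uminus cst.hom_one .
  then show ?thesis using P_mult[of "- 1" x] True by simp
next
  case False
  have "- x \<notin> K" if "x \<notin> K" using subfield_uminus[OF K, of "- x"] that by auto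
  then show ?thesis using False P_outside by auto
qed

lemma P_inverse: "x \<in> K \<Longrightarrow> P (inverse x) = - P x"
  using P_mult[of x "inverse x"] subfield_inverse[OF K] by (cases "x = 0") auto

lemma P_divide: "x \<in> K \<Longrightarrow> y \<in> K \<Longrightarrow> x \<noteq> 0 \<Longrightarrow> y \<noteq> 0 \<Longrightarrow> P (x / y) = P x - P y"
  using P_mult[of x "inverse y"] subfield_inverse[OF K, of y] by (simp add: divide_inverse P_inverse)

lemma P_power: "x \<in> K \<Longrightarrow> x \<noteq> 0 \<Longrightarrow> P (x ^ n) = int n * P x"
  by (induction n) (auto simp: P_mult subfield_power[OF K] algebra_simps)

definition "int_ring = {x \<in> K. 0 \<le> P x}"
definition "max_ideal = {x \<in> K. vanishes P x}"

lemma max_ideal_subset: "max_ideal \<subseteq> int_ring"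
  by (auto simp: max_ideal_def int_ring_def vanishes_def)

lemma int_ring_subset: "int_ring \<subseteq> K"
  by (auto simp: int_ring_def)

lemma max_ideal_iff: "x \<in> int_ring \<Longrightarrow> x \<in> max_ideal \<longleftrightarrow> vanishes P x"
  by (auto simp: max_ideal_def int_ring_def)

lemma int_ring_add: "x \<in> int_ring \<Longrightarrow> y \<in> int_ring \<Longrightarrow> x + y \<in> int_ring"
  using P_add[of x y] subfield_add[OF K, of x y]
  by (cases "x = 0 \<or> y = 0 \<or> x + y = 0") (auto simp: int_ring_def)

lemma int_ring_mult: "x \<in> int_ring \<Longrightarrow> y \<in> int_ring \<Longrightarrow> x * y \<in> int_ring"
  using P_mult[of x y] subfield_mult[OF K, of x y]
  by (cases "x = 0 \<or> y = 0") (auto simp: int_ring_def)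

lemma int_ring_cst: "cst c \<in> int_ring"
  using cst_in by (simp add: int_ring_def)

lemma int_ring_subring: "is_subring int_ring"
  unfolding is_subring_def
  using int_ring_add int_ring_mult subfield_0[OF K] subfield_1[OF K] subfield_uminus[OF K]
  by (auto simp: int_ring_def)

lemma max_ideal_0: "0 \<in> max_ideal"
  using subfield_0[OF K] by (simp add: max_ideal_def vanishes_def)

lemma max_ideal_add: "x \<in> max_ideal \<Longrightarrow> y \<in> max_ideal \<Longrightarrow> x + y \<in> max_ideal"
  using P_add[of x y] subfield_add[OF K, of x y]
  by (cases "x = 0 \<or> y = 0 \<or> x + y = 0") (auto simp: max_ideal_def vanishes_def)

lemma max_ideal_mult: "x \<in> int_ring \<Longrightarrow> y \<in> max_ideal \<Longrightarrow> x * y \<in> max_ideal"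
  using P_mult[of x y] subfield_mult[OF K, of x y]
  by (cases "x = 0 \<or> y = 0") (auto simp: max_ideal_def int_ring_def vanishes_def)

lemma max_ideal_uminus: "x \<in> max_ideal \<Longrightarrow> - x \<in> max_ideal"
  using subfield_uminus[OF K, of x] by (auto simp: max_ideal_def vanishes_def)

lemma max_ideal_diff: "x \<in> max_ideal \<Longrightarrow> y \<in> max_ideal \<Longrightarrow> x - y \<in> max_ideal"
  using max_ideal_add[of x "- y"] max_ideal_uminus[of y] by simp

lemma max_ideal_sum: "(\<And>i. i \<in> I \<Longrightarrow> f i \<in> max_ideal) \<Longrightarrow> sum f I \<in> max_ideal"
  by (induction I rule: infinite_finite_induct) (auto intro: max_ideal_0 max_ideal_add)

lemma max_ideal_prime: "x \<in> int_ring \<Longrightarrow> y \<in> int_ring \<Longrightarrow> x * y \<in> max_ideal \<Longrightarrow> x \<in> max_ideal \<or> y \<in> max_ideal"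
  using P_mult[of x y] by (cases "x = 0 \<or> y = 0") (auto simp: max_ideal_def int_ring_def vanishes_def)

lemma max_ideal_power: "x \<in> int_ring \<Longrightarrow> x ^ n \<in> max_ideal \<Longrightarrow> x \<in> max_ideal"
proof (induction n)
  case 0
  then show ?case by (simp add: max_ideal_def vanishes_def)
next
  case (Suc n)
  then show ?case using max_ideal_prime[of x "x ^ n"] subring_power[OF int_ring_subring, of x n] by auto
qed

lemma cst_not_max_ideal: "c \<noteq> 0 \<Longrightarrow> cst c \<notin> max_ideal"
  by (simp add: max_ideal_def vanishes_def)

lemma one_not_max_ideal: "1 \<notin> max_ideal"
  using cst_not_max_ideal[of 1] by simp

lemma int_ring_unit: "x \<in> int_ring \<Longrightarrow> x \<notin> max_ideal \<Longrightarrow> inverse x \<in> int_ring \<and> x \<noteq> 0 \<and> P x = 0"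
  using subfield_inverse[OF K, of x] P_inverse[of x] by (auto simp: int_ring_def max_ideal_def vanishes_def)

lemma int_ring_divide_unit: "x \<in> int_ring \<Longrightarrow> y \<in> int_ring \<Longrightarrow> y \<notin> max_ideal \<Longrightarrow> x / y \<in> int_ring"
  using int_ring_mult[of x "inverse y"] int_ring_unit[of y] by (simp add: divide_inverse)

lemma poly_int_ring: "coeffs_in int_ring f \<Longrightarrow> x \<in> int_ring \<Longrightarrow> poly f x \<in> int_ring"
  using poly_in_subring[OF int_ring_subring] .

lemma poly_max_ideal:
  assumes "\<And>i. coeff f i \<in> max_ideal" "x \<in> int_ring"
  shows "poly f x \<in> max_ideal"
  unfolding poly_altdef
  by (intro max_ideal_sum) (metis assms max_ideal_mult mult.commute subring_power[OF int_ring_subring])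

lemma coeffs_max_ideal_mult:
  assumes "coeffs_in int_ring f" "\<And>i. coeff g i \<in> max_ideal"
  shows "coeff (f * g) i \<in> max_ideal"
  unfolding coeff_mult using assms by (intro max_ideal_sum max_ideal_mult) (auto simp: coeffs_in_def)

lemma int_ring_of_nat: "of_nat n \<in> int_ring"
  by (rule subring_of_nat[OF int_ring_subring])

lemma cpoly_int_ring: "coeffs_in int_ring (cpoly f)"
  by (simp add: coeffs_in_def int_ring_cst)

lemma max_ideal_of_power:
  assumes "x \<in> K" "x ^ n \<in> int_ring" "n > 0"
  shows "x \<in> int_ring"
  using assms P_power[of x n] by (cases "x = 0") (auto simp: int_ring_def zero_le_mult_iff)

text \<open>Gauss's content: b is a coefficient of least value, hence lies in F. The quotient g has
  a nonzero reduction at the place.\<close>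

lemma primitive_part:
  assumes F: "is_subfield F" "F \<subseteq> K" and f: "coeffs_in F f" "f \<noteq> 0"
  obtains b g where "b \<in> F" "b \<noteq> 0" "f = smult b g" "coeffs_in F g" "coeffs_in int_ring g"
    "\<exists>i. coeff g i \<notin> max_ideal"
proof -
  define S where "S = {i. coeff f i \<noteq> 0}"
  have "finite S" unfolding S_def using MOST_coeff_eq_0[of f] by (simp add: MOST_iff_cofinite)
  moreover have "S \<noteq> {}" using f(2) unfolding S_def by (auto simp: poly_eq_iff)
  ultimately obtain j where j: "j \<in> S" "\<And>i. i \<in> S \<Longrightarrow> P (coeff f j) \<le> P (coeff f i)"
    using ex_min_if_finite[of "(\<lambda>i. P (coeff f i)) ` S"] by (auto simp: not_less)
  define b where "b = coeff f j"
  define g where "g = smult (inverse b) f"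
  have b: "b \<in> F" "b \<noteq> 0" using j(1) f(1) by (auto simp: b_def S_def coeffs_in_def)
  have gF: "coeffs_in F g"
    unfolding g_def using coeffs_in_smult[OF is_subfield_imp_subring[OF F(1)]] subfield_inverse[OF F(1)] b f by blast
  have bK: "b \<in> K" using b F by auto
  have fK: "coeff f i \<in> K" for i using f(1) F(2) by (auto simp: coeffs_in_def)
  have "coeff g i \<in> int_ring" for i
  proof (cases "i \<in> S")
    case True
    then have "P (coeff g i) = P (coeff f i) - P b"
      using P_divide[OF fK[of i] bK] b by (simp add: g_def S_def divide_inverse mult.commute)
    moreover have "coeff g i \<in> K" using gF F(2) by (auto simp: coeffs_in_def)
    ultimately show ?thesis using j(2)[OF True] by (simp add: int_ring_def b_def)
  next
    case False
    then show ?thesis using subring_0[OF int_ring_subring] by (simp add: g_def S_def)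
  qed
  then have "coeffs_in int_ring g" by (simp add: coeffs_in_def)
  moreover have "coeff g j = 1" using b by (simp add: g_def b_def)
  then have "\<exists>i. coeff g i \<notin> max_ideal" using one_not_max_ideal by metis
  moreover have "f = smult b g" using b by (simp add: g_def)
  ultimately show ?thesis using that[of b g] b gF by blast
qed

text \<open>Reduction modulo the place: an element satisfying a polynomial with unit derivative generates an
  unramified extension. The polynomial \<open>h\<close> reduces to the minimal polynomial of the residue of \<open>\<theta>\<close>.\<close>

lemma minimal_residue_poly:
  assumes F: "is_subfield F" "F \<subseteq> K" and \<theta>: "\<theta> \<in> int_ring"
    and g: "coeffs_in (F \<inter> int_ring) g" "\<exists>i. coeff g i \<notin> max_ideal" "poly g \<theta> \<in> max_ideal"
  obtains h where "coeffs_in (F \<inter> int_ring) h" "lead_coeff h \<notin> max_ideal" "poly h \<theta> \<in> max_ideal"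
    "degree h \<le> degree g"
    "\<forall>r i. coeffs_in (F \<inter> int_ring) r \<longrightarrow> degree r < degree h \<longrightarrow> poly r \<theta> \<in> max_ideal \<longrightarrow> coeff r i \<in> max_ideal"
proof -
  have R: "is_subring (F \<inter> int_ring)"
    using is_subfield_imp_subring[OF F(1)] int_ring_subring by (auto simp: is_subring_def)
  define Q where "Q n \<longleftrightarrow> (\<exists>h. coeffs_in (F \<inter> int_ring) h \<and> (\<exists>i. coeff h i \<notin> max_ideal) \<and>
      poly h \<theta> \<in> max_ideal \<and> degree h = n)" for n
  have "Q (degree g)" using g unfolding Q_def by blast
  then have "Q (LEAST n. Q n)" and le: "(LEAST n. Q n) \<le> degree g" by (auto intro: LeastI Least_le)
  then obtain h where h: "coeffs_in (F \<inter> int_ring) h" "\<exists>i. coeff h i \<notin> max_ideal" "poly h \<theta> \<in> max_ideal"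
    "degree h = (LEAST n. Q n)" unfolding Q_def by blast
  have min: "coeff r i \<in> max_ideal"
    if "coeffs_in (F \<inter> int_ring) r" "degree r < degree h" "poly r \<theta> \<in> max_ideal" for r i
  proof (rule ccontr)
    assume "coeff r i \<notin> max_ideal"
    then have "Q (degree r)" using that unfolding Q_def by blast
    then show False using that(2) not_less_Least h(4) by auto
  qed
  have "lead_coeff h \<notin> max_ideal"
  proof
    assume lc: "lead_coeff h \<in> max_ideal"
    \<comment> \<open>Dropping a leading term that reduces to zero would leave a shorter
      candidate.\<close>
    define r where "r = h - monom (lead_coeff h) (degree h)"
    have lF: "lead_coeff h \<in> F \<inter> int_ring" using h(1) by (auto simp: coeffs_in_def)
    have r: "coeffs_in (F \<inter> int_ring) r"
      unfolding r_def by (intro coeffs_in_diff[OF R] coeffs_in_monom[OF R] h(1) lF)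
    have "poly (monom (lead_coeff h) (degree h)) \<theta> \<in> max_ideal"
      using lc \<theta> by (intro poly_max_ideal) (auto simp: max_ideal_0)
    then have rv: "poly r \<theta> \<in> max_ideal" unfolding r_def using h(3) by (simp add: max_ideal_diff)
    obtain i where i: "coeff h i \<notin> max_ideal" using h(2) by blast
    then have "i \<noteq> degree h" using lc by auto
    then have ri: "coeff r i \<notin> max_ideal" using i by (simp add: r_def)
    have "degree r \<le> degree h" unfolding r_def by (intro degree_diff_le) (auto simp: degree_monom_le)
    moreover have "coeff r (degree h) = 0" by (simp add: r_def)
    moreover have "r \<noteq> 0" using ri max_ideal_0 by auto
    ultimately have "degree r < degree h" by (metis leading_coeff_0_iff order_le_imp_less_or_eq)
    then show False using min[OF r _ rv] ri by blast
  qed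
  then show ?thesis using that[of h] h(1,3,4) min le by simp
qed

end

text \<open>The reduction of \<open>h\<close> is the minimal polynomial of the residue of a, of
  degree n at most 3. In characteristic other than 2 and 3 the leading coefficient n lc(h) of the
  derivative is a unit, so by minimality the derivative does not vanish there.\<close>

lemma residue_separable:
  assumes "place L Q" and F: "is_subfield F" "F \<subseteq> L"
    and char: "(2::'k::field) \<noteq> 0" "(3::'k) \<noteq> 0"
    and alg: "\<And>a. a \<in> L \<Longrightarrow> \<exists>f. coeffs_in F f \<and> f \<noteq> 0 \<and> degree f \<le> 3 \<and> poly f (a :: 'k geo) = 0"
  shows "separable_residue F L Q"
  unfolding separable_residue_def
proof (intro ballI impI)
  interpret place L Q by fact
  fix a assume a: "a \<in> L" "0 \<le> Q a"
  have R: "is_subring (F \<inter> int_ring)"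
    using is_subfield_imp_subring[OF F(1)] int_ring_subring by (auto simp: is_subring_def)
  have a': "a \<in> int_ring" using a by (simp add: int_ring_def)
  obtain f where f: "coeffs_in F f" "f \<noteq> 0" "degree f \<le> 3" "poly f a = 0" using alg[OF a(1)] by blast
  obtain b g where bg: "b \<noteq> 0" "f = smult b g" "coeffs_in F g" "coeffs_in int_ring g" "\<exists>i. coeff g i \<notin> max_ideal"
    using primitive_part[OF F f(1,2)] by metis
  have g: "coeffs_in (F \<inter> int_ring) g" using bg by (auto simp: coeffs_in_def)
  have "poly g a = 0" using f(4) bg by simp
  then have ga: "poly g a \<in> max_ideal" by (simp add: max_ideal_0)
  obtain h where h: "coeffs_in (F \<inter> int_ring) h" "lead_coeff h \<notin> max_ideal" "poly h a \<in> max_ideal"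
    "degree h \<le> degree g"
    "\<forall>r i. coeffs_in (F \<inter> int_ring) r \<longrightarrow> degree r < degree h \<longrightarrow> poly r a \<in> max_ideal \<longrightarrow> coeff r i \<in> max_ideal"
    by (rule minimal_residue_poly[OF F a' g bg(5) ga])
  have d0: "degree h \<noteq> 0"
  proof
    assume "degree h = 0"
    then obtain c where "h = [:c:]" by (metis degree_0_id)
    then show False using h(2,3) by simp
  qed
  have d3: "degree h \<le> 3" using h(4) f(3) bg(1,2) by simp
  define n where "n = degree h"
  have n: "n = 1 \<or> n = 2 \<or> n = 3" using d0 d3 by (auto simp: n_def)
  have nz: "(of_nat n :: 'k) \<noteq> 0" using n char by auto
  have "poly (pderiv h) a \<notin> max_ideal"
  proof
    assume "poly (pderiv h) a \<in> max_ideal"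
    moreover have "degree (pderiv h) \<le> degree h - 1"
      by (intro degree_le) (auto simp: coeff_pderiv coeff_eq_0)
    then have "degree (pderiv h) < degree h" using d0 by simp
    ultimately have "coeff (pderiv h) (n - 1) \<in> max_ideal"
      using h(5) coeffs_in_pderiv[OF R h(1)] by blast
    moreover have "coeff (pderiv h) (n - 1) = cst (of_nat n) * lead_coeff h"
    proof -
      have "Suc (n - 1) = n" using n by auto
      then show ?thesis by (simp only: coeff_pderiv cst.hom_of_nat n_def)
    qed
    ultimately have "cst (of_nat n) * lead_coeff h \<in> max_ideal" by simp
    then show False
      using max_ideal_prime[OF int_ring_cst, of "lead_coeff h"] h(1,2) cst_not_max_ideal[OF nz]
      by (auto simp: coeffs_in_def)
  qed
  moreover have "poly (pderiv h) a \<in> int_ring" "poly h a \<in> int_ring"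
    using poly_int_ring[OF _ a'] coeffs_in_pderiv[OF R h(1)] h(1) by (auto intro: coeffs_in_mono)
  ultimately show "\<exists>p. (\<forall>i. coeff p i \<in> F \<and> 0 \<le> Q (coeff p i)) \<and> vanishes Q (poly p a) \<and> \<not> vanishes Q (poly (pderiv p) a)"
    using h(1,3) max_ideal_iff by (intro exI[of _ h]) (auto simp: coeffs_in_def int_ring_def)
qed

text \<open>A simple root of the reduction of g causes no ramification: the maximal ideal of the
  place is generated by elements of F. The proof splits contents in F off a value s(theta) until a
  unit remains.\<close>

lemma etale_value_group:
  assumes "place L Q" and F: "is_subfield F" "F \<subseteq> L"
    and \<theta>: "\<theta> \<in> L" "0 \<le> Q \<theta>" "L = adjoin F \<theta>"
    and g: "coeffs_in F g" "\<And>i. 0 \<le> Q (coeff g i)" "lead_coeff g = 1" "poly g \<theta> = 0"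
      "\<not> vanishes Q (poly (pderiv g) \<theta>)"
  shows "\<exists>x\<in>F. Q x = 1"
proof -
  interpret place L Q by fact
  define R where "R = F \<inter> int_ring"
  have R: "is_subring R"
    using is_subfield_imp_subring[OF F(1)] int_ring_subring by (auto simp: is_subring_def R_def)
  have RI: "coeffs_in R f \<Longrightarrow> coeffs_in int_ring f" for f by (auto simp: R_def coeffs_in_def)
  have \<theta>': "\<theta> \<in> int_ring" using \<theta>(1,2) by (simp add: int_ring_def)
  have gR: "coeffs_in R g" using g(1,2) F(2) by (auto simp: R_def coeffs_in_def int_ring_def)
  have g1: "\<exists>i. coeff g i \<notin> max_ideal" using g(3) one_not_max_ideal by metis
  have g\<theta>: "poly g \<theta> \<in> max_ideal" using g(4) max_ideal_0 by simp
  obtain h where h: "coeffs_in R h" "lead_coeff h \<notin> max_ideal" "poly h \<theta> \<in> max_ideal"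
    "degree h \<le> degree g"
    "\<forall>r i. coeffs_in R r \<longrightarrow> degree r < degree h \<longrightarrow> poly r \<theta> \<in> max_ideal \<longrightarrow> coeff r i \<in> max_ideal"
    unfolding R_def by (rule minimal_residue_poly[OF F \<theta>' gR[unfolded R_def] g1 g\<theta>])
  have h0: "h \<noteq> 0" using h(2) max_ideal_0 by auto
  have lh: "c / lead_coeff h \<in> R" if "c \<in> R" for c
    using that h(1,2) int_ring_divide_unit subfield_divide[OF F(1)] by (auto simp: R_def coeffs_in_def)
  have red: "\<exists>q r. coeffs_in R q \<and> coeffs_in R r \<and> s = q * h + r \<and> (\<forall>i. coeff r i \<in> max_ideal)"
    if s: "coeffs_in R s" "poly s \<theta> \<in> max_ideal" for s
  proof -
    obtain q r where qr: "coeffs_in R q" "coeffs_in R r" "s = q * h + r" "r = 0 \<or> degree r < degree h"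
      using coeffs_in_division[OF R s(1) h(1) h0 lh] by blast
    have "poly q \<theta> * poly h \<theta> \<in> max_ideal"
      by (intro max_ideal_mult poly_int_ring RI qr \<theta>' h)
    then have "poly s \<theta> - poly q \<theta> * poly h \<theta> \<in> max_ideal" by (intro max_ideal_diff s(2))
    then have "poly r \<theta> \<in> max_ideal" by (simp add: qr(3))
    then have "coeff r i \<in> max_ideal" for i using h(5) qr(2,4) max_ideal_0 by auto
    then show ?thesis using qr by blast
  qed
  obtain m r where m: "coeffs_in R m" "coeffs_in R r" "g = m * h + r" "\<And>i. coeff r i \<in> max_ideal"
    using red[OF gR] g(4) max_ideal_0 by metis
  \<comment> \<open>Otherwise the reductions of m and h would have a common root and theta would be
    a multiple root of the reduction of g.\<close>
  have m\<theta>: "poly m \<theta> \<notin> max_ideal"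
  proof
    assume mv: "poly m \<theta> \<in> max_ideal"
    have "poly (pderiv m) \<theta> \<in> int_ring" "poly (pderiv h) \<theta> \<in> int_ring"
      by (intro poly_int_ring RI coeffs_in_pderiv[OF R] m h \<theta>')+
    moreover have "poly (pderiv r) \<theta> \<in> max_ideal"
      by (intro poly_max_ideal \<theta>') (auto simp: coeff_pderiv intro!: max_ideal_mult m(4) int_ring_of_nat simp flip: of_nat_Suc)
    ultimately have "poly (pderiv g) \<theta> \<in> max_ideal"
      unfolding m(3) pderiv_add pderiv_mult poly_add poly_mult
      using mv h(3) max_ideal_mult[of "poly (pderiv m) \<theta>" "poly h \<theta>"]
        max_ideal_mult[of "poly (pderiv h) \<theta>" "poly m \<theta>"]
      by (auto simp: mult.commute intro!: max_ideal_add)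
    then show False using g(5) by (simp add: max_ideal_def)
  qed
  have key: "\<exists>b\<in>F. b \<noteq> 0 \<and> Q (poly s \<theta>) = Q b" if "coeffs_in R s" "poly s \<theta> \<noteq> 0" for s
    using that
  proof (induction "nat (Q (poly s \<theta>))" arbitrary: s rule: less_induct)
    case less
    have si: "poly s \<theta> \<in> int_ring" by (intro poly_int_ring RI less.prems \<theta>')
    show ?case
    proof (cases "poly s \<theta> \<in> max_ideal")
      case False
      then have "Q (poly s \<theta>) = Q 1" using int_ring_unit[OF si] by simp
      then show ?thesis using subfield_1[OF F(1)] by (intro bexI[of _ 1]) auto
    next
      case True
      obtain q r2 where qr: "coeffs_in R q" "coeffs_in R r2" "s = q * h + r2" "\<And>i. coeff r2 i \<in> max_ideal"
        using red[OF less.prems(1) True] by metis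
      \<comment> \<open>From g(theta) = 0 follows m(theta) h(theta) = -r(theta). So the unit
        m(theta) turns s = q h + r2 into a value of a polynomial all of whose coefficients vanish at
        the place.\<close>
      define t where "t = m * r2 - q * r"
      have ts: "poly t \<theta> = poly m \<theta> * poly s \<theta>"
      proof -
        have "poly m \<theta> * poly h \<theta> = - poly r \<theta>" using g(4) m(3) by (simp add: eq_neg_iff_add_eq_0)
        then have "poly q \<theta> * (poly m \<theta> * poly h \<theta>) = - (poly q \<theta> * poly r \<theta>)" by simp
        then show ?thesis unfolding t_def qr(3) by (simp add: algebra_simps)
      qed
      have tF: "coeffs_in F t" unfolding t_def
        using coeffs_in_diff[OF R coeffs_in_mult[OF R m(1) qr(2)] coeffs_in_mult[OF R qr(1) m(2)]]
        by (auto simp: R_def coeffs_in_def)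
      have tm: "coeff t i \<in> max_ideal" for i
        unfolding t_def coeff_diff
        by (intro max_ideal_diff coeffs_max_ideal_mult RI m qr)
      have m0: "poly m \<theta> \<in> int_ring" by (intro poly_int_ring RI m \<theta>')
      have t0: "poly t \<theta> \<noteq> 0" using ts less.prems(2) m\<theta> max_ideal_0 by auto
      then have "t \<noteq> 0" by auto
      then obtain b t' where bt: "b \<in> F" "b \<noteq> 0" "t = smult b t'" "coeffs_in F t'" "coeffs_in int_ring t'"
          "\<exists>i. coeff t' i \<notin> max_ideal"
        using primitive_part[OF F tF] by metis
      obtain i where i: "coeff t' i \<notin> max_ideal" using bt(6) by blast
      \<comment> \<open>As b times a unit coefficient of \<open>t'\<close> is a coefficient of
        \<open>t\<close>, the content has positive value and the value of \<open>t'\<close> is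
        strictly smaller.\<close>
      have b: "b \<in> max_ideal"
      proof -
        have ti: "coeff t' i \<in> int_ring" using bt(5) by (auto simp: coeffs_in_def)
        have "inverse (coeff t' i) * coeff t i \<in> max_ideal"
          using int_ring_unit[OF ti i] tm by (intro max_ideal_mult) auto
        moreover have "inverse (coeff t' i) * coeff t i = b"
          using int_ring_unit[OF ti i] by (simp add: bt(3))
        ultimately show ?thesis by simp
      qed
      have t'R: "coeffs_in R t'" using bt(4,5) by (auto simp: R_def coeffs_in_def)
      have t'0: "poly t' \<theta> \<noteq> 0" using t0 bt(3) by auto
      have t'i: "poly t' \<theta> \<in> int_ring" by (intro poly_int_ring bt \<theta>')
      have "Q (poly m \<theta> * poly s \<theta>) = Q (poly s \<theta>)"
        using int_ring_unit[OF m0 m\<theta>] less.prems(2) m0 si int_ring_subset by (subst P_mult) auto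
      moreover have "Q (poly t \<theta>) = Q b + Q (poly t' \<theta>)"
      proof -
        have "b \<in> L" "poly t' \<theta> \<in> L" using bt(1) F(2) t'i int_ring_subset by auto
        then show ?thesis using P_mult[of b "poly t' \<theta>"] bt(2) t'0 by (simp add: bt(3))
      qed
      ultimately have Qs: "Q (poly s \<theta>) = Q b + Q (poly t' \<theta>)" using ts by simp
      moreover have "0 < Q b" using b bt(2) by (simp add: max_ideal_def vanishes_def)
      moreover have "0 \<le> Q (poly t' \<theta>)" using t'i by (simp add: int_ring_def)
      ultimately have "nat (Q (poly t' \<theta>)) < nat (Q (poly s \<theta>))" by simp
      then obtain b' where "b' \<in> F" "b' \<noteq> 0" "Q (poly t' \<theta>) = Q b'"
        using less.hyps[OF _ t'R t'0] by blast
      then show ?thesis using Qs bt(1,2) F(2) subfield_mult[OF F(1)]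
          P_mult[of b b'] subsetD[OF F(2), of b] subsetD[OF F(2), of b']
        by (intro bexI[of _ "b * b'"]) auto
    qed
  qed
  \<comment> \<open>An element of value 1 in L; by \<open>key\<close> and the content its value is
    also taken by an element of F.\<close>
  obtain x where x: "x \<in> L" "Q x = 1" using P_attains_1 by blast
  then obtain f where f: "coeffs_in F f" "x = poly f \<theta>" using \<theta>(3) unfolding adjoin_def[OF F(1)] by blast
  have "f \<noteq> 0" using x(2) f(2) by auto
  then obtain b f' where bf: "b \<in> F" "b \<noteq> 0" "f = smult b f'" "coeffs_in F f'" "coeffs_in int_ring f'"
    using primitive_part[OF F f(1)] by metis
  have f'R: "coeffs_in R f'" using bf(4,5) by (auto simp: R_def coeffs_in_def)
  have f'0: "poly f' \<theta> \<noteq> 0" using x(2) f(2) bf(3) by auto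
  obtain b' where b': "b' \<in> F" "b' \<noteq> 0" "Q (poly f' \<theta>) = Q b'" using key[OF f'R f'0] by blast
  have "poly f' \<theta> \<in> L" using poly_int_ring[OF bf(5) \<theta>'] int_ring_subset by auto
  then have "Q x = Q b + Q b'" using bf f'0 F(2) b' P_mult[of b "poly f' \<theta>"] subsetD[OF F(2), of b]
    by (auto simp: f(2))
  then have "Q (b * b') = 1" using bf b' F(2) x(2) P_mult[of b b'] subsetD[OF F(2), of b] subsetD[OF F(2), of b']
    by auto
  then show ?thesis using subfield_mult[OF F(1) bf(1) b'(1)] by blast
qed

section \<open>Finiteness of zeros\<close>

text \<open>One inclusion of valuation rings suffices: units stay units, so P' is P' t times P for a
  uniformizer t of P. Normalization then gives P' t = 1.\<close>

lemma place_eqI: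
  assumes "place K P" "place K P'" and le: "\<And>x. x \<in> K \<Longrightarrow> 0 \<le> P x \<Longrightarrow> 0 \<le> P' x"
  shows "P = P'"
proof -
  interpret P: place K P by fact
  interpret P': place K P' by fact
  have zero: "P' x = 0" if "x \<in> K" "x \<noteq> 0" "P x = 0" for x
    using le[of x] le[of "inverse x"] that P.P_inverse[of x] P'.P_inverse[of x]
      subfield_inverse[OF P.K, of x] by auto
  obtain t where t: "t \<in> K" "P t = 1" using P.P_attains_1 by blast
  then have t0: "t \<noteq> 0" by auto
  have scale: "P' x = P x * P' t" if x: "x \<in> K" "x \<noteq> 0" for x
  proof (cases "0 \<le> P x")
    case True
    define n where "n = nat (P x)"
    have tn: "t ^ n \<in> K" "t ^ n \<noteq> 0" using t t0 subfield_power[OF P.K] by auto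
    have "P (x / t ^ n) = 0" using P.P_divide[OF x(1) tn(1) x(2) tn(2)] P.P_power[OF t(1) t0] t True
      by (simp add: n_def)
    then have "P' (x / t ^ n) = 0" using zero x tn subfield_divide[OF P.K] by simp
    then show ?thesis using P'.P_divide[OF x(1) tn(1) x(2) tn(2)] P'.P_power[OF t(1) t0] True
      by (simp add: n_def)
  next
    case False
    define n where "n = nat (- P x)"
    have tn: "t ^ n \<in> K" "t ^ n \<noteq> 0" using t t0 subfield_power[OF P.K] by auto
    have "P (x * t ^ n) = 0" using P.P_mult[OF x(1) tn(1) x(2) tn(2)] P.P_power[OF t(1) t0] t False
      by (simp add: n_def)
    then have "P' (x * t ^ n) = 0" using zero x tn subfield_mult[OF P.K] by simp
    then show ?thesis using P'.P_mult[OF x(1) tn(1) x(2) tn(2)] P'.P_power[OF t(1) t0] False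
      by (simp add: n_def)
  qed
  obtain s where s: "s \<in> K" "P' s = 1" using P'.P_attains_1 by blast
  then have "s \<noteq> 0" using P'.P_0 by (metis zero_neq_one)
  then have "P s * P' t = 1" using scale[of s] s by simp
  moreover have "0 \<le> P' t" using le[of t] t by simp
  ultimately have "P' t = 1" by (metis zmult_eq_1_iff zero_le_one abs_1 abs_of_nonneg not_one_le_zero neg_0_le_iff_le)
  then show ?thesis
  proof (intro ext)
    fix x
    show "P x = P' x"
      using scale[of x] P.P_outside[of x] P'.P_outside[of x] \<open>P' t = 1\<close>
      by (cases "x \<in> K"; cases "x = 0") auto
  qed
qed

context place
begin

lemma P_add_eq: "x \<in> K \<Longrightarrow> y \<in> K \<Longrightarrow> P x < 0 \<Longrightarrow> 0 \<le> P y \<Longrightarrow> P (x + y) < 0"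
  using int_ring_add[of "x + y" "- y"] subfield_add[OF K, of x y] subfield_uminus[OF K, of y]
  by (force simp: int_ring_def)

lemma translates_one_zero:
  assumes "a \<in> K" "vanishes P (a + cst c)" "vanishes P (a + cst c')"
  shows "c = c'"
proof (rule ccontr)
  assume "c \<noteq> c'"
  have "a + cst c \<in> max_ideal" "a + cst c' \<in> max_ideal"
    using assms cst_in subfield_add[OF K] by (auto simp: max_ideal_def)
  then have "(a + cst c) - (a + cst c') \<in> max_ideal" by (rule max_ideal_diff)
  then have "cst (c - c') \<in> max_ideal" by (simp add: cst.hom_minus)
  then show False using cst_not_max_ideal[of "c - c'"] \<open>c \<noteq> c'\<close> by simp
qed

lemma translate_nonpos:
  assumes "a \<in> K" "\<not> vanishes P (a + cst c)"
  shows "P (a + cst c) \<le> 0"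
  using assms by (auto simp: vanishes_def)

lemma translate_zero:
  assumes "a \<in> K" "0 \<le> P a" "\<not> vanishes P (a + cst c)"
  shows "P (a + cst c) = 0"
  using assms int_ring_add[of a "cst c"] int_ring_cst[of c] by (auto simp: int_ring_def vanishes_def)

end

text \<open>One of the translates of \<open>a\<close> by \<open>0, 1, -1\<close> is a nonzero residue at both \<open>P\<close> and \<open>R\<close>.\<close>

lemma separating_element:
  fixes K :: "'k::field geo set"
  assumes P: "place K P" and P': "place K P'" and R: "place K R" and ne: "P \<noteq> P'"
    and two: "(2::'k) \<noteq> 0"
  shows "\<exists>e\<in>K. e \<noteq> 0 \<and> P e = 0 \<and> 0 < P' e \<and> 0 \<le> R e"
proof -
  interpret P: place K P by fact
  interpret P': place K P' by fact
  interpret R: place K R by fact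
  obtain a where a: "a \<in> K" "0 \<le> P a" "P' a < 0"
    using place_eqI[OF P P'] ne by (metis not_le)
  have d: "(0::'k) \<noteq> 1" "(1::'k) \<noteq> - 1" "(0::'k) \<noteq> - 1"
    using two by (auto simp: eq_neg_iff_add_eq_0)
  have "\<exists>c. \<not> vanishes P (a + cst c) \<and> \<not> vanishes R (a + cst c)"
    using P.translates_one_zero[OF a(1)] R.translates_one_zero[OF a(1)] d by metis
  then obtain c where c: "\<not> vanishes P (a + cst c)" "\<not> vanishes R (a + cst c)" by blast
  have aK: "a + cst c \<in> K" using a P.cst_in subfield_add[OF P.K] by blast
  have a0: "a + cst c \<noteq> 0" using c by (auto simp: vanishes_def)
  have "P' (a + cst c) < 0" using P'.P_add_eq[OF a(1) P'.cst_in a(3)] by simp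
  then show ?thesis
    using P.translate_zero[OF a(1,2) c(1)] R.translate_nonpos[OF a(1) c(2)] aK a0
      P.P_inverse[OF aK] P'.P_inverse[OF aK] R.P_inverse[OF aK] subfield_inverse[OF P.K aK]
    by (intro bexI[of _ "inverse (a + cst c)"]) auto
qed

text \<open>The places agree on F, so dividing by a coefficient of least value makes all quotients
  integral at each of them. At the place belonging to that coefficient only one term survives, and
  it is a unit.\<close>

lemma independent_of_separated:
  fixes K :: "'k::field geo set" and Pl :: "nat \<Rightarrow> 'k geo \<Rightarrow> int"
  assumes pl: "\<And>i. i \<in> I \<Longrightarrow> place K (Pl i)" and fin: "finite I"
    and F: "is_subfield F" "F \<subseteq> K"
    and comp: "\<And>i j x. i \<in> I \<Longrightarrow> j \<in> I \<Longrightarrow> x \<in> F \<Longrightarrow> 0 \<le> Pl i x \<Longrightarrow> 0 \<le> Pl j x"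
    and z: "\<And>i. i \<in> I \<Longrightarrow> z i \<in> K \<and> z i \<noteq> 0 \<and> Pl i (z i) = 0"
    and z': "\<And>i j. i \<in> I \<Longrightarrow> j \<in> I \<Longrightarrow> i \<noteq> j \<Longrightarrow> 0 < Pl j (z i)"
    and f: "\<And>i. i \<in> I \<Longrightarrow> f i \<in> F" and sum0: "(\<Sum>i\<in>I. f i * z i) = 0" and k: "k \<in> I"
  shows "f k = 0"
proof (rule ccontr)
  assume fk: "f k \<noteq> 0"
  define S where "S = {i\<in>I. f i \<noteq> 0}"
  have "finite S" "S \<noteq> {}" using fin fk k by (auto simp: S_def)
  then obtain j where j: "j \<in> S" "\<And>i. i \<in> S \<Longrightarrow> Pl k (f j) \<le> Pl k (f i)"
    using ex_min_if_finite[of "(\<lambda>i. Pl k (f i)) ` S"] by (auto simp: not_less)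
  interpret k: place K "Pl k" using pl k by blast
  have jI: "j \<in> I" "f j \<noteq> 0" using j by (auto simp: S_def)
  interpret j: place K "Pl j" using pl jI by blast
  have fK: "f i \<in> K" if "i \<in> I" for i using f F that by blast
  have int: "f i / f j \<in> j.int_ring" if i: "i \<in> I" for i
  proof (cases "f i = 0")
    case True
    then show ?thesis using subfield_0[OF k.K] by (simp add: j.int_ring_def)
  next
    case False
    then have "0 \<le> Pl k (f i / f j)"
      using j(2)[of i] i jI k.P_divide[OF fK[OF i] fK[OF jI(1)]] by (simp add: S_def)
    moreover have "f i / f j \<in> F" using f i jI subfield_divide[OF F(1)] by blast
    ultimately show ?thesis using comp[OF k jI(1)] F(2) by (auto simp: j.int_ring_def)
  qed
  have "(\<Sum>i\<in>I. f i / f j * z i) = (\<Sum>i\<in>I. f i * z i) / f j"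
    by (simp add: sum_divide_distrib)
  then have "(\<Sum>i\<in>I. f i / f j * z i) = 0" using sum0 by simp
  moreover have "(\<Sum>i\<in>I. f i / f j * z i) = z j + (\<Sum>i\<in>I - {j}. f i / f j * z i)"
    using fin jI by (subst sum.remove[of I j]) auto
  ultimately have "z j = - (\<Sum>i\<in>I - {j}. f i / f j * z i)" by (simp add: eq_neg_iff_add_eq_0)
  also have "\<dots> \<in> j.max_ideal"
    using int z z' jI
    by (intro j.max_ideal_uminus j.max_ideal_sum j.max_ideal_mult) (auto simp: j.max_ideal_def vanishes_def)
  finally show False using z[OF jI(1)] by (simp add: j.max_ideal_def vanishes_def)
qed

text \<open>Three distinct places over one point would give three elements independent over F in the
  space spanned by 1 and y.\<close>

lemma at_most_two_places_above:
  fixes K :: "'k::field geo set" and Pl :: "nat \<Rightarrow> 'k geo \<Rightarrow> int"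
  assumes pl: "\<And>i. i < 3 \<Longrightarrow> place K (Pl i)"
    and two: "(2::'k) \<noteq> 0"
    and F: "is_subfield F" "F \<subseteq> K" and gen: "\<And>x. x \<in> K \<Longrightarrow> \<exists>r\<in>F. \<exists>s\<in>F. x = r + s * y"
    and comp: "\<And>i j x. i < 3 \<Longrightarrow> j < 3 \<Longrightarrow> x \<in> F \<Longrightarrow> 0 \<le> Pl i x \<Longrightarrow> 0 \<le> Pl j x"
  shows "\<exists>i<3. \<exists>j<3. i \<noteq> j \<and> Pl i = Pl j"
proof (rule ccontr)
  assume "\<not> ?thesis"
  then have ne: "Pl i \<noteq> Pl j" if "i < 3" "j < 3" "i \<noteq> j" for i j using that by blast
  have "\<exists>e\<in>K. e \<noteq> 0 \<and> Pl i e = 0 \<and> 0 < Pl j e \<and> 0 \<le> Pl l e" if "i < 3" "j < 3" "l < 3" "i \<noteq> j" for i j l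
    using separating_element[OF pl pl pl ne two] that by blast
  then obtain e where e: "\<And>i j l. i < 3 \<Longrightarrow> j < 3 \<Longrightarrow> l < 3 \<Longrightarrow> i \<noteq> j \<Longrightarrow>
      e i j l \<in> K \<and> e i j l \<noteq> 0 \<and> Pl i (e i j l) = 0 \<and> 0 < Pl j (e i j l) \<and> 0 \<le> Pl l (e i j l)"
    by metis
  have zex: "\<exists>z. z \<in> K \<and> z \<noteq> 0 \<and> Pl i z = 0 \<and> 0 < Pl j z \<and> 0 < Pl l z"
    if ijl: "i < 3" "j < 3" "l < 3" "i \<noteq> j" "i \<noteq> l" for i j l
  proof -
    interpret i: place K "Pl i" using pl ijl by blast
    interpret j: place K "Pl j" using pl ijl by blast
    interpret l: place K "Pl l" using pl ijl by blast
    show ?thesis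
      using e[of i j l] e[of i l j] ijl subfield_mult[OF i.K]
      by (intro exI[of _ "e i j l * e i l j"]) (auto simp: i.P_mult j.P_mult l.P_mult)
  qed
  have I: "{..<3::nat} = {0, 1, 2}" by auto
  have "\<exists>z. z \<in> K \<and> z \<noteq> 0 \<and> Pl i z = 0 \<and> (\<forall>j<3. j \<noteq> i \<longrightarrow> 0 < Pl j z)" if i: "i < 3" for i
  proof -
    obtain j l where jl: "j < 3" "l < 3" "i \<noteq> j" "i \<noteq> l" "\<And>k. k < 3 \<Longrightarrow> k = i \<or> k = j \<or> k = l"
    proof -
      consider "i = 0" | "i = 1" | "i = 2" using i by linarith
      then show thesis
      proof cases
        case 1
        then show thesis by (intro that[of 1 2]) auto
      next
        case 2
        then show thesis by (intro that[of 0 2]) auto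
      next
        case 3
        then show thesis by (intro that[of 0 1]) auto
      qed
    qed
    then show ?thesis using zex[OF i jl(1,2,3,4)] jl(5) by metis
  qed
  then obtain z where z: "\<And>i. i < 3 \<Longrightarrow> z i \<in> K \<and> z i \<noteq> 0 \<and> Pl i (z i) = 0 \<and> (\<forall>j<3. j \<noteq> i \<longrightarrow> 0 < Pl j (z i))"
    by metis
  have "\<exists>r s. r \<in> F \<and> s \<in> F \<and> z i = r + s * y" if "i < 3" for i using gen z that by blast
  then obtain r s where rs: "\<And>i. i < 3 \<Longrightarrow> r i \<in> F \<and> s i \<in> F \<and> z i = r i + s i * y" by metis
  have dep: "f 0 = 0 \<and> f 1 = 0 \<and> f 2 = 0" if f: "\<And>i. i < 3 \<Longrightarrow> f i \<in> F" and f0: "f 0 * z 0 + f 1 * z 1 + f 2 * z 2 = 0"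
    for f :: "nat \<Rightarrow> 'k geo"
  proof -
    have "f k = 0" if "k < 3" for k
    proof (rule independent_of_separated[where I = "{..<3}" and K = K and Pl = Pl and F = F and z = z])
      show "place K (Pl i)" if "i \<in> {..<3}" for i using pl that by simp
      show "0 \<le> Pl j x" if "i \<in> {..<3}" "j \<in> {..<3}" "x \<in> F" "0 \<le> Pl i x" for i j x
        using comp[of i j x] that by simp
      show "z i \<in> K \<and> z i \<noteq> 0 \<and> Pl i (z i) = 0" if "i \<in> {..<3}" for i using z[of i] that by simp
      show "0 < Pl j (z i)" if "i \<in> {..<3}" "j \<in> {..<3}" "i \<noteq> j" for i j using z[of i] that by simp
      show "f i \<in> F" if "i \<in> {..<3}" for i using f that by simp
      show "(\<Sum>i<3. f i * z i) = 0" using f0 by (simp add: I add.assoc)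
      show "k \<in> {..<3}" using that by simp
    qed (use F in simp_all)
    then show ?thesis by simp
  qed
  have cl: "a * b \<in> F" "a - b \<in> F" "- a \<in> F" if "a \<in> F" "b \<in> F" for a b
    using that subfield_mult[OF F(1)] subfield_diff[OF F(1)] subfield_uminus[OF F(1)] by auto
  have rsF: "r 0 \<in> F" "r 1 \<in> F" "r 2 \<in> F" "s 0 \<in> F" "s 1 \<in> F" "s 2 \<in> F" "0 \<in> F"
    using rs[of 0] rs[of 1] rs[of 2] subfield_0[OF F(1)] by auto
  have zz: "z 0 = r 0 + s 0 * y" "z 1 = r 1 + s 1 * y" "z 2 = r 2 + s 2 * y"
    using rs[of 0] rs[of 1] rs[of 2] by auto
  \<comment> \<open>The 2 by 2 minors of the coefficient matrix form a linear relation between the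
    three \<open>z i\<close>.\<close>
  define f where "f i = (if i = 0 then r 1 * s 2 - r 2 * s 1 else if i = 1 then r 2 * s 0 - r 0 * s 2 else r 0 * s 1 - r 1 * s 0)" for i :: nat
  have "f 0 = 0 \<and> f 1 = 0 \<and> f 2 = 0"
  proof (rule dep)
    show "f i \<in> F" for i using rsF cl by (simp add: f_def)
    show "f 0 * z 0 + f 1 * z 1 + f 2 * z 2 = 0"
      unfolding zz by (simp add: f_def algebra_simps)
  qed
  then have par: "r 0 * s 1 = r 1 * s 0" by (simp add: f_def)
  \<comment> \<open>Once the minors vanish, the two columns of coefficients give relations between
    \<open>z 0\<close> and \<open>z 1\<close> alone.\<close>
  define g where "g i = (if i = 0 then r 1 else if i = 1 then - r 0 else 0)" for i :: nat
  define h where "h i = (if i = 0 then s 1 else if i = 1 then - s 0 else 0)" for i :: nat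
  have "g 0 = 0 \<and> g 1 = 0 \<and> g 2 = 0"
  proof (rule dep)
    show "g i \<in> F" for i using rsF cl by (simp add: g_def)
    show "g 0 * z 0 + g 1 * z 1 + g 2 * z 2 = 0"
      using par unfolding zz by (simp add: g_def algebra_simps)
  qed
  moreover have "h 0 = 0 \<and> h 1 = 0 \<and> h 2 = 0"
  proof (rule dep)
    show "h i \<in> F" for i using rsF cl by (simp add: h_def)
    show "h 0 * z 0 + h 1 * z 1 + h 2 * z 2 = 0"
      using par unfolding zz by (simp add: h_def algebra_simps)
  qed
  ultimately have "z 0 = 0" unfolding zz by (simp add: g_def h_def)
  then show False using z[of 0] by simp
qed

section \<open>The point of the line below a place\<close>

context place
begin

text \<open>The prime ideal of k[X] that defines the point below the place in the affine chart with
  coordinate s.\<close>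

definition zero_ideal :: "'k geo \<Rightarrow> 'k poly set"
  where "zero_ideal s = {f. vanishes P (poly (cpoly f) s)}"

context
  fixes s assumes s: "s \<in> int_ring"
begin

lemma zero_ideal_iff: "f \<in> zero_ideal s \<longleftrightarrow> poly (cpoly f) s \<in> max_ideal"
  using max_ideal_iff[OF poly_int_ring[OF cpoly_int_ring s]] by (simp add: zero_ideal_def)

lemma zero_ideal_diff: "f \<in> zero_ideal s \<Longrightarrow> g \<in> zero_ideal s \<Longrightarrow> f - g \<in> zero_ideal s"
  and zero_ideal_mult: "g \<in> zero_ideal s \<Longrightarrow> f * g \<in> zero_ideal s"
  unfolding zero_ideal_iff
  by (auto intro: max_ideal_diff max_ideal_mult poly_int_ring[OF cpoly_int_ring s])

lemma zero_ideal_prime: "f * g \<in> zero_ideal s \<Longrightarrow> f \<in> zero_ideal s \<or> g \<in> zero_ideal s"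
  unfolding zero_ideal_iff using max_ideal_prime poly_int_ring[OF cpoly_int_ring s] by simp

lemma zero_ideal_const: "[:c:] \<in> zero_ideal s \<longleftrightarrow> c = 0"
  unfolding zero_ideal_iff using cst_not_max_ideal[of c] max_ideal_0 by auto

lemma zero_ideal_principal:
  assumes "f \<in> zero_ideal s" "f \<noteq> 0"
  obtains p where "p \<in> zero_ideal s" "p \<noteq> 0" "degree p > 0" "\<And>g. g \<in> zero_ideal s \<Longrightarrow> p dvd g"
proof -
  define Q where "Q n \<longleftrightarrow> (\<exists>p\<in>zero_ideal s. p \<noteq> 0 \<and> degree p = n)" for n
  have "Q (degree f)" using assms unfolding Q_def by blast
  then have "Q (LEAST n. Q n)" by (rule LeastI)
  then obtain p where p: "p \<in> zero_ideal s" "p \<noteq> 0" "degree p = (LEAST n. Q n)" unfolding Q_def by blast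
  have d: "degree p > 0"
  proof (rule ccontr)
    assume "\<not> degree p > 0"
    then obtain c where "p = [:c:]" by (metis degree_0_id gr0I)
    then show False using p(1,2) zero_ideal_const by auto
  qed
  have "p dvd g" if g: "g \<in> zero_ideal s" for g
  proof (rule ccontr)
    assume n: "\<not> p dvd g"
    have "g mod p = g - (g div p) * p" by (simp add: minus_div_mult_eq_mod)
    then have "g mod p \<in> zero_ideal s" using zero_ideal_diff[OF g zero_ideal_mult[OF p(1)]] by simp
    moreover have "g mod p \<noteq> 0" using n by (simp add: dvd_eq_mod_eq_0)
    ultimately have "Q (degree (g mod p))" unfolding Q_def by blast
    moreover have "degree (g mod p) < degree p"
      using degree_mod_less[OF p(2), of g] \<open>g mod p \<noteq> 0\<close> by simp
    ultimately show False using not_less_Least p(3) by metis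
  qed
  then show ?thesis using that p d by blast
qed

text \<open>Replaces the residue of s by an element of the algebraic closure with the same vanishing
  polynomials over k: s itself if they all vanish at s, otherwise a root of the generator of the
  ideal.\<close>

lemma specialization: "\<exists>c. \<forall>f. f \<in> zero_ideal s \<longleftrightarrow> poly (cpoly f) c = 0"
proof (cases "\<forall>f\<in>zero_ideal s. poly (cpoly f) s = 0")
  case True
  then show ?thesis by (intro exI[of _ s]) (auto simp: zero_ideal_iff max_ideal_0)
next
  case False
  then obtain f where f: "f \<in> zero_ideal s" "f \<noteq> 0" by (metis cpoly_hom(1) poly_0)
  obtain p where p: "p \<in> zero_ideal s" "p \<noteq> 0" "degree p > 0" "\<And>g. g \<in> zero_ideal s \<Longrightarrow> p dvd g"
    using zero_ideal_principal[OF f] by metis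
  obtain c where c: "poly (cpoly p) c = 0"
    using alg_closed_imp_poly_has_root[of "cpoly p"] p(3) by auto
  have 1: "poly (cpoly g) c = 0" if "g \<in> zero_ideal s" for g
    using p(4)[OF that] c by (auto elim!: dvdE)
  have 2: "g \<in> zero_ideal s" if g: "poly (cpoly g) c = 0" for g
  proof -
    define q where "q = (if g = 0 then p else g)"
    have nz: "q \<noteq> 0" "poly (cpoly q) c = 0" using g c p(2) by (auto simp: q_def)
    define Q where "Q n \<longleftrightarrow> (\<exists>q. q \<noteq> 0 \<and> poly (cpoly q) c = 0 \<and> degree q = n)" for n
    have "Q (degree q)" using nz unfolding Q_def by blast
    then have "Q (LEAST n. Q n)" by (rule LeastI)
    then obtain m where m: "m \<noteq> 0" "poly (cpoly m) c = 0" "degree m = (LEAST n. Q n)" unfolding Q_def by blast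
    have dvd: "m dvd h" if h: "poly (cpoly h) c = 0" for h
    proof (rule ccontr)
      assume n: "\<not> m dvd h"
      have "h mod m = h - (h div m) * m" by (simp add: minus_div_mult_eq_mod)
      then have "poly (cpoly (h mod m)) c = 0" using h m(2) by simp
      moreover have "h mod m \<noteq> 0" using n by (simp add: dvd_eq_mod_eq_0)
      ultimately have "Q (degree (h mod m))" unfolding Q_def by blast
      moreover have "degree (h mod m) < degree m"
        using degree_mod_less[OF m(1), of h] \<open>h mod m \<noteq> 0\<close> by simp
      ultimately show False using not_less_Least m(3) by metis
    qed
    obtain r where r: "p = m * r" using dvd[OF c] by (rule dvdE)
    \<comment> \<open>Here m is a minimal polynomial of c and p = m r lies in a prime ideal. If r
      belonged to it, p would divide r, against the degrees.\<close>
    have "m \<in> zero_ideal s"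
    proof (rule ccontr)
      assume "m \<notin> zero_ideal s"
      then have "r \<in> zero_ideal s" using zero_ideal_prime p(1) unfolding r by blast
      then have "p dvd r" by (rule p(4))
      then have "degree p \<le> degree r" using r p(2) by (intro dvd_imp_degree_le) auto
      moreover have "r \<noteq> 0" using r p(2) by auto
      then have "degree p = degree m + degree r" using r m(1) by (simp add: degree_mult_eq)
      ultimately have "degree m = 0" by simp
      then obtain b where "m = [:b:]" by (metis degree_0_id)
      then show False using m(1,2) by auto
    qed
    then show ?thesis using dvd[OF g] zero_ideal_mult by (auto elim!: dvdE simp: mult.commute)
  qed
  show ?thesis using 1 2 by blast
qed

text \<open>If the denominator vanishes at the place, so does the numerator, and the generator of
  the ideal cancels. Hence the zero ideal determines the induced ring on k(s).\<close>

lemma int_ring_fraction: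
  assumes "x = poly (cpoly f) s / poly (cpoly g) s" "poly (cpoly g) s \<noteq> 0" "0 \<le> P x"
  shows "\<exists>f' g'. x = poly (cpoly f') s / poly (cpoly g') s \<and> g' \<notin> zero_ideal s"
  using assms
proof (induction "degree g" arbitrary: f g rule: less_induct)
  case less
  show ?case
  proof (cases "g \<in> zero_ideal s")
    case False
    then show ?thesis using less.prems by blast
  next
    case True
    have fs: "poly (cpoly f) s = x * poly (cpoly g) s" using less.prems by simp
    have "x \<in> K" unfolding less.prems(1) using poly_int_ring[OF cpoly_int_ring s] int_ring_subset
        subfield_divide[OF K] by blast
    then have "x \<in> int_ring" using less.prems(3) by (simp add: int_ring_def)
    then have f: "f \<in> zero_ideal s" using True max_ideal_mult unfolding zero_ideal_iff fs by blast
    have "g \<noteq> 0" using less.prems(2) by auto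
    obtain p where p: "p \<noteq> 0" "degree p > 0" "\<And>g. g \<in> zero_ideal s \<Longrightarrow> p dvd g"
      using zero_ideal_principal[OF True \<open>g \<noteq> 0\<close>] by metis
    obtain f' g' where fg: "f = p * f'" "g = p * g'" using p(3)[OF f] p(3)[OF True] by (auto elim!: dvdE)
    have "g' \<noteq> 0" using fg \<open>g \<noteq> 0\<close> by auto
    then have "degree g' < degree g" using p fg by (simp add: degree_mult_eq)
    moreover have "x = poly (cpoly f') s / poly (cpoly g') s" "poly (cpoly g') s \<noteq> 0"
      using less.prems(1,2) fg by auto
    ultimately show ?thesis using less.hyps less.prems(3) by blast
  qed
qed

end

end

lemma same_zero_ideal:
  assumes P: "place K P" and P': "place K P'" and s: "s \<in> K" "0 \<le> P s" "0 \<le> P' s"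
    and eq: "place.zero_ideal P s = place.zero_ideal P' s"
    and x: "x = poly (cpoly f) s / poly (cpoly g) s" "poly (cpoly g) s \<noteq> 0" "0 \<le> P x"
  shows "0 \<le> P' x"
proof -
  interpret P: place K P by fact
  interpret P': place K P' by fact
  have s1: "s \<in> P.int_ring" "s \<in> P'.int_ring" using s by (auto simp: P.int_ring_def P'.int_ring_def)
  obtain f' g' where fg: "x = poly (cpoly f') s / poly (cpoly g') s" "g' \<notin> P.zero_ideal s"
    using P.int_ring_fraction[OF s1(1) x] by blast
  then have "poly (cpoly g') s \<notin> P'.max_ideal" using eq P'.zero_ideal_iff[OF s1(2)] by simp
  then have "x \<in> P'.int_ring"
    unfolding fg(1) by (intro P'.int_ring_divide_unit P'.poly_int_ring P'.cpoly_int_ring s1)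
  then show ?thesis by (simp add: P'.int_ring_def)
qed

text \<open>\<open>specialization\<close> sends each place to a root of h. Places with the same
  image induce the same ring on F, so each fibre has at most two elements.\<close>

lemma finite_places_over_zeros:
  fixes K :: "'k::field geo set"
  assumes K: "is_subfield K" "range cst \<subseteq> K" and F: "is_subfield F" "F \<subseteq> K"
    and two: "(2::'k) \<noteq> 0"
    and gen: "\<And>x. x \<in> K \<Longrightarrow> \<exists>r\<in>F. \<exists>s\<in>F. x = r + s * y"
    and s: "s \<in> K"
    and frac: "\<And>x. x \<in> F \<Longrightarrow> \<exists>f g. x = poly (cpoly f) s / poly (cpoly g) s \<and> poly (cpoly g) s \<noteq> 0"
    and h: "h \<noteq> 0"
  shows "finite {P \<in> places K. 0 \<le> P s \<and> vanishes P (poly (cpoly h) s)}" (is "finite ?A")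
proof -
  have pl: "place K P" if "P \<in> places K" for P using K that by unfold_locales auto
  have "\<exists>c. \<forall>f. f \<in> place.zero_ideal P s \<longleftrightarrow> poly (cpoly f) c = 0" if "P \<in> ?A" for P
  proof -
    interpret place K P using pl that by blast
    show ?thesis by (rule specialization) (use s that in \<open>auto simp: int_ring_def\<close>)
  qed
  then have "\<forall>P\<in>?A. \<exists>c. \<forall>f. f \<in> place.zero_ideal P s \<longleftrightarrow> poly (cpoly f) c = 0" by blast
  from bchoice[OF this] obtain c where
    c: "\<And>P f. P \<in> ?A \<Longrightarrow> f \<in> place.zero_ideal P s \<longleftrightarrow> poly (cpoly f) (c P) = 0"
    by blast
  have ch: "c ` ?A \<subseteq> {x. poly (cpoly h) x = 0}"
  proof safe
    fix P assume PA: "P \<in> places K" "0 \<le> P s" "vanishes P (poly (cpoly h) s)"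
    interpret place K P using pl PA by blast
    have "h \<in> zero_ideal s" using PA(3) by (simp add: zero_ideal_def)
    then show "poly (cpoly h) (c P) = 0" using c[of P h] PA by simp
  qed
  have "finite {x. poly (cpoly h) x = 0}" using h by (intro poly_roots_finite) simp
  then have fin: "finite (c ` ?A)" by (rule finite_subset[OF ch])
  have fib: "finite {P\<in>?A. c P = b}" for b
  proof (rule ccontr)
    assume inf: "infinite {P\<in>?A. c P = b}"
    then obtain T where T: "T \<subseteq> {P\<in>?A. c P = b}" "finite T" "card T = 3"
      using infinite_arbitrarily_large[OF inf, of 3] by auto
    obtain Pl :: "nat \<Rightarrow> _" where Pl: "bij_betw Pl {0..<3} T"
      using ex_bij_betw_nat_finite[OF T(2)] T(3) by auto
    have PlT: "Pl i \<in> T" if "i < 3" for i using Pl that unfolding bij_betw_def by auto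
    have "\<exists>i<3. \<exists>j<3. i \<noteq> j \<and> Pl i = Pl j"
    proof (rule at_most_two_places_above[OF _ two F gen])
      show "place K (Pl i)" if "i < 3" for i using pl PlT[OF that] T(1) by blast
      fix i j :: nat and x assume ij: "i < 3" "j < 3" and x: "x \<in> F" "0 \<le> Pl i x"
      obtain f g where fg: "x = poly (cpoly f) s / poly (cpoly g) s" "poly (cpoly g) s \<noteq> 0"
        using frac[OF x(1)] by blast
      have A: "Pl i \<in> ?A" "Pl j \<in> ?A" "c (Pl i) = c (Pl j)" using PlT[OF ij(1)] PlT[OF ij(2)] T(1) by auto
      have "place.zero_ideal (Pl i) s = place.zero_ideal (Pl j) s"
        using c[OF A(1)] c[OF A(2)] A(3) by (intro Set.set_eqI) simp
      moreover have "place K (Pl i)" "place K (Pl j)" "0 \<le> Pl i s" "0 \<le> Pl j s" using pl A by auto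
      ultimately show "0 \<le> Pl j x"
        using same_zero_ideal[of K "Pl i" "Pl j" s x f g] s fg x(2) by blast
    qed
    then obtain i j where ij: "i < 3" "j < 3" "i \<noteq> j" "Pl i = Pl j" by blast
    have "inj_on Pl {0..<3}" using Pl by (rule bij_betw_imp_inj_on)
    then show False using inj_onD[of Pl "{0..<3}" i j] ij by simp
  qed
  have "finite (\<Union>b\<in>c ` ?A. {P\<in>?A. c P = b})" by (rule finite_UN_I[OF fin fib])
  moreover have "?A \<subseteq> (\<Union>b\<in>c ` ?A. {P\<in>?A. c P = b})" by blast
  ultimately show ?thesis by (rule finite_subset[rotated])
qed

section \<open>Existence of places\<close>

text \<open>Such a \<open>V\<close> is a valuation ring of \<open>L\<close>, by the argument of Chevalley's extension theorem.\<close>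

locale maximal_subring =
  fixes L V :: "'a::field set" and x :: 'a
  assumes L: "is_subfield L" and V: "is_subring V" and VL: "V \<subseteq> L" and xV: "x \<in> V" and x0: "x \<noteq> 0"
    and nonunit: "inverse x \<notin> V"
    and maximal: "\<And>R. is_subring R \<Longrightarrow> V \<subseteq> R \<Longrightarrow> R \<subseteq> L \<Longrightarrow> inverse x \<notin> R \<Longrightarrow> R = V"
begin

text \<open>The ideal generated by x plays the part that the maximal ideal plays in the usual
  argument: \<open>1 - c\<close> is a unit for every c in it.\<close>

definition "xV = {x * b | b. b \<in> V}"

lemma xV_closed: "c \<in> xV \<Longrightarrow> d \<in> xV \<Longrightarrow> c + d \<in> xV" "b \<in> V \<Longrightarrow> c \<in> xV \<Longrightarrow> b * c \<in> xV" "0 \<in> xV"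
  "c \<in> xV \<Longrightarrow> c \<in> V" "c \<in> xV \<Longrightarrow> d \<in> xV \<Longrightarrow> c - d \<in> xV"
proof -
  show "c + d \<in> xV" if "c \<in> xV" "d \<in> xV" for c d
    using that subring_add[OF V] unfolding xV_def by (auto simp: distrib_left[symmetric])
  show "c - d \<in> xV" if "c \<in> xV" "d \<in> xV" for c d
    using that subring_diff[OF V] unfolding xV_def by (auto simp: right_diff_distrib[symmetric])
  show "b * c \<in> xV" if "b \<in> V" "c \<in> xV" for b c
    using that subring_mult[OF V] unfolding xV_def by (auto simp: mult.left_commute)
  show "0 \<in> xV" using subring_0[OF V] unfolding xV_def by (auto intro!: exI[of _ 0])
  show "c \<in> V" if "c \<in> xV" for c using that subring_mult[OF V xV] unfolding xV_def by auto
qed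

lemma one_notin_xV: "1 \<notin> xV"
proof
  assume "1 \<in> xV"
  then obtain b where "b \<in> V" "1 = x * b" unfolding xV_def by blast
  then have "inverse x = b" by (metis inverse_unique)
  then show False using nonunit \<open>b \<in> V\<close> by simp
qed

text \<open>By maximality V[w] contains \<open>inverse x\<close>; multiplying such an expression by
  x gives the relation.\<close>

lemma xV_relation:
  assumes w: "w \<in> L" "w \<notin> V"
  shows "\<exists>g. (\<forall>i. coeff g i \<in> xV) \<and> poly g w = 1"
proof -
  define R where "R = {poly f w | f. coeffs_in V f}"
  have sub: "V \<subseteq> R"
  proof
    fix a assume "a \<in> V"
    then have "coeffs_in V [:a:]" by (simp add: coeffs_in_pCons[OF V] coeffs_in_0[OF V])
    moreover have "a = poly [:a:] w" by simp
    ultimately show "a \<in> R" unfolding R_def by blast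
  qed
  have "coeffs_in V [:0, 1:]"
    by (simp add: coeffs_in_pCons[OF V] coeffs_in_0[OF V] subring_0[OF V] subring_1[OF V])
  moreover have "w = poly [:0, 1:] w" by simp
  ultimately have wR: "w \<in> R" unfolding R_def by blast
  have "is_subring R"
    unfolding is_subring_def
  proof (intro conjI ballI)
    show "0 \<in> R" "1 \<in> R" using sub subring_0[OF V] subring_1[OF V] by auto
    fix a assume "a \<in> R"
    then obtain f where f: "coeffs_in V f" "a = poly f w" unfolding R_def by blast
    then have "coeffs_in V (- f)" "- a = poly (- f) w" using coeffs_in_uminus[OF V] by auto
    then show "- a \<in> R" unfolding R_def by blast
    fix b assume "b \<in> R"
    then obtain g where g: "coeffs_in V g" "b = poly g w" unfolding R_def by blast
    have "coeffs_in V (f + g)" "a + b = poly (f + g) w" "coeffs_in V (f * g)" "a * b = poly (f * g) w"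
      using f g coeffs_in_add[OF V] coeffs_in_mult[OF V] by auto
    then show "a + b \<in> R" "a * b \<in> R" unfolding R_def by blast+
  qed
  moreover have "R \<subseteq> L"
    unfolding R_def using poly_in_subring[OF is_subfield_imp_subring[OF L]] coeffs_in_mono[OF _ VL] w(1) by blast
  ultimately have "inverse x \<in> R" using maximal[of R] sub wR w(2) by blast
  then obtain f where f: "coeffs_in V f" "poly f w = inverse x" unfolding R_def by auto
  then have "poly (smult x f) w = 1" "coeff (smult x f) i \<in> xV" for i
    using x0 by (auto simp: xV_def coeffs_in_def)
  then show ?thesis by blast
qed

lemma one_minus_power: "c \<in> xV \<Longrightarrow> 1 - (1 - c) ^ n \<in> xV"
proof (induction n)
  case 0
  then show ?case using xV_closed(3) by simp
next
  case (Suc n)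
  have "1 - (1 - c) ^ Suc n = (1 - c) * (1 - (1 - c) ^ n) + c" by (simp add: algebra_simps)
  moreover have "1 - c \<in> V" using Suc.prems xV_closed(4) subring_diff[OF V subring_1[OF V]] by blast
  ultimately show ?case using Suc xV_closed(1,2) by simp
qed

text \<open>Otherwise the relation for \<open>inverse u\<close>, where u = 1 - c, multiplied by u^n,
  would put u^n in \<open>xV\<close>. But u^n is congruent to 1 there.\<close>

lemma unit_one_minus:
  assumes c: "c \<in> xV"
  shows "1 - c \<noteq> 0" "inverse (1 - c) \<in> V"
proof -
  define u where "u = 1 - c"
  show "1 - c \<noteq> 0" using c one_notin_xV by auto
  then have u0: "u \<noteq> 0" by (simp add: u_def)
  have uV: "u \<in> V" unfolding u_def using c xV_closed(4) subring_diff[OF V subring_1[OF V]] by blast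
  have "inverse u \<in> V"
  proof (rule ccontr)
    assume n: "inverse u \<notin> V"
    have "inverse u \<in> L" using subfield_inverse[OF L] uV VL by blast
    then obtain g where g: "\<And>i. coeff g i \<in> xV" "poly g (inverse u) = 1" using xV_relation n by blast
    define n where "n = degree g"
    have "u ^ n = u ^ n * poly g (inverse u)" using g(2) by simp
    also have "\<dots> = (\<Sum>i\<le>n. coeff g i * (u ^ n * inverse u ^ i))"
      unfolding poly_altdef n_def sum_distrib_left by (simp add: mult_ac)
    also have "\<dots> = (\<Sum>i\<le>n. u ^ (n - i) * coeff g i)"
      using u0 by (intro sum.cong) (auto simp: power_diff divide_inverse power_inverse)
    also have "\<dots> \<in> xV"
    proof -
      have sum_xV: "sum h I \<in> xV" if "\<And>i. i \<in> I \<Longrightarrow> h i \<in> xV" for h :: "nat \<Rightarrow> 'a" and I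
        using that by (induction I rule: infinite_finite_induct) (auto intro: xV_closed)
      show ?thesis by (rule sum_xV) (intro xV_closed(2) subring_power[OF V uV] g(1))
    qed
    finally have "u ^ n \<in> xV" .
    moreover have "1 - u ^ n \<in> xV" using one_minus_power[OF c, of n] by (simp add: u_def)
    ultimately have "u ^ n + (1 - u ^ n) \<in> xV" by (rule xV_closed(1))
    then show False using one_notin_xV by simp
  qed
  then show "inverse (1 - c) \<in> V" by (simp add: u_def)
qed

text \<open>Replaces the leading coefficient of \<open>f\<close> by means of the relation satisfied by \<open>inverse z\<close>.\<close>

lemma reduce_relation:
  assumes z: "z \<noteq> 0"
    and f: "\<And>i. coeff f i \<in> xV" "poly f z = 1"
    and g: "\<And>i. coeff g i \<in> xV" "poly g (inverse z) = 1"
    and d: "degree g \<le> degree f"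
  shows "\<exists>h. (\<forall>i. coeff h i \<in> xV) \<and> poly h z = 1 \<and> degree h < degree f"
proof -
  define n where "n = degree f"
  define m where "m = degree g"
  have n0: "n > 0"
  proof (rule ccontr)
    assume "\<not> n > 0"
    then obtain c where "f = [:c:]" unfolding n_def by (metis degree_0_id gr0I)
    then show False using f(1)[of 0] f(2) one_notin_xV by simp
  qed
  define v where "v = inverse (1 - coeff g 0)"
  have v: "1 - coeff g 0 \<noteq> 0" "v \<in> V" using unit_one_minus[OF g(1)[of 0]] by (auto simp: v_def)
  have "poly g (inverse z) = coeff g 0 + (\<Sum>j=1..m. coeff g j * inverse z ^ j)"
  proof -
    have "{..m} = insert 0 {1..m}" by auto
    then show ?thesis unfolding poly_altdef m_def[symmetric] by simp
  qed
  then have "1 - coeff g 0 = (\<Sum>j=1..m. coeff g j * inverse z ^ j)"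
    unfolding g(2) by (metis add_diff_cancel_left')
  then have "v * (1 - coeff g 0) = v * (\<Sum>j=1..m. coeff g j * inverse z ^ j)" by simp
  then have one: "1 = (\<Sum>j=1..m. v * coeff g j * inverse z ^ j)"
    using v by (simp add: v_def sum_distrib_left mult.assoc)
  define c where "c j = v * coeff g j" for j
  have c: "c j \<in> xV" for j unfolding c_def using xV_closed(2) v(2) g(1) by blast
  \<comment> \<open>Dividing by the unit 1 - g0 expresses 1 through negative powers of z. Multiplied
    by z^n this writes z^n with exponents below n, ready to replace the leading term of f.\<close>
  define t where "t = (\<Sum>j=1..m. monom (c j) (n - j))"
  have tz: "poly t z = z ^ n"
  proof -
    have "z ^ n = z ^ n * (\<Sum>j=1..m. c j * inverse z ^ j)" using one by (simp add: c_def)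
    also have "\<dots> = (\<Sum>j=1..m. c j * z ^ (n - j))"
      unfolding sum_distrib_left using z d
      by (intro sum.cong) (auto simp: n_def m_def power_diff divide_inverse power_inverse)
    finally show ?thesis by (simp add: t_def poly_sum poly_monom)
  qed
  have sum_xV: "sum h I \<in> xV" if "\<And>i. i \<in> I \<Longrightarrow> h i \<in> xV" for h :: "nat \<Rightarrow> 'a" and I
    using that by (induction I rule: infinite_finite_induct) (auto intro: xV_closed)
  have tc: "coeff t i \<in> xV" for i
    unfolding t_def coeff_sum by (intro sum_xV) (auto simp: c xV_closed(3))
  have td: "coeff t i = 0" if "i \<ge> n" for i
    unfolding t_def coeff_sum using that n0 by (intro sum.neutral) auto
  define h where "h = f - monom (coeff f n) n + smult (coeff f n) t"
  have "coeff h i \<in> xV" for i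
    using f(1) tc xV_closed by (auto simp: h_def)
  moreover have "poly h z = 1" using f(2) tz by (simp add: h_def poly_monom)
  moreover have "coeff h i = 0" if "i \<ge> n" for i
    using that td[OF that] by (auto simp: h_def n_def coeff_eq_0)
  then have "degree h < n" using n0
    by (metis leading_coeff_0_iff degree_0 not_le)
  ultimately show ?thesis unfolding n_def by blast
qed

text \<open>If neither element lay in V, both would satisfy relations over \<open>xV\<close>. Of two
  shortest relations, the one of larger degree could be shortened by the other.\<close>

lemma valuation_ring:
  assumes z: "z \<in> L" "z \<noteq> 0"
  shows "z \<in> V \<or> inverse z \<in> V"
proof (rule ccontr)
  assume n: "\<not> ?thesis"
  define A where "A w k \<longleftrightarrow> (\<exists>g. (\<forall>i. coeff g i \<in> xV) \<and> poly g w = 1 \<and> degree g = k)" for w k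
  have ex: "\<exists>k. A z k" "\<exists>k. A (inverse z) k"
    using xV_relation[OF z(1)] xV_relation[OF subfield_inverse[OF L z(1)]] n unfolding A_def by blast+
  define k where "k = (LEAST k. A z k)"
  define l where "l = (LEAST k. A (inverse z) k)"
  have "A z k" "A (inverse z) l" unfolding k_def l_def using ex by (auto intro: LeastI_ex)
  then obtain f g where f: "\<And>i. coeff f i \<in> xV" "poly f z = 1" "degree f = k"
    and g: "\<And>i. coeff g i \<in> xV" "poly g (inverse z) = 1" "degree g = l"
    unfolding A_def by blast
  show False
  proof (cases "l \<le> k")
    case True
    then obtain h where "\<forall>i. coeff h i \<in> xV" "poly h z = 1" "degree h < k"
      using reduce_relation[OF z(2) f(1,2) g(1,2)] f(3) g(3) by auto
    then show False using not_less_Least[of "degree h" "A z"] unfolding A_def k_def by blast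
  next
    case False
    then obtain h where "\<forall>i. coeff h i \<in> xV" "poly h (inverse z) = 1" "degree h < l"
      using reduce_relation[of "inverse z" g f] z(2) f g by auto
    then show False using not_less_Least[of "degree h" "A (inverse z)"] unfolding A_def l_def by blast
  qed
qed

definition "units = {z \<in> L. z \<noteq> 0 \<and> z \<in> V \<and> inverse z \<in> V}"

lemma units_mult: "a \<in> units \<Longrightarrow> b \<in> units \<Longrightarrow> a * b \<in> units"
  using subring_mult[OF V] subfield_mult[OF L] unfolding units_def by auto

lemma units_inverse: "a \<in> units \<Longrightarrow> inverse a \<in> units"
  using subfield_inverse[OF L] unfolding units_def by auto

lemma units_1: "1 \<in> units"
  using subring_1[OF V] subfield_1[OF L] unfolding units_def by auto

lemma units_power: "a \<in> units \<Longrightarrow> a ^ n \<in> units"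
  by (induction n) (auto intro: units_1 units_mult)

lemma nonunits_mult: "a \<in> V \<Longrightarrow> b \<in> V \<Longrightarrow> b \<notin> units \<Longrightarrow> a * b \<notin> units"
proof
  assume a: "a \<in> V" "b \<in> V" "b \<notin> units" "a * b \<in> units"
  then have nz: "b \<noteq> 0" "a \<noteq> 0" by (auto simp: units_def)
  have "inverse (a * b) \<in> V" using a(4) unfolding units_def by blast
  then have "a * inverse (a * b) \<in> V" by (rule subring_mult[OF V a(1)])
  moreover have "a * inverse (a * b) = inverse b" using nz by (simp add: field_simps)
  ultimately have "inverse b \<in> V" by (simp only:)
  then show False using a(2,3) VL nz(1) unfolding units_def by blast
qed

lemma unit_of_power: "a \<in> V \<Longrightarrow> a ^ n \<in> units \<Longrightarrow> n > 0 \<Longrightarrow> a \<in> units"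
  using nonunits_mult[of "a ^ (n - 1)" a] subring_power[OF V, of a] by (cases n) (auto simp: mult.commute)

lemma nonunits_add:
  assumes "a \<in> V" "b \<in> V" "a \<notin> units" "b \<notin> units"
  shows "a + b \<notin> units"
proof -
  have *: "c + d \<notin> units" if "c \<in> V" "d \<in> V" "c \<notin> units" "c \<noteq> 0" "d / c \<in> V" for c d
  proof -
    have "(1 + d / c) * c \<notin> units" using that subring_add[OF V subring_1[OF V]] by (intro nonunits_mult) auto
    then show ?thesis using that(4) by (simp add: algebra_simps)
  qed
  show ?thesis
  proof (cases "a = 0 \<or> b = 0")
    case False
    then have "b / a \<in> V \<or> inverse (b / a) \<in> V"
      using valuation_ring[of "b / a"] subfield_divide[OF L] assms VL by auto
    then have "b / a \<in> V \<or> a / b \<in> V" by simp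
    then show ?thesis using *[of a b] *[of b a] assms False by (auto simp: add.commute)
  qed (use assms in auto)
qed

lemma nonunits_sum: "(\<And>i. i \<in> I \<Longrightarrow> h i \<in> V \<and> h i \<notin> units) \<Longrightarrow> sum h I \<in> V \<and> sum h I \<notin> units"
proof (induction I rule: infinite_finite_induct)
  case (insert i I)
  then have "h i \<in> V \<and> h i \<notin> units" "sum h I \<in> V \<and> sum h I \<notin> units" by blast+
  then show ?case
    unfolding sum.insert[OF insert.hyps(1,2)] using subring_add[OF V] nonunits_add by blast
qed (simp_all add: subring_0[OF V] units_def)

lemma x_nonunit: "x \<notin> units"
  using nonunit by (simp add: units_def)

lemma V_or_unit: "z \<in> L \<Longrightarrow> z \<noteq> 0 \<Longrightarrow> z \<notin> units \<Longrightarrow> (z \<in> V) \<noteq> (inverse z \<in> V)"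
  using valuation_ring[of z] by (auto simp: units_def)

lemma dominating_term:
  assumes "finite S" "S \<noteq> {}" "\<And>i. i \<in> S \<Longrightarrow> h i \<in> L \<and> h i \<noteq> 0"
  shows "\<exists>i\<in>S. \<forall>k\<in>S. h k / h i \<in> V"
  using assms
proof (induction S rule: finite_ne_induct)
  case (singleton i)
  then show ?case using subring_1[OF V] by simp
next
  case (insert j S)
  then obtain i where i: "i \<in> S" "\<And>k. k \<in> S \<Longrightarrow> h k / h i \<in> V" by auto
  have nz: "h i \<noteq> 0" "h j \<noteq> 0" "h i \<in> L" "h j \<in> L" using insert.prems i by auto
  have "h j / h i \<in> V \<or> inverse (h j / h i) \<in> V"
    using valuation_ring[of "h j / h i"] nz subfield_divide[OF L] by simp
  then show ?case
  proof
    assume "h j / h i \<in> V"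
    then show ?thesis using i by auto
  next
    assume a: "inverse (h j / h i) \<in> V"
    have "h k / h j \<in> V" if "k \<in> S" for k
      using subring_mult[OF V i(2)[OF that] a] nz by simp
    then show ?thesis using subring_1[OF V] nz by (intro bexI[of _ j]) auto
  qed
qed

text \<open>In a vanishing sum a dominating term cannot dominate strictly, so another term is its
  associate. The quotient of these two terms is a power of z times an element of E.\<close>

lemma power_associate:
  assumes E: "is_subfield E" "E \<subseteq> L" and z: "z \<in> L" "z \<noteq> 0"
    and f: "coeffs_in E f" "f \<noteq> 0" "poly f z = 0"
  shows "\<exists>j b. 1 \<le> j \<and> j \<le> degree f \<and> b \<in> E \<and> b \<noteq> 0 \<and> z ^ j * b \<in> units"
proof -
  define h where "h i = coeff f i * z ^ i" for i
  define S where "S = {i. i \<le> degree f \<and> coeff f i \<noteq> 0}"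
  have fS: "finite S" by (simp add: S_def)
  have "degree f \<in> S" using f(2) by (simp add: S_def)
  then have S0: "S \<noteq> {}" by blast
  have hL: "h i \<in> L \<and> h i \<noteq> 0" if "i \<in> S" for i
  proof -
    have "coeff f i \<in> L" using f(1) E(2) by (auto simp: coeffs_in_def)
    then show ?thesis using that z subfield_mult[OF L] subfield_power[OF L] by (simp add: h_def S_def)
  qed
  obtain i where i: "i \<in> S" "\<And>k. k \<in> S \<Longrightarrow> h k / h i \<in> V"
    using dominating_term[of S h, OF fS S0 hL] by auto
  have "(\<Sum>k\<in>S. h k) = (\<Sum>k\<le>degree f. h k)"
    unfolding S_def h_def by (rule sum.mono_neutral_left) auto
  also have "\<dots> = 0" using f(3) by (simp add: poly_altdef h_def)
  finally have "(\<Sum>k\<in>S. h k / h i) = 0" by (simp add: sum_divide_distrib[symmetric])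
  moreover have "(\<Sum>k\<in>S. h k / h i) = 1 + (\<Sum>k\<in>S - {i}. h k / h i)"
    using hL[OF i(1)] fS i(1) by (subst sum.remove[of S i]) auto
  ultimately have m1: "(\<Sum>k\<in>S - {i}. h k / h i) = - 1" by (simp only: eq_neg_iff_add_eq_0 add.commute)
  have "- 1 \<in> units" using units_1 subring_uminus[OF V] subfield_uminus[OF L] unfolding units_def by auto
  then obtain k where k: "k \<in> S" "k \<noteq> i" "h k / h i \<in> units"
    using nonunits_sum[of "S - {i}" "\<lambda>k. h k / h i"] i(2) m1 by auto
  have *: "\<exists>j b. 1 \<le> j \<and> j \<le> degree f \<and> b \<in> E \<and> b \<noteq> 0 \<and> z ^ j * b \<in> units"
    if "k \<in> S" "l \<in> S" "l < k" "h k / h l \<in> units" for k l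
  proof -
    have "h k / h l = z ^ (k - l) * (coeff f k / coeff f l)"
      using that(3) z by (simp add: h_def power_diff mult.commute)
    moreover have "coeff f k / coeff f l \<in> E" using f(1) subfield_divide[OF E(1)] by (auto simp: coeffs_in_def)
    moreover have "coeff f k / coeff f l \<noteq> 0" using that by (simp add: S_def)
    moreover have "1 \<le> k - l" "k - l \<le> degree f" using that by (auto simp: S_def)
    ultimately show ?thesis using that(4) by metis
  qed
  show ?thesis
  proof (cases "i < k")
    case True
    then show ?thesis using *[OF k(1) i(1) _ k(3)] by simp
  next
    case False
    then have "k < i" using k(2) by simp
    moreover have "h i / h k \<in> units" using units_inverse[OF k(3)] by simp
    ultimately show ?thesis using *[OF i(1) k(1)] by simp
  qed
qed

end

lemma exists_maximal_subring:
  fixes L :: "'a::field set"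
  assumes L: "is_subfield L" and R: "is_subring R" "R \<subseteq> L" "x \<in> R" "x \<noteq> 0" "inverse x \<notin> R"
  shows "\<exists>V. R \<subseteq> V \<and> maximal_subring L V x"
proof -
  define C where "C = {V. is_subring V \<and> R \<subseteq> V \<and> V \<subseteq> L \<and> inverse x \<notin> V}"
  have ne: "C \<noteq> {}" using R unfolding C_def by blast
  have chain: "\<Union>D \<in> C" if D: "D \<noteq> {}" "subset.chain C D" for D
  proof -
    have DC: "\<And>V. V \<in> D \<Longrightarrow> V \<in> C" and tot: "\<And>V W. V \<in> D \<Longrightarrow> W \<in> D \<Longrightarrow> V \<subseteq> W \<or> W \<subseteq> V"
      using D(2) unfolding subset.chain_def by auto
    obtain V0 where V0: "V0 \<in> D" using D(1) by blast
    have sr: "is_subring V" if "V \<in> D" for V using DC[OF that] by (simp add: C_def)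
    have "is_subring (\<Union>D)"
      unfolding is_subring_def
    proof (intro conjI ballI)
      show "0 \<in> \<Union>D" "1 \<in> \<Union>D" using V0 subring_0[OF sr] subring_1[OF sr] by blast+
      fix a assume "a \<in> \<Union>D"
      then obtain V where V: "V \<in> D" "a \<in> V" by blast
      then show "- a \<in> \<Union>D" using subring_uminus[OF sr] by blast
      fix b assume "b \<in> \<Union>D"
      then obtain W where W: "W \<in> D" "b \<in> W" by blast
      obtain U where "U \<in> D" "a \<in> U" "b \<in> U" using tot[OF V(1) W(1)] V W by blast
      then show "a + b \<in> \<Union>D" "a * b \<in> \<Union>D" using subring_add[OF sr] subring_mult[OF sr] by blast+
    qed
    then show ?thesis using DC V0 unfolding C_def by blast
  qed
  obtain V where V: "V \<in> C" "\<And>W. W \<in> C \<Longrightarrow> V \<subseteq> W \<Longrightarrow> W = V"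
    using subset_Zorn_nonempty[OF ne chain] by blast
  have "maximal_subring L V x"
  proof
    show "is_subfield L" by fact
    show "is_subring V" "V \<subseteq> L" "x \<in> V" "x \<noteq> 0" "inverse x \<notin> V" using V(1) R unfolding C_def by auto
    show "W = V" if "is_subring W" "V \<subseteq> W" "W \<subseteq> L" "inverse x \<notin> W" for W
      using V(2)[of W] V(1) that unfolding C_def by auto
  qed
  then show ?thesis using V(1) unfolding C_def by blast
qed

lemma tt_nonzero: "tt \<noteq> (0 :: 'k::field geo)"
  by (simp add: tt_def Zero_fract_def eq_fract)

section \<open>From a valuation ring to a discrete valuation\<close>

locale place_construction = maximal_subring L V x
  for L V :: "'k::field geo set" and x :: "'k geo" +
  fixes K F :: "'k geo set"
  assumes cst_V: "cst c \<in> V" and tt_L: "tt \<in> L"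
    and K: "is_subfield K" "K \<subseteq> L" and F: "is_subfield F" "F \<subseteq> K"
    and alg_K: "\<And>z. z \<in> L \<Longrightarrow> \<exists>f. coeffs_in K f \<and> f \<noteq> 0 \<and> degree f \<le> 3 \<and> poly f z = 0"
    and alg_F: "\<And>z. z \<in> K \<Longrightarrow> \<exists>f. coeffs_in F f \<and> f \<noteq> 0 \<and> degree f \<le> 2 \<and> poly f z = 0"
    and frac: "\<And>s z. s = tt \<or> s = inverse tt \<Longrightarrow> z \<in> F \<Longrightarrow>
      \<exists>f g. z = poly (cpoly f) s / poly (cpoly g) s \<and> poly (cpoly g) s \<noteq> 0"
    and sF: "\<And>s f. s = tt \<or> s = inverse tt \<Longrightarrow> poly (cpoly f) s \<in> F"
begin

lemma F_L: "F \<subseteq> L" using F K by auto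

lemma cst_unit: "c \<noteq> 0 \<Longrightarrow> cst c \<in> units"
  using cst_V[of c] cst_V[of "inverse c"] VL by (auto simp: units_def cst.hom_inverse)

text \<open>An exponent j at most 3 leads from L to K and an exponent i at most 2 from K to F. All
  products i j divide 12, so one exponent serves for every z.\<close>

lemma twelfth_power_associate:
  assumes z: "z \<in> L" "z \<noteq> 0"
  shows "\<exists>c\<in>F. c \<noteq> 0 \<and> z ^ 12 * c \<in> units"
proof -
  obtain f where f: "coeffs_in K f" "f \<noteq> 0" "degree f \<le> 3" "poly f z = 0" using alg_K[OF z(1)] by blast
  obtain j b where j: "1 \<le> j" "j \<le> 3" and b: "b \<in> K" "b \<noteq> 0" and jb: "z ^ j * b \<in> units"
    using power_associate[OF K z f(1,2,4)] f(3) by (metis order_trans)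
  have bL: "b \<in> L" using b K by auto
  obtain g where g: "coeffs_in F g" "g \<noteq> 0" "degree g \<le> 2" "poly g b = 0" using alg_F[OF b(1)] by blast
  obtain i c where i: "1 \<le> i" "i \<le> 2" and c: "c \<in> F" "c \<noteq> 0" and ic: "b ^ i * c \<in> units"
    using power_associate[OF F(1) F_L bL b(2) g(1,2,4)] g(3) by (metis order_trans)
  have "j = 1 \<or> j = 2 \<or> j = 3" "i = 1 \<or> i = 2" using i j by auto
  then have "j * (12 div j) = 12" "12 div j = i * (12 div j div i)" by auto
  then obtain M N where MN: "j * M = 12" "M = i * N" by blast
  have "z ^ 12 * inverse (c ^ N) = (z ^ j * b) ^ M * inverse ((b ^ i * c) ^ N)"
    using b(2) unfolding power_mult_distrib MN(1)[symmetric] power_mult MN(2) by (simp add: power_mult)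
  also have "\<dots> \<in> units" using jb ic units_mult units_inverse units_power by blast
  finally show ?thesis
    using c subfield_inverse[OF F(1)] subfield_power[OF F(1)] by (intro bexI[of _ "inverse (c ^ N)"]) auto
qed

lemma exists_coordinate: "\<exists>s. (s = tt \<or> s = inverse tt) \<and> s \<in> V"
  using valuation_ring[OF tt_L tt_nonzero] by blast

lemma poly_V: "s \<in> V \<Longrightarrow> poly (cpoly f) s \<in> V"
  by (intro poly_in_subring[OF V]) (simp_all add: coeffs_in_def cst_V)

text \<open>The valuation ring induces on \<open>F\<close> the ring of a point of the line, with a uniformizer \<open>\<pi>\<close>.\<close>

lemma uniformizer:
  "\<exists>\<pi>\<in>F. \<pi> \<in> V \<and> \<pi> \<noteq> 0 \<and> \<pi> \<notin> units \<and> (\<forall>z\<in>F. z \<noteq> 0 \<longrightarrow> (\<exists>m. z * \<pi> powi m \<in> units))"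
proof -
  obtain s where s: "s = tt \<or> s = inverse tt" "s \<in> V" using exists_coordinate by blast
  define ev where "ev f = poly (cpoly f) s" for f
  have evV: "ev f \<in> V" for f unfolding ev_def by (rule poly_V[OF s(2)])
  have evF: "ev f \<in> F" for f unfolding ev_def by (rule sF[OF s(1)])
  have ev_simps: "ev (f * g) = ev f * ev g" "ev (f + g) = ev f + ev g" "ev (f - g) = ev f - ev g" for f g
    by (simp_all add: ev_def)
  define Q where "Q n \<longleftrightarrow> (\<exists>p. ev p \<noteq> 0 \<and> ev p \<notin> units \<and> degree p = n)" for n
  \<comment> \<open>If all nonzero values were units, so would be all nonzero elements of F. Then
    x^12, associated to an element of F, would be a unit, and with it x.\<close>
  have "\<exists>n. Q n"
  proof (rule ccontr)
    assume "\<nexists>n. Q n"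
    then have u: "ev p \<in> units" if "ev p \<noteq> 0" for p using that unfolding Q_def by blast
    have Fu: "z \<in> units" if z: "z \<in> F" "z \<noteq> 0" for z
    proof -
      obtain f g where fg: "z = ev f / ev g" "ev g \<noteq> 0" using frac[OF s(1) z(1)] unfolding ev_def by blast
      then have "ev f \<noteq> 0" using z(2) by auto
      then have "ev f * inverse (ev g) \<in> units" using u fg(2) units_mult units_inverse by blast
      then show ?thesis unfolding fg(1) by (simp add: divide_inverse)
    qed
    obtain c where c: "c \<in> F" "c \<noteq> 0" "x ^ 12 * c \<in> units"
      using twelfth_power_associate[of x] xV VL x0 by blast
    have "x ^ 12 * c * inverse c \<in> units" using c Fu units_mult units_inverse by blast
    then have "x ^ 12 \<in> units" using c(2) by (simp add: mult.assoc)
    then show False using unit_of_power[OF xV, of 12] x_nonunit by simp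
  qed
  then have "Q (LEAST n. Q n)" by (rule LeastI_ex)
  then obtain p where p: "ev p \<noteq> 0" "ev p \<notin> units" "degree p = (LEAST n. Q n)" unfolding Q_def by blast
  have min: "ev r \<in> units" if "ev r \<noteq> 0" "degree r < degree p" for r
    using that not_less_Least[of "degree r" Q] p(3) unfolding Q_def by auto
  have p0: "p \<noteq> 0" using p(1) by (auto simp: ev_def)
  have dp: "degree p > 0"
  proof (rule ccontr)
    assume "\<not> degree p > 0"
    then obtain c where c: "p = [:c:]" by (metis degree_0_id gr0I)
    then have "ev p = cst c" by (simp add: ev_def)
    then show False using p cst_unit[of c] by auto
  qed
  \<comment> \<open>On division by p a nonunit leaves a remainder whose value is a nonunit; by
    minimality of p that value is zero. So p splits off repeatedly until a unit is left.\<close>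
  have key: "\<exists>m u. u \<in> units \<and> ev f = u * ev p ^ m" if "ev f \<noteq> 0" for f
    using that
  proof (induction "degree f" arbitrary: f rule: less_induct)
    case less
    show ?case
    proof (cases "ev f \<in> units")
      case True
      then show ?thesis by (intro exI[of _ 0] exI[of _ "ev f"]) simp
    next
      case False
      define q where "q = f div p"
      define r where "r = f mod p"
      have fqr: "f = q * p + r" by (simp add: q_def r_def)
      have er: "ev r = ev f + (- ev q) * ev p" using fqr by (simp add: ev_simps)
      have "- ev q * ev p \<notin> units" using nonunits_mult[OF subring_uminus[OF V evV] evV p(2)] .
      then have "ev r \<notin> units" unfolding er
        using nonunits_add[OF evV _ False] subring_mult[OF V subring_uminus[OF V evV] evV] by blast
      moreover have "r = 0 \<or> degree r < degree p" using degree_mod_less[OF p0, of f] by (simp add: r_def)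
      ultimately have "ev r = 0" using min[of r] by (auto simp: ev_def)
      then have fq: "ev f = ev q * ev p" using er by simp
      then have q0: "ev q \<noteq> 0" "q \<noteq> 0" using less.prems by (auto simp: ev_def)
      have "degree f = degree q + degree p"
      proof (cases "r = 0")
        case True
        then show ?thesis using fqr q0 p0 by (simp add: degree_mult_eq)
      next
        case False
        then have "degree r < degree (q * p)"
          using \<open>r = 0 \<or> degree r < degree p\<close> q0 p0 by (simp add: degree_mult_eq)
        then show ?thesis using fqr q0 p0 degree_add_eq_left[of r "q * p"] by (simp add: degree_mult_eq)
      qed
      then obtain m u where "u \<in> units" "ev q = u * ev p ^ m" using less.hyps[of q] q0 dp by auto
      then show ?thesis using fq by (intro exI[of _ "Suc m"] exI[of _ u]) simp
    qed
  qed
  have "\<exists>m. z * ev p powi m \<in> units" if z: "z \<in> F" "z \<noteq> 0" for z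
  proof -
    obtain f g where fg: "z = ev f / ev g" "ev g \<noteq> 0" using frac[OF s(1) z(1)] unfolding ev_def by blast
    then have "ev f \<noteq> 0" using z(2) by auto
    then obtain m u where mu: "u \<in> units" "ev f = u * ev p ^ m" using key by blast
    obtain n w where nw: "w \<in> units" "ev g = w * ev p ^ n" using key[OF fg(2)] by blast
    have w0: "w \<noteq> 0" using nw(1) by (auto simp: units_def)
    have "ev p powi (int n - int m) = ev p ^ n / ev p ^ m" using p(1) by (simp add: power_int_diff)
    then have "z * ev p powi (int n - int m) = u * inverse w"
      unfolding fg(1) mu(2) nw(2) using p(1) w0 by (simp add: field_simps)
    also have "\<dots> \<in> units" using mu nw units_mult units_inverse by blast
    finally show ?thesis by blast
  qed
  then show ?thesis using p evF evV by blast
qed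

text \<open>The function \<open>w\<close> is a multiple of the sought valuation: it is additive and
  nonnegative exactly on V. Division by its least positive value normalizes it.\<close>

lemma exists_place: "\<exists>Q\<in>places L. 0 < Q x"
proof -
  obtain \<pi> where \<pi>: "\<pi> \<in> F" "\<pi> \<in> V" "\<pi> \<noteq> 0" "\<pi> \<notin> units"
    and assoc: "\<And>z. z \<in> F \<Longrightarrow> z \<noteq> 0 \<Longrightarrow> \<exists>m. z * \<pi> powi m \<in> units"
    using uniformizer by blast
  have \<pi>L: "\<pi> \<in> L" using \<pi>(2) VL by auto
  have pos: "\<pi> powi k \<in> V \<and> \<pi> powi k \<notin> units" if "0 < k" for k :: int
  proof -
    define n where "n = nat k"
    have n: "n > 0" "\<pi> powi k = \<pi> ^ n" using that by (auto simp: n_def power_int_def)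
    then show ?thesis using subring_power[OF V \<pi>(2)] unit_of_power[OF \<pi>(2), of n] \<pi>(4) by auto
  qed
  have unit0: "k = 0" if "\<pi> powi k \<in> units" for k
  proof (rule ccontr)
    assume "k \<noteq> 0"
    then consider "0 < k" | "0 < - k" by linarith
    then show False
    proof cases
      case 1
      then show False using pos that by blast
    next
      case 2
      moreover have "\<pi> powi (- k) \<in> units" using units_inverse[OF that] by (simp add: power_int_minus)
      ultimately show False using pos by blast
    qed
  qed
  \<comment> \<open>Says that z^12 is associated to the m-th power of the uniformizer of F.\<close>
  define A where "A z m \<longleftrightarrow> z ^ 12 * \<pi> powi (- m) \<in> units" for z m
  have exA: "\<exists>m. A z m" if z: "z \<in> L" "z \<noteq> 0" for z
  proof -
    obtain c where c: "c \<in> F" "c \<noteq> 0" "z ^ 12 * c \<in> units" using twelfth_power_associate[OF z] by blast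
    obtain m where m: "c * \<pi> powi m \<in> units" using assoc c by blast
    have "z ^ 12 * \<pi> powi (- (- (- m))) = (z ^ 12 * c) * inverse (c * \<pi> powi m)"
      using c(2) by (simp add: power_int_minus field_simps)
    also have "\<dots> \<in> units" using units_mult[OF c(3) units_inverse[OF m]] .
    finally show ?thesis unfolding A_def by blast
  qed
  have uniqA: "m = n" if "A z m" "A z n" "z \<noteq> 0" for z m n
  proof -
    have "\<pi> powi (n - m) = (z ^ 12 * \<pi> powi (- m)) * inverse (z ^ 12 * \<pi> powi (- n))"
      using that(3) \<pi>(3) by (simp add: power_int_diff power_int_minus field_simps)
    also have "\<dots> \<in> units" using that units_mult units_inverse unfolding A_def by blast
    finally show ?thesis using unit0[of "n - m"] by simp
  qed
  define w where "w z = (THE m. A z m)" for z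
  have wA: "A z (w z)" if "z \<in> L" "z \<noteq> 0" for z
    unfolding w_def using exA[OF that] uniqA that by (metis (mono_tags, lifting) theI)
  have wI: "w z = m" if "A z m" "z \<in> L" "z \<noteq> 0" for z m using uniqA wA that by blast
  have w_mult: "w (a * b) = w a + w b" if "a \<in> L" "b \<in> L" "a \<noteq> 0" "b \<noteq> 0" for a b
  proof (rule wI)
    have "(a * b) ^ 12 * \<pi> powi (- (w a + w b)) = (a ^ 12 * \<pi> powi (- w a)) * (b ^ 12 * \<pi> powi (- w b))"
      using \<pi>(3) by (simp add: power_int_diff power_int_minus power_mult_distrib power_int_add field_simps)
    also have "\<dots> \<in> units" using wA that units_mult unfolding A_def by blast
    finally show "A (a * b) (w a + w b)" unfolding A_def .
  qed (use that subfield_mult[OF L] in auto)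
  have w_unit: "w z = 0" if "z \<in> units" for z
    by (rule wI) (use that units_power in \<open>auto simp: A_def units_def\<close>)
  have w_nonunit: "0 < w z" if z: "z \<in> V" "z \<notin> units" "z \<noteq> 0" for z
  proof (rule ccontr)
    assume n: "\<not> 0 < w z"
    have zL: "z \<in> L" using z VL by auto
    have a: "z ^ 12 * \<pi> powi (- w z) \<in> units" using wA[OF zL z(3)] unfolding A_def .
    have "\<pi> powi (- w z) \<in> V"
    proof (cases "w z = 0")
      case True
      then show ?thesis using subring_1[OF V] by simp
    next
      case False
      then show ?thesis using pos[of "- w z"] n by simp
    qed
    moreover have "z ^ 12 \<notin> units" using unit_of_power[OF z(1), of 12] z(2) by auto
    ultimately have "\<pi> powi (- w z) * z ^ 12 \<notin> units"
      by (intro nonunits_mult subring_power[OF V z(1)])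
    then show False using a by (simp add: mult.commute)
  qed
  have w_V: "z \<in> V \<longleftrightarrow> 0 \<le> w z" if z: "z \<in> L" "z \<noteq> 0" for z
  proof (cases "z \<in> units")
    case True
    then show ?thesis using w_unit by (simp add: units_def)
  next
    case False
    have "w (inverse z) = - w z"
      using w_mult[of z "inverse z"] z w_unit[OF units_1] subfield_inverse[OF L] by simp
    moreover have "inverse z \<notin> units" using False units_inverse[of "inverse z"] by auto
    ultimately show ?thesis
      using w_nonunit[of z] w_nonunit[of "inverse z"] V_or_unit[OF z False] False z by force
  qed
  have w_add: "min (w a) (w b) \<le> w (a + b)"
    if ab: "a \<in> L" "b \<in> L" "a \<noteq> 0" "b \<noteq> 0" "a + b \<noteq> 0" for a b
  proof -
    have *: "w c \<le> w (c + d)" if cd: "c \<in> L" "d \<in> L" "c \<noteq> 0" "d \<noteq> 0" "c + d \<noteq> 0" "w c \<le> w d" for c d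
    proof -
      have dc: "d / c \<in> L" "d / c \<noteq> 0" using cd subfield_divide[OF L] by auto
      have "w d = w c + w (d / c)" using w_mult[OF cd(1) dc(1) cd(3) dc(2)] cd by simp
      then have "d / c \<in> V" using w_V[OF dc] cd(6) by simp
      then have e: "1 + d / c \<in> V" using subring_add[OF V subring_1[OF V]] by blast
      have e0: "1 + d / c \<noteq> 0" using cd by (simp add: field_simps)
      have "c + d = c * (1 + d / c)" using cd by (simp add: field_simps)
      then have "w (c + d) = w c + w (1 + d / c)" using w_mult[of c "1 + d / c"] cd e e0 VL by auto
      moreover have "0 \<le> w (1 + d / c)" using w_V[of "1 + d / c"] e e0 VL by auto
      ultimately show ?thesis by simp
    qed
    show ?thesis using *[of a b] *[of b a] ab by (cases "w a \<le> w b") (auto simp: add.commute)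
  qed
  \<comment> \<open>The least element e of S generates the image of w.\<close>
  define S where "S n \<longleftrightarrow> 0 < n \<and> (\<exists>z\<in>L. z \<noteq> 0 \<and> w z = int n)" for n
  have xL: "x \<in> L" using xV VL by auto
  have wx: "0 < w x" by (rule w_nonunit[OF xV x_nonunit x0])
  have "S (nat (w x))" unfolding S_def using wx xL x0 by auto
  then have S: "S (LEAST n. S n)" by (rule LeastI)
  define e where "e = int (LEAST n. S n)"
  obtain y where y: "y \<in> L" "y \<noteq> 0" "w y = e" and e0: "0 < e" using S unfolding S_def e_def by auto
  have w_pow: "w (y ^ n) = int n * e" for n
    by (induction n) (use y w_unit[OF units_1] w_mult subfield_power[OF L] in \<open>auto simp: algebra_simps\<close>)
  have w_inv: "w (inverse z) = - w z" if "z \<in> L" "z \<noteq> 0" for z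
    using w_mult[of z "inverse z"] that w_unit[OF units_1] subfield_inverse[OF L] by simp
  have div: "e dvd w z" if z: "z \<in> L" "z \<noteq> 0" for z
  proof -
    have *: "w a mod e = 0" if a: "a \<in> L" "a \<noteq> 0" "0 \<le> w a" for a
    proof (rule ccontr)
      assume n: "w a mod e \<noteq> 0"
      define k where "k = nat (w a div e)"
      have ik: "int k = w a div e" using a(3) e0 by (simp add: k_def pos_imp_zdiv_nonneg_iff)
      define b where "b = a * inverse (y ^ k)"
      have yk: "y ^ k \<in> L" "y ^ k \<noteq> 0" using y subfield_power[OF L] by auto
      have b: "b \<in> L" "b \<noteq> 0" using a yk subfield_mult[OF L] subfield_inverse[OF L] by (auto simp: b_def)
      have "w b = w a - int k * e"
        unfolding b_def using w_mult[of a "inverse (y ^ k)"] a yk subfield_inverse[OF L] w_inv w_pow by simp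
      then have wb: "w b = w a mod e" unfolding ik by (simp add: minus_div_mult_eq_mod)
      have "0 < w a mod e" "w a mod e < e" using n pos_mod_sign[OF e0, of "w a"] pos_mod_bound[OF e0, of "w a"] by linarith+
      then have "S (nat (w b))" "nat (w b) < (LEAST n. S n)" using b wb unfolding S_def e_def by auto
      then show False using not_less_Least by blast
    qed
    show ?thesis
    proof (cases "0 \<le> w z")
      case True
      then show ?thesis using *[OF z] by auto
    next
      case False
      then have "w (inverse z) mod e = 0" using *[of "inverse z"] z w_inv subfield_inverse[OF L] by auto
      then show ?thesis using w_inv[OF z] by auto
    qed
  qed
  define Q where "Q z = (if z \<in> L \<and> z \<noteq> 0 then w z div e else 0)" for z
  have "Q \<in> places L"
    unfolding places_def
  proof (intro CollectI conjI allI ballI impI)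
    fix z assume "z \<notin> L \<or> z = 0" then show "Q z = 0" by (auto simp: Q_def)
  next
    fix a b assume ab: "a \<in> L - {0}" "b \<in> L - {0}"
    then show "Q (a * b) = Q a + Q b"
      using w_mult[of a b] div[of a] subfield_mult[OF L] by (auto simp: Q_def div_plus_div_distrib_dvd_left)
    assume s: "a + b \<noteq> 0"
    have "min (w a) (w b) \<le> w (a + b)" using w_add ab s by auto
    then have "min (w a) (w b) div e \<le> w (a + b) div e" using e0 by (rule zdiv_mono1)
    moreover have "min (w a) (w b) div e = min (w a div e) (w b div e)"
      using zdiv_mono1[of "w a" "w b" e] zdiv_mono1[of "w b" "w a" e] e0 by (auto simp: min_def)
    ultimately show "min (Q a) (Q b) \<le> Q (a + b)" using ab s subfield_add[OF L] by (auto simp: Q_def)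
  next
    fix c show "Q (cst c) = 0" using w_unit[OF cst_unit[of c]] by (cases "c = 0") (auto simp: Q_def)
  next
    show "\<exists>z\<in>L. Q z = 1" using y e0 by (intro bexI[of _ y]) (auto simp: Q_def)
  qed
  moreover have "0 < Q x"
  proof -
    have "e dvd w x" using div xL x0 by blast
    then obtain k where "w x = e * k" by (rule dvdE)
    then show ?thesis using wx e0 xL x0 by (auto simp: Q_def zero_less_mult_iff)
  qed
  ultimately show ?thesis by blast
qed

end

text \<open>Since x is transcendental over k, the ring k[x] omits \<open>inverse x\<close>, which
  makes it a starting point for Zorn's lemma.\<close>

lemma exists_valuation_ring:
  fixes L :: "'k::field geo set"
  assumes Lf: "is_subfield L" "range cst \<subseteq> L" and x: "x \<in> L" and n: "x \<notin> constants_closure"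
  shows "\<exists>V. range cst \<subseteq> V \<and> maximal_subring L V x"
proof -
  have tr: "f = 0" if "poly (cpoly f) x = 0" for f
    using that n unfolding constants_closure_def cpoly_def by blast
  define R where "R = {poly (cpoly f) x | f. True}"
  have x0: "x \<noteq> 0" using tr[of "[:0, 1:]"] by auto
  have "poly (cpoly f) x \<in> R" for f unfolding R_def by blast
  then have mem: "a \<in> R" if "a = poly (cpoly f) x" for a f using that by simp
  have "is_subring R"
    unfolding is_subring_def
  proof (intro conjI ballI)
    show "0 \<in> R" by (rule mem[of _ 0]) simp
    show "1 \<in> R" by (rule mem[of _ 1]) simp
    fix a assume "a \<in> R"
    then obtain f where f: "a = poly (cpoly f) x" unfolding R_def by blast
    show "- a \<in> R" by (rule mem[of _ "- f"]) (simp add: f)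
    fix b assume "b \<in> R"
    then obtain g where g: "b = poly (cpoly g) x" unfolding R_def by blast
    show "a + b \<in> R" by (rule mem[of _ "f + g"]) (simp add: f g)
    show "a * b \<in> R" by (rule mem[of _ "f * g"]) (simp add: f g)
  qed
  moreover have "R \<subseteq> L"
  proof -
    have "coeffs_in L (cpoly f)" for f using Lf(2) by (auto simp: coeffs_in_def)
    then show ?thesis
      unfolding R_def using poly_in_subring[OF is_subfield_imp_subring[OF Lf(1)]] x by blast
  qed
  moreover have "x \<in> R" by (rule mem[of _ "[:0, 1:]"]) simp
  moreover have "inverse x \<notin> R"
  proof
    assume "inverse x \<in> R"
    then obtain f where "inverse x = poly (cpoly f) x" unfolding R_def by blast
    then have "x * poly (cpoly f) x = 1" using x0 by (metis right_inverse)
    then have "poly (cpoly (pCons (- 1) f)) x = 0" by (simp add: cst.hom_uminus)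
    then have "pCons (- 1) f = 0" by (rule tr)
    then show False by simp
  qed
  ultimately obtain V where RV: "R \<subseteq> V" "maximal_subring L V x"
    using exists_maximal_subring[OF Lf(1)] x0 by blast
  have "cst c \<in> V" for c using mem[of "cst c" "[:c:]"] RV(1) by auto
  then show ?thesis using RV by blast
qed

text \<open>The tower of F, K and L stands for the line, the curve and a cubic cover; the degree
  bounds 2 and 3 are those behind the exponent 12.\<close>

lemma valuations_zero_imp_constant:
  fixes L K F :: "'k::field geo set"
  assumes Lf: "is_subfield L" "range cst \<subseteq> L" "tt \<in> L"
    and K: "is_subfield K" "K \<subseteq> L" and F: "is_subfield F" "F \<subseteq> K"
    and alg_K: "\<And>z. z \<in> L \<Longrightarrow> \<exists>f. coeffs_in K f \<and> f \<noteq> 0 \<and> degree f \<le> 3 \<and> poly f z = 0"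
    and alg_F: "\<And>z. z \<in> K \<Longrightarrow> \<exists>f. coeffs_in F f \<and> f \<noteq> 0 \<and> degree f \<le> 2 \<and> poly f z = 0"
    and frac: "\<And>s z. s = tt \<or> s = inverse tt \<Longrightarrow> z \<in> F \<Longrightarrow>
      \<exists>f g. z = poly (cpoly f) s / poly (cpoly g) s \<and> poly (cpoly g) s \<noteq> 0"
    and sF: "\<And>s f. s = tt \<or> s = inverse tt \<Longrightarrow> poly (cpoly f) s \<in> F"
    and x: "x \<in> L" "\<And>Q. Q \<in> places L \<Longrightarrow> Q x = 0"
  shows "x \<in> constants_closure"
proof (rule ccontr)
  assume n: "x \<notin> constants_closure"
  obtain V where RV: "range cst \<subseteq> V" "maximal_subring L V x"
    using exists_valuation_ring[OF Lf(1,2) x(1) n] by blast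
  interpret maximal_subring L V x by fact
  have "cst c \<in> V" for c using RV(1) by auto
  then have "place_construction L V x K F"
    by unfold_locales (use Lf K F alg_K alg_F frac sF in auto)
  then have "\<exists>Q\<in>places L. 0 < Q x" by (rule place_construction.exists_place)
  then show False using x(2) by force
qed

section \<open>Constants and rational functions\<close>

lemma \<Omega>_pow [simp]: "x [^]\<^bsub>ring_of_type_algebra\<^esub> n = (x :: 'a::field) ^ (n::nat)"
proof (induction n)
  case 0
  then show ?case using monoid.nat_pow_0[OF ring.is_monoid[OF \<Omega>_ring], of x] by simp
next
  case (Suc n)
  then show ?case using monoid.nat_pow_Suc[OF ring.is_monoid[OF \<Omega>_ring], of x n]
    by (simp add: mult.commute)
qed

lemma \<Omega>_eval: "ring.eval ring_of_type_algebra p x = poly (Poly (rev p)) (x :: 'a::field)"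
proof (induction p)
  case Nil
  then show ?case by (simp add: ring.eval.simps[OF \<Omega>_ring])
next
  case (Cons a p)
  then show ?case by (simp add: ring.eval.simps[OF \<Omega>_ring] Poly_snoc poly_monom add.commute)
qed

text \<open>Passes between \<open>poly\<close> and the polynomials as coefficient lists of the
  algebraic library, which supplies that algebraic elements form a field.\<close>

lemma \<Omega>_algebraic_iff:
  fixes x :: "'a::Fields.field"
  assumes K: "is_subfield K"
  shows "\<not> ring.transcendental ring_of_type_algebra K x \<longleftrightarrow> (\<exists>f. coeffs_in K f \<and> f \<noteq> 0 \<and> poly f x = 0)"
proof -
  have sr: "subring K (ring_of_type_algebra :: 'a ring)"
    using K subfieldE(1) unfolding subfield_iff_is_subfield[symmetric] by blast
  show ?thesis
  proof
    assume "\<not> ring.transcendental ring_of_type_algebra K x"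
    then have "(ring.algebraic ring_of_type_algebra over K) x" by (simp add: over_def)
    then obtain p where p: "p \<in> carrier (univ_poly (ring_of_type_algebra :: 'a ring) K)" "p \<noteq> []"
      "ring.eval ring_of_type_algebra p x = \<zero>\<^bsub>ring_of_type_algebra\<^esub>"
      using domain.algebraicE[OF field.axioms(1)[OF \<Omega>_field] sr, of x] by auto
    then have "polynomial\<^bsub>ring_of_type_algebra\<^esub> K p" by (simp add: univ_poly_carrier)
    then have pK: "set p \<subseteq> K" "hd p \<noteq> 0" using p(2) by (auto simp: polynomial_def)
    obtain a ps where ap: "p = a # ps" using p(2) by (cases p) auto
    have "coeffs_in K (Poly (rev p))"
      using pK(1) subfield_0[OF K] by (auto simp: coeffs_in_def nth_default_def rev_nth)
    moreover have "Poly (rev p) \<noteq> 0"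
    proof
      assume "Poly (rev p) = 0"
      then have "coeff (Poly (rev p)) (length ps) = 0" by simp
      then show False using pK(2) by (simp add: ap nth_default_def nth_append)
    qed
    moreover have "poly (Poly (rev p)) x = 0" using p(3) by (simp add: \<Omega>_eval)
    ultimately show "\<exists>f. coeffs_in K f \<and> f \<noteq> 0 \<and> poly f x = 0" by blast
  next
    assume "\<exists>f. coeffs_in K f \<and> f \<noteq> 0 \<and> poly f x = 0"
    then obtain f where f: "coeffs_in K f" "f \<noteq> 0" "poly f x = 0" by blast
    define p where "p = rev (coeffs f)"
    have "p \<noteq> []" using f(2) by (simp add: p_def)
    moreover have "set p \<subseteq> K" using f(1) by (auto simp: p_def coeffs_def coeffs_in_def)
    moreover have "hd p \<noteq> 0" using f(2) by (simp add: p_def hd_rev last_coeffs_eq_coeff_degree)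
    ultimately have "polynomial\<^bsub>ring_of_type_algebra\<^esub> K p" by (simp add: polynomial_def)
    then have "p \<in> carrier (univ_poly (ring_of_type_algebra :: 'a ring) K)" by (simp add: univ_poly_carrier)
    moreover have "ring.eval ring_of_type_algebra p x = \<zero>\<^bsub>ring_of_type_algebra\<^esub>"
      using f(3) by (simp add: \<Omega>_eval p_def)
    ultimately have "(ring.algebraic ring_of_type_algebra over K) x"
      using ring.algebraicI[OF \<Omega>_ring, of p K x] \<open>p \<noteq> []\<close> by blast
    then show "\<not> ring.transcendental ring_of_type_algebra K x" by (simp add: over_def)
  qed
qed

lemma algebraic_elements_subfield:
  fixes K :: "'a::Fields.field set"
  assumes K: "is_subfield K"
  shows "is_subfield {x. \<exists>f. coeffs_in K f \<and> f \<noteq> 0 \<and> poly f x = 0}"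
proof -
  have "subfield {x \<in> carrier ring_of_type_algebra. (ring.algebraic ring_of_type_algebra over K) x}
      (ring_of_type_algebra :: 'a ring)"
    by (rule field.subfield_of_algebraics[OF \<Omega>_field]) (use K in \<open>simp add: subfield_iff_is_subfield\<close>)
  then show ?thesis
    unfolding subfield_iff_is_subfield by (simp add: over_def \<Omega>_algebraic_iff[OF K])
qed

lemma range_cst_subfield: "is_subfield (range (cst :: 'k::field \<Rightarrow> 'k geo))"
proof (rule is_subfieldI)
  show "0 \<in> range cst" "1 \<in> range cst" using cst.hom_zero cst.hom_one by (metis rangeI)+
  fix x :: "'k geo" assume "x \<in> range cst"
  then obtain a where a: "x = cst a" by blast
  show "- x \<in> range cst" "inverse x \<in> range cst"
    unfolding a cst.hom_uminus[symmetric] cst.hom_inverse[symmetric] by blast+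
  fix y :: "'k geo" assume "y \<in> range cst"
  then obtain b where b: "y = cst b" by blast
  show "x + y \<in> range cst" "x * y \<in> range cst"
    unfolding a b cst.hom_add[symmetric] cst.hom_mult[symmetric] by blast+
qed

lemma coeffs_in_range_cst_iff: "coeffs_in (range cst) f \<longleftrightarrow> (\<exists>f0. f = cpoly f0)"
proof
  assume f: "coeffs_in (range cst) f"
  define g where "g = Abs_poly (\<lambda>i. inv_into UNIV cst (coeff f i))"
  have inj: "inj (cst :: 'a \<Rightarrow> 'a geo)" by (auto simp: inj_on_def)
  have "coeff g i = inv_into UNIV cst (coeff f i)" for i
    unfolding g_def
  proof (subst coeff_Abs_poly[of "degree f"])
    show "inv_into UNIV cst (coeff f i) = 0" if "degree f < i" for i
      using that inv_into_f_f[OF inj, of 0] by (simp add: coeff_eq_0)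
  qed simp
  then have "f = cpoly g"
    using f by (intro poly_eqI) (simp add: coeffs_in_def f_inv_into_f)
  then show "\<exists>f0. f = cpoly f0" by blast
qed (auto simp: coeffs_in_def)

lemma constants_closure_eq:
  "constants_closure = {x :: 'k::field geo. \<exists>f. coeffs_in (range cst) f \<and> f \<noteq> 0 \<and> poly f x = 0}"
  unfolding constants_closure_def coeffs_in_range_cst_iff cpoly_def[symmetric] by auto

lemma constants_closure_subfield: "is_subfield (constants_closure :: 'k::field geo set)"
  unfolding constants_closure_eq by (rule algebraic_elements_subfield[OF range_cst_subfield])

lemma cst_constants_closure: "cst c \<in> constants_closure"
proof -
  have "[:- c, 1:] \<noteq> 0" "poly (cpoly [:- c, 1:]) (cst c) = 0" by (simp_all add: cst.hom_uminus)
  then show ?thesis unfolding constants_closure_def cpoly_def[symmetric] by blast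
qed

lemma constants_closure_root:
  assumes "c ^ 3 \<in> constants_closure" shows "c \<in> constants_closure"
proof -
  obtain f :: "'a poly" where f: "f \<noteq> 0" "poly (cpoly f) (c ^ 3) = 0"
    using assms unfolding constants_closure_def cpoly_def by blast
  define g where "g = f \<circ>\<^sub>p monom 1 3"
  have "cpoly (monom 1 n :: 'a poly) = monom 1 n" for n :: nat
    by (rule poly_eqI) (simp add: coeff_monom)
  then have "cpoly (h \<circ>\<^sub>p monom 1 3) = cpoly h \<circ>\<^sub>p monom 1 3" for h :: "'a poly"
    by (induction h) (simp_all add: pcompose_pCons)
  then have "poly (cpoly g) c = 0" using f(2) by (simp add: g_def poly_pcompose poly_monom)
  moreover have "g \<noteq> 0"
    unfolding g_def using f(1) pcompose_eq_0[of f "monom 1 3"] by (auto simp: degree_monom_eq)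
  ultimately show ?thesis unfolding constants_closure_def cpoly_def by blast
qed

section \<open>Powers of an element and finite dimension\<close>

lemma combine_powers:
  fixes z :: "'a::field"
  shows "ring.combine ring_of_type_algebra Ks (map (\<lambda>i. z ^ (m + i)) [0..<n]) = z ^ m * poly (Poly (take n Ks)) z"
proof (induction n arbitrary: m Ks)
  case 0
  then show ?case by (cases Ks) (simp_all add: ring.combine.simps[OF \<Omega>_ring])
next
  case (Suc n)
  show ?case
  proof (cases Ks)
    case Nil
    then show ?thesis by (simp add: ring.combine.simps[OF \<Omega>_ring])
  next
    case (Cons k Ks')
    have "map (\<lambda>i. z ^ (m + i)) [0..<Suc n] = z ^ m # map (\<lambda>i. z ^ (Suc m + i)) [0..<n]"
      by (simp add: map_Suc_upt[symmetric] upt_conv_Cons comp_def del: upt_Suc)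
    then show ?thesis using Suc.IH[of Ks' "Suc m"] Cons
      by (simp add: ring.combine.simps[OF \<Omega>_ring] algebra_simps del: upt_Suc)
  qed
qed

lemma powers_independent:
  fixes z :: "'a::Fields.field"
  assumes K: "is_subfield K"
    and min: "\<And>f. coeffs_in K f \<Longrightarrow> f \<noteq> 0 \<Longrightarrow> poly f z = 0 \<Longrightarrow> degree f \<ge> n"
  shows "ring.independent ring_of_type_algebra K (map (\<lambda>i. z ^ i) [0..<n])"
proof -
  have K': "subfield K (ring_of_type_algebra :: 'a ring)" using K by (simp add: subfield_iff_is_subfield)
  show ?thesis
  proof (rule ring.trivial_combine_imp_independent[OF \<Omega>_ring K'])
    fix Ks :: "'a list"
    assume Ks: "set Ks \<subseteq> K"
      "ring.combine ring_of_type_algebra Ks (map (\<lambda>i. z ^ i) [0..<n]) = \<zero>\<^bsub>ring_of_type_algebra\<^esub>"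
    define f where "f = Poly (take n Ks)"
    have "poly f z = 0" using combine_powers[of Ks z 0 n] Ks(2) by (simp add: f_def)
    moreover have "coeffs_in K f"
    proof -
      have "nth_default 0 (take n Ks) i \<in> K" for i
        using Ks(1) subfield_0[OF K] by (auto simp: nth_default_def)
      then show ?thesis by (simp add: f_def coeffs_in_def)
    qed
    moreover have "degree f < n \<or> f = 0"
    proof (cases "n = 0")
      case False
      have "coeff f i = 0" if "i \<ge> n" for i using that by (simp add: f_def nth_default_def)
      then show ?thesis by (metis leading_coeff_0_iff not_le)
    qed (simp add: f_def)
    ultimately have "f = 0" using min[of f] by (cases "f = 0") auto
    then have "nth_default 0 (take n Ks) i = 0" for i by (metis coeff_0 coeff_Poly_eq f_def)
    then have "\<forall>i<length (take n Ks). take n Ks ! i = 0" by (metis nth_default_def)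
    then show "set (take (length (map (\<lambda>i. z ^ i) [0..<n])) Ks) \<subseteq> {\<zero>\<^bsub>ring_of_type_algebra\<^esub>}"
      by (auto simp: in_set_conv_nth)
  qed simp
qed

lemma dimension_relation:
  fixes z :: "'a::Fields.field"
  assumes K: "is_subfield K" and dim: "ring.dimension ring_of_type_algebra n K L"
    and L: "is_subfield L" and z: "z \<in> L"
  shows "\<exists>f. coeffs_in K f \<and> f \<noteq> 0 \<and> degree f \<le> n \<and> poly f z = 0"
proof (rule ccontr)
  assume "\<not> ?thesis"
  then have "ring.independent ring_of_type_algebra K (map (\<lambda>i. z ^ i) [0..<Suc n])"
    by (intro powers_independent[OF K]) (metis not_less_eq_eq)
  moreover have K': "subfield K (ring_of_type_algebra :: 'a ring)" using K by (simp add: subfield_iff_is_subfield)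
  moreover have "set (map (\<lambda>i. z ^ i) [0..<Suc n]) \<subseteq> L" using subfield_power[OF L z] by auto
  ultimately have "length (map (\<lambda>i. z ^ i) [0..<Suc n]) \<le> n"
    using ring.independent_length_le_dimension[OF \<Omega>_ring K' dim] by blast
  then show False by simp
qed

lemma dimension_3_adjoin:
  fixes z :: "'a::Fields.field"
  assumes K: "is_subfield K" and dim: "ring.dimension ring_of_type_algebra 3 K L"
    and L: "is_subfield L" and z: "z \<in> L"
    and min: "\<And>f. coeffs_in K f \<Longrightarrow> f \<noteq> 0 \<Longrightarrow> poly f z = 0 \<Longrightarrow> degree f \<ge> 3"
  shows "L \<subseteq> adjoin K z"
proof
  fix x assume x: "x \<in> L"
  let ?U = "map (\<lambda>i. z ^ i) [0..<3]"
  have K': "subfield K (ring_of_type_algebra :: 'a ring)" using K by (simp add: subfield_iff_is_subfield)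
  have "set ?U \<subseteq> L" using subfield_power[OF L z] by auto
  then have "ring.Span ring_of_type_algebra K ?U = L"
    using ring.independent_length_eq_dimension[OF \<Omega>_ring K' dim powers_independent[OF K min]] by simp
  then obtain Ks where Ks: "set Ks \<subseteq> K" "x = ring.combine ring_of_type_algebra Ks ?U"
    using ring.Span_eq_combine_set[OF \<Omega>_ring K', of ?U] x by auto
  then have "x = poly (Poly (take 3 Ks)) z" using combine_powers[of Ks z 0 3] by simp
  moreover have "nth_default 0 (take 3 Ks) i \<in> K" for i
    using Ks(1) subfield_0[OF K] by (auto simp: nth_default_def)
  then have "coeffs_in K (Poly (take 3 Ks))" by (simp add: coeffs_in_def)
  ultimately show "x \<in> adjoin K z" unfolding adjoin_def[OF K] by blast
qed

section \<open>The coordinate t and the function field of the line\<close>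

lemma poly_cpoly_tt: "poly (cpoly f) tt = to_ac (Fract f 1)"
proof (induction f)
  case 0
  then show ?case by (simp add: Zero_fract_def[symmetric])
next
  case (pCons a f)
  have "to_ac (Fract (pCons a f) 1) = cst a + tt * to_ac (Fract f 1)"
    unfolding cst_def tt_def to_ac_mult[symmetric] to_ac_add[symmetric] by simp
  then show ?case using pCons.IH by simp
qed

lemma tt_transcendental: "poly (cpoly f) tt = 0 \<Longrightarrow> f = (0 :: 'k::field poly)"
  unfolding poly_cpoly_tt by (simp add: Zero_fract_def eq_fract)

lemma tt_not_constant: "tt \<notin> (constants_closure :: 'k::field geo set)"
  unfolding constants_closure_def using tt_transcendental by (auto simp: cpoly_def)

text \<open>In a valuation ring over k where t is a nonunit, nonzero algebraic constants are units
  by \<open>power_associate\<close>. The constant coefficient of a relation is a multiple of t,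
  hence a nonunit, hence zero; then t cancels.\<close>

lemma tt_transcendental_constants_closure:
  fixes f :: "'k::field geo poly"
  assumes "coeffs_in constants_closure f" "poly f tt = 0"
  shows "f = 0"
proof -
  have U: "is_subfield (UNIV :: 'k geo set)" by (auto simp: is_subfield_def)
  obtain V :: "'k geo set" where RV: "range cst \<subseteq> V" "maximal_subring UNIV V tt"
    using exists_valuation_ring[OF U _ _ tt_not_constant] by blast
  interpret maximal_subring UNIV V tt by fact
  have cu: "cst c \<in> units" if "c \<noteq> 0" for c
    using RV(1) that unfolding units_def by (auto simp flip: cst.hom_inverse)
  have unit: "c \<in> units" if c: "c \<in> constants_closure" "c \<noteq> 0" for c
  proof -
    obtain g where g: "coeffs_in (range cst) g" "g \<noteq> 0" "poly g c = 0" using c unfolding constants_closure_eq by blast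
    obtain j b where jb: "1 \<le> j" "b \<in> range cst" "b \<noteq> 0" "c ^ j * b \<in> units"
      using power_associate[OF range_cst_subfield _ _ c(2) g] by auto
    have "b \<in> units" using jb cu by auto
    then have "c ^ j * b * inverse b \<in> units" using jb units_mult units_inverse by blast
    then have cj: "c ^ j \<in> units" using jb(3) by (simp add: mult.assoc)
    have "c \<in> V \<or> inverse c \<in> V" using valuation_ring c(2) by simp
    then show ?thesis
    proof
      assume "c \<in> V" then show ?thesis using unit_of_power[OF _ cj] jb(1) by simp
    next
      assume i: "inverse c \<in> V"
      have "inverse c ^ j \<in> units" using units_inverse[OF cj] by (simp add: power_inverse)
      then have "inverse c \<in> units" using unit_of_power[OF i] jb(1) by simp
      then show ?thesis using units_inverse[of "inverse c"] by simp
    qed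
  qed
  show ?thesis
    using assms
  proof (induction f)
    case (pCons a f)
    have a: "a \<in> constants_closure" "coeffs_in constants_closure f"
      using pCons.prems(1) coeffs_in_subfield_pCons[OF constants_closure_subfield] by auto
    have "0 \<in> V" using subring_0[OF V] .
    then have "coeff f i \<in> V" for i
      using a(2) unit[of "coeff f i"] by (cases "coeff f i = 0") (auto simp: coeffs_in_def units_def)
    then have fV: "poly f tt \<in> V" by (intro poly_in_subring[OF V _ xV]) (simp add: coeffs_in_def)
    have e: "a = - poly f tt * tt" using pCons.prems(2) by (simp add: eq_neg_iff_add_eq_0 mult.commute)
    have "a \<notin> units" unfolding e
      by (intro nonunits_mult subring_uminus[OF V fV] xV x_nonunit)
    then have a0: "a = 0" using unit a by blast
    then have "poly f tt = 0" using pCons.prems(2) tt_nonzero by auto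
    then show ?case using pCons.IH a a0 by simp
  qed simp
qed

definition "rational_functions C s = {poly f s / poly g s | f g. coeffs_in C f \<and> coeffs_in C g \<and> poly g s \<noteq> 0}"

lemma rational_functions_eq_gen_field:
  fixes C :: "'a::Fields.field set"
  assumes C: "is_subfield C"
  shows "gen_field (insert s C) = rational_functions C s"
proof
  have R: "is_subring C" by (rule is_subfield_imp_subring[OF C])
  have mem: "x \<in> rational_functions C s" if "coeffs_in C f" "coeffs_in C g" "poly g s \<noteq> 0" "x = poly f s / poly g s"
    for x f g using that unfolding rational_functions_def by blast
  have "is_subfield (rational_functions C s)"
  proof (rule is_subfieldI)
    show "0 \<in> rational_functions C s"
      by (rule mem[of 0 1]) (simp_all add: coeffs_in_0[OF R] coeffs_in_1[OF R])
    show "1 \<in> rational_functions C s"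
      by (rule mem[of 1 1]) (simp_all add: coeffs_in_1[OF R])
    fix x assume "x \<in> rational_functions C s"
    then obtain f g where fg: "coeffs_in C f" "coeffs_in C g" "poly g s \<noteq> 0" "x = poly f s / poly g s"
      unfolding rational_functions_def by blast
    show "- x \<in> rational_functions C s"
      by (rule mem[of "- f" g]) (use fg coeffs_in_uminus[OF R] in auto)
    show "inverse x \<in> rational_functions C s" if "x \<noteq> 0"
      by (rule mem[of g f]) (use fg that in auto)
    fix y assume "y \<in> rational_functions C s"
    then obtain h k where hk: "coeffs_in C h" "coeffs_in C k" "poly k s \<noteq> 0" "y = poly h s / poly k s"
      unfolding rational_functions_def by blast
    show "x + y \<in> rational_functions C s"
      by (rule mem[of "f * k + h * g" "g * k"])
        (use fg hk coeffs_in_mult[OF R] coeffs_in_add[OF R] in \<open>auto simp: add_frac_eq\<close>)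
    show "x * y \<in> rational_functions C s"
      by (rule mem[of "f * h" "g * k"]) (use fg hk coeffs_in_mult[OF R] in auto)
  qed
  moreover have "insert s C \<subseteq> rational_functions C s"
  proof
    fix x assume "x \<in> insert s C"
    then consider "x = s" | "x \<in> C" by blast
    then show "x \<in> rational_functions C s"
    proof cases
      case 1
      then show ?thesis
        by (intro mem[of "[:0, 1:]" 1]) (simp_all add: coeffs_in_pCons[OF R] coeffs_in_0[OF R] coeffs_in_1[OF R] subring_0[OF R] subring_1[OF R])
    next
      case 2
      then show ?thesis
        by (intro mem[of "[:x:]" 1]) (simp_all add: coeffs_in_pCons[OF R] coeffs_in_0[OF R] coeffs_in_1[OF R])
    qed
  qed
  ultimately show "gen_field (insert s C) \<subseteq> rational_functions C s" by (rule gen_field_min)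
  have G: "is_subfield (gen_field (insert s C))" by (rule gen_field_is_subfield)
  have "C \<subseteq> gen_field (insert s C)" "s \<in> gen_field (insert s C)" using gen_field_incl by blast+
  then show "rational_functions C s \<subseteq> gen_field (insert s C)"
    unfolding rational_functions_def using poly_in_subfield[OF C G] subfield_divide[OF G] by auto
qed

lemma gen_field_inverse: "gen_field (insert (inverse s) C) = gen_field (insert s C)"
proof -
  have *: "gen_field (insert (inverse s) C) \<subseteq> gen_field (insert s C)" for s :: 'a
    using gen_field_incl[of "insert s C"] subfield_inverse[OF gen_field_is_subfield, of s "insert s C"]
    by (intro gen_field_min gen_field_is_subfield) auto
  show ?thesis using *[of s] *[of "inverse s"] by auto
qed

lemma line_field_subfield: "is_subfield (line_field :: 'k::field geo set)"
  unfolding line_field_def by (rule gen_field_is_subfield)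

lemma tt_line_field: "tt \<in> line_field" and cst_line_field: "cst c \<in> line_field"
  unfolding line_field_def using gen_field_incl[of "insert tt (range cst)"] by auto

lemma line_field_fraction:
  assumes s: "s = tt \<or> s = inverse tt" and z: "z \<in> line_field"
  shows "\<exists>f g. z = poly (cpoly f) s / poly (cpoly g) s \<and> poly (cpoly g) s \<noteq> 0"
proof -
  have "line_field = rational_functions (range cst) s"
    using s rational_functions_eq_gen_field[OF range_cst_subfield, of s] gen_field_inverse[of tt "range cst"]
    unfolding line_field_def by auto
  then obtain f g where "coeffs_in (range cst) f" "coeffs_in (range cst) g" "poly g s \<noteq> 0"
      "z = poly f s / poly g s"
    using z unfolding rational_functions_def by blast
  then show ?thesis unfolding coeffs_in_range_cst_iff by blast
qed

lemma poly_line_field: "s = tt \<or> s = inverse tt \<Longrightarrow> poly (cpoly f) s \<in> line_field"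
  using tt_line_field subfield_inverse[OF line_field_subfield tt_line_field] cst_line_field
  by (intro poly_in_subring[OF is_subfield_imp_subring[OF line_field_subfield]]) (auto simp: coeffs_in_def)

text \<open>Equal annihilators make the assignment of f(w') to f(w) well defined and injective;
  \<open>r\<close> merely chooses a polynomial f for each element.\<close>

lemma adjoin_isomorphic:
  fixes w w' :: "'k::field geo"
  assumes same: "\<And>f. coeffs_in line_field f \<Longrightarrow> poly f w = 0 \<longleftrightarrow> poly f w' = 0"
  shows "equivalent_covers (adjoin line_field w) (adjoin line_field w')"
proof -
  let ?F = "line_field :: 'k geo set"
  have R: "is_subring ?F" by (rule is_subfield_imp_subring[OF line_field_subfield])
  have eq: "poly f w = poly g w \<longleftrightarrow> poly f w' = poly g w'" if "coeffs_in ?F f" "coeffs_in ?F g" for f g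
    using same[OF coeffs_in_diff[OF R that]] by simp
  define r where "r x = (SOME f. coeffs_in ?F f \<and> x = poly f w)" for x
  define h where "h x = poly (r x) w'" for x
  have r: "coeffs_in ?F (r x) \<and> x = poly (r x) w" if "x \<in> adjoin ?F w" for x
    unfolding r_def by (rule someI_ex) (use that in \<open>auto simp: adjoin_def[OF line_field_subfield]\<close>)
  have h: "h (poly f w) = poly f w'" if f: "coeffs_in ?F f" for f
  proof -
    have "poly f w \<in> adjoin ?F w" using f unfolding adjoin_def[OF line_field_subfield] by blast
    then have r': "coeffs_in ?F (r (poly f w))" "poly f w = poly (r (poly f w)) w" using r by blast+
    then show ?thesis using eq[OF f r'(1)] unfolding h_def by simp
  qed
  have rep: "\<exists>f. coeffs_in ?F f \<and> x = poly f w" if "x \<in> adjoin ?F w" for x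
    using that unfolding adjoin_def[OF line_field_subfield] by blast
  have "h \<in> Ring.ring_hom (\<Omega>\<lparr>carrier := adjoin ?F w\<rparr>) (\<Omega>\<lparr>carrier := adjoin ?F w'\<rparr>)"
  proof (rule ring_hom_memI)
    fix x assume "x \<in> carrier (\<Omega>\<lparr>carrier := adjoin ?F w\<rparr>)"
    then obtain f where f: "coeffs_in ?F f" "x = poly f w" using rep by auto
    show "h x \<in> carrier (\<Omega>\<lparr>carrier := adjoin ?F w'\<rparr>)"
      using h[OF f(1)] f unfolding adjoin_def[OF line_field_subfield] by auto
    fix y assume "y \<in> carrier (\<Omega>\<lparr>carrier := adjoin ?F w\<rparr>)"
    then obtain g where g: "coeffs_in ?F g" "y = poly g w" using rep by auto
    show "h (x \<otimes>\<^bsub>\<Omega>\<lparr>carrier := adjoin ?F w\<rparr>\<^esub> y) = h x \<otimes>\<^bsub>\<Omega>\<lparr>carrier := adjoin ?F w'\<rparr>\<^esub> h y"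
      using h[OF coeffs_in_mult[OF R f(1) g(1)]] h[OF f(1)] h[OF g(1)] f(2) g(2) by simp
    show "h (x \<oplus>\<^bsub>\<Omega>\<lparr>carrier := adjoin ?F w\<rparr>\<^esub> y) = h x \<oplus>\<^bsub>\<Omega>\<lparr>carrier := adjoin ?F w'\<rparr>\<^esub> h y"
      using h[OF coeffs_in_add[OF R f(1) g(1)]] h[OF f(1)] h[OF g(1)] f(2) g(2) by simp
  next
    show "h \<one>\<^bsub>\<Omega>\<lparr>carrier := adjoin ?F w\<rparr>\<^esub> = \<one>\<^bsub>\<Omega>\<lparr>carrier := adjoin ?F w'\<rparr>\<^esub>"
      using h[OF coeffs_in_1[OF R]] by simp
  qed
  moreover have "bij_betw h (adjoin ?F w) (adjoin ?F w')"
    unfolding bij_betw_def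
  proof
    show "inj_on h (adjoin ?F w)"
    proof (rule inj_onI)
      fix x y assume xy: "x \<in> adjoin ?F w" "y \<in> adjoin ?F w" "h x = h y"
      obtain f where f: "coeffs_in ?F f" "x = poly f w" using rep[OF xy(1)] by blast
      obtain g where g: "coeffs_in ?F g" "y = poly g w" using rep[OF xy(2)] by blast
      show "x = y" using eq[OF f(1) g(1)] h[OF f(1)] h[OF g(1)] xy(3) f(2) g(2) by simp
    qed
    show "h ` adjoin ?F w = adjoin ?F w'"
    proof
      show "h ` adjoin ?F w \<subseteq> adjoin ?F w'"
      proof
        fix x assume "x \<in> h ` adjoin ?F w"
        then obtain f where f: "coeffs_in ?F f" "x = h (poly f w)" using rep by blast
        then show "x \<in> adjoin ?F w'" using h[OF f(1)] unfolding adjoin_def[OF line_field_subfield] by blast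
      qed
      show "adjoin ?F w' \<subseteq> h ` adjoin ?F w"
      proof
        fix x assume "x \<in> adjoin ?F w'"
        then obtain f where f: "coeffs_in ?F f" "x = poly f w'" unfolding adjoin_def[OF line_field_subfield] by blast
        then have "poly f w \<in> adjoin ?F w" unfolding adjoin_def[OF line_field_subfield] by blast
        then show "x \<in> h ` adjoin ?F w" using h[OF f(1)] f(2) by (metis imageI)
      qed
    qed
  qed
  ultimately have "h \<in> ring_iso (\<Omega>\<lparr>carrier := adjoin ?F w\<rparr>) (\<Omega>\<lparr>carrier := adjoin ?F w'\<rparr>)"
    by (simp add: ring_iso_def)
  moreover have "h a = a" if a: "a \<in> ?F" for a
  proof -
    have "coeffs_in ?F [:a:]" using a by (simp add: coeffs_in_pCons[OF R] coeffs_in_0[OF R])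
    then show ?thesis using h[of "[:a:]"] by simp
  qed
  ultimately show ?thesis unfolding equivalent_covers_def by blast
qed

section \<open>Unramified cubic radicals\<close>

context place
begin

text \<open>With \<open>B = - q - A\<close> one has \<open>A * B = - p\<^sup>3\<close>, and \<open>A\<close>, \<open>B\<close> do not both vanish at a place
  because \<open>p\<close> and \<open>q\<close> have no common zero.\<close>

lemma cardano_radicand_value:
  fixes f g :: "'k poly"
  assumes two: "(2::'k) \<noteq> 0" and s: "s \<in> int_ring"
    and coprime: "\<And>c. poly (cpoly f) c = 0 \<Longrightarrow> poly (cpoly g) c = 0 \<Longrightarrow> False"
    and p: "p = poly (cpoly f) s" and q: "q = poly (cpoly g) s"
    and \<rho>: "\<rho> \<in> K" "\<rho>^2 = q^2 + 4 * p^3" and A: "A = (\<rho> - q) / 2" "A \<noteq> 0"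
  shows "A \<in> int_ring \<and> (P A = 0 \<or> p \<in> max_ideal \<and> p \<noteq> 0 \<and> P A = 3 * P p)"
proof -
  have two': "(2::'k geo) \<noteq> 0" using two cst.hom_numeral[of "num.Bit0 num.One"] by (metis cst.hom_0_iff)
  have pq: "p \<in> int_ring" "q \<in> int_ring" unfolding p q using poly_int_ring[OF cpoly_int_ring s] by auto
  have 4: "(4::'k geo) \<in> int_ring" using int_ring_cst[of 4] by (simp add: cst.hom_numeral)
  have "\<rho>^2 \<in> int_ring"
    unfolding \<rho>(2) using pq 4 by (intro int_ring_add int_ring_mult subring_power[OF int_ring_subring])
  then have \<rho>i: "\<rho> \<in> int_ring" using max_ideal_of_power[OF \<rho>(1)] by simp
  have "cst (1 / 2) * 2 = cst (1 / 2 * 2 :: 'k)" unfolding cst.hom_mult by (simp only: cst.hom_numeral)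
  also have "\<dots> = 1" using two by simp
  finally have "cst (1 / 2) = (1 / 2 :: 'k geo)" using two' by (simp add: eq_divide_eq)
  then have "A = cst (1 / 2) * (\<rho> - q)" using A(1) by (simp only: times_divide_eq_left mult_1_left)
  then have Ai: "A \<in> int_ring"
    using int_ring_mult[OF int_ring_cst subring_diff[OF int_ring_subring \<rho>i pq(2)]] by simp
  define B where "B = - q - A"
  have Bi: "B \<in> int_ring" unfolding B_def using Ai pq subring_uminus[OF int_ring_subring] subring_diff[OF int_ring_subring] by blast
  have "2 * A = \<rho> - q" using A(1) two' by (simp add: mult.commute)
  then have "4 * (A * B) = 4 * - (p^3)" unfolding B_def using \<rho>(2) by Groebner_Basis.algebra
  moreover have "(4::'k geo) \<noteq> 0" using two' by (metis mult_2 mult_eq_0_iff numeral_Bit0)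
  ultimately have AB: "A * B = - (p^3)" by (simp only: mult_cancel_left simp_thms)
  have "P A = 0 \<or> p \<in> max_ideal \<and> p \<noteq> 0 \<and> P A = 3 * P p"
  proof (cases "A \<in> max_ideal")
    case False
    then show ?thesis using int_ring_unit[OF Ai] by simp
  next
    case True
    have "B * A \<in> max_ideal" by (rule max_ideal_mult[OF Bi True])
    then have "- (A * B) \<in> max_ideal" by (simp add: max_ideal_uminus mult.commute)
    then have "p ^ 3 \<in> max_ideal" unfolding AB by simp
    then have pm: "p \<in> max_ideal" by (rule max_ideal_power[OF pq(1)])
    have Bm: "B \<notin> max_ideal"
    proof
      assume "B \<in> max_ideal"
      then have "- (A + B) \<in> max_ideal" using True by (intro max_ideal_uminus max_ideal_add)
      then have "q \<in> max_ideal" by (simp add: B_def)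
      then have "f \<in> zero_ideal s" "g \<in> zero_ideal s" using pm zero_ideal_iff[OF s] p q by auto
      moreover obtain c where "\<forall>h. h \<in> zero_ideal s \<longleftrightarrow> poly (cpoly h) c = 0" using specialization[OF s] by blast
      ultimately show False using coprime by blast
    qed
    have B0: "B \<noteq> 0" "P B = 0" using int_ring_unit[OF Bi Bm] by auto
    then have p0: "p \<noteq> 0" using AB A(2) by auto
    have "P (A * B) = P A" using P_mult[of A B] Ai Bi int_ring_subset B0 A(2) by auto
    moreover have "P (p^3) = 3 * P p" using P_power[of p 3] pq int_ring_subset p0 by auto
    ultimately show ?thesis using AB pm p0 by simp
  qed
  then show ?thesis using Ai by blast
qed

end

text \<open>As c has a third of the value of a^3, the generator a/c is a cube root of a unit. The
  derivative 3 (a/c)^2 is then a unit too, and \<open>etale_value_group\<close> applies.\<close>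

lemma cube_root_value_group:
  fixes L F :: "'k::field geo set"
  assumes "place L Q" and F: "is_subfield F" "F \<subseteq> L" and three: "(3::'k) \<noteq> 0"
    and a: "a \<in> L" "a \<noteq> 0" "L = adjoin F a" "a ^ 3 \<in> F" and c: "c \<in> F" "c \<noteq> 0" "Q (a ^ 3) = 3 * Q c"
  shows "\<exists>x\<in>F. Q x = 1"
proof -
  interpret place L Q by fact
  have R: "is_subring F" by (rule is_subfield_imp_subring[OF F(1)])
  have cL: "c \<in> L" using c F by auto
  define \<theta> where "\<theta> = a / c"
  define A where "A = a ^ 3 / c ^ 3"
  define g where "g = [:- A, 0, 0, 1:]"
  have \<theta>: "\<theta> \<in> L" "\<theta> \<noteq> 0" using a c cL subfield_divide[OF K] by (auto simp: \<theta>_def)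
  have Q\<theta>: "Q \<theta> = 0" using P_divide[OF a(1) cL a(2) c(2)] P_power[OF a(1,2), of 3] c(3) by (simp add: \<theta>_def)
  have AF: "A \<in> F" unfolding A_def using a(4) c(1) subfield_divide[OF F(1)] subfield_power[OF F(1)] by blast
  have A\<theta>: "A = \<theta> ^ 3" by (simp add: A_def \<theta>_def power_divide)
  have QA: "Q A = 0" unfolding A\<theta> using P_power[OF \<theta>, of 3] Q\<theta> by simp
  have gF: "coeffs_in F g" unfolding g_def
    using AF by (simp add: coeffs_in_pCons[OF R] coeffs_in_0[OF R] subring_0[OF R] subring_1[OF R] subring_uminus[OF R])
  have g\<theta>: "poly g \<theta> = 0" by (simp add: g_def A\<theta> power3_eq_cube algebra_simps)
  have g0: "g \<noteq> 0" by (simp add: g_def)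
  have sub: "is_subfield (adjoin F \<theta>)" by (rule adjoin_is_subfield[OF F(1) gF g0 g\<theta>])
  have "a = c * \<theta>" using c(2) by (simp add: \<theta>_def)
  then have "a \<in> adjoin F \<theta>" using subfield_mult[OF sub] adjoin_incl[OF F(1), of \<theta>] adjoin_mem[OF F(1), of \<theta>] c(1) by auto
  then have "adjoin F a \<subseteq> adjoin F \<theta>" by (intro adjoin_min[OF F(1) sub] adjoin_incl[OF F(1)])
  moreover have "adjoin F \<theta> \<subseteq> L" by (intro adjoin_min[OF F(1) K] F \<theta>)
  ultimately have L\<theta>: "L = adjoin F \<theta>" using a(3) by blast
  have co: "0 \<le> Q (coeff g i)" for i
    using QA by (auto simp: g_def coeff_pCons split: nat.splits)
  have lc: "lead_coeff g = 1" by (simp add: g_def)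
  have "poly (pderiv g) \<theta> = cst 3 * \<theta> ^ 2"
    by (simp add: g_def pderiv_pCons cst.hom_numeral power2_eq_square algebra_simps)
  moreover have "cst (3::'k) \<noteq> 0" using three by simp
  then have "Q (cst 3 * \<theta> ^ 2) = 0" using P_mult[of "cst 3" "\<theta>^2"] cst_in \<theta> subfield_power[OF K] P_power[OF \<theta>, of 2] Q\<theta> by simp
  ultimately have der: "\<not> vanishes Q (poly (pderiv g) \<theta>)" using \<open>cst (3::'k) \<noteq> 0\<close> \<theta>(2) by (simp add: vanishes_def)
  show ?thesis
    using etale_value_group[OF \<open>place L Q\<close> F \<theta>(1) _ L\<theta> gF co lc g\<theta> der] Q\<theta> by simp
qed

text \<open>Guarantees that the minimum in \<open>ram_index\<close> is taken over a nonempty set. If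
  Q were trivial on F, a relation for an element of value 1 would have a constant coefficient
  vanishing at Q, hence zero, and so on for all coefficients.\<close>

lemma place_nontrivial_below:
  assumes "place L Q" and F: "is_subfield F" "F \<subseteq> L"
    and alg: "\<And>z. z \<in> L \<Longrightarrow> \<exists>f. coeffs_in F f \<and> f \<noteq> 0 \<and> poly f z = 0"
  shows "\<exists>e>0. \<exists>x\<in>F. Q x = int e"
proof (rule ccontr)
  assume n: "\<not> ?thesis"
  interpret place L Q by fact
  have le: "Q x \<le> 0" if "x \<in> F" for x
  proof (rule ccontr)
    assume "\<not> Q x \<le> 0"
    then have "nat (Q x) > 0" "Q x = int (nat (Q x))" by auto
    then show False using n that by blast
  qed
  have triv: "Q x = 0" if x: "x \<in> F" for x
    using le[OF x] le[OF subfield_inverse[OF F(1) x]] P_inverse[of x] F(2) x by auto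
  obtain z where z: "z \<in> L" "Q z = 1" using P_attains_1 by blast
  have zm: "z \<in> max_ideal" using z by (simp add: max_ideal_def vanishes_def)
  have z0: "z \<noteq> 0" using z by auto
  have Fint: "x \<in> int_ring" if "x \<in> F" for x using triv[OF that] F(2) that by (auto simp: int_ring_def)
  have "f = 0" if "coeffs_in F f" "poly f z = 0" for f
    using that
  proof (induction f)
    case (pCons b f)
    have b: "b \<in> F" "coeffs_in F f" using pCons.prems(1) coeffs_in_subfield_pCons[OF F(1)] by auto
    have "poly f z \<in> int_ring"
      using b(2) Fint max_ideal_subset zm by (intro poly_int_ring) (auto simp: coeffs_in_def)
    then have "- poly f z * z \<in> max_ideal"
      by (intro max_ideal_mult zm subring_uminus[OF int_ring_subring])
    moreover have "b = - poly f z * z" using pCons.prems(2) by (simp add: eq_neg_iff_add_eq_0 mult.commute)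
    ultimately have "b \<in> max_ideal" by simp
    then have b0: "b = 0" using triv[OF b(1)] by (auto simp: max_ideal_def vanishes_def)
    then show ?case using pCons b z0 by simp
  qed simp
  then show False using alg[OF z(1)] by blast
qed

lemma restrict_place:
  assumes "place L Q" and F: "is_subfield F" "F \<subseteq> L" "range cst \<subseteq> F" and one: "\<exists>x\<in>F. Q x = 1"
  shows "ram_index F Q = 1" "place_below F Q = (\<lambda>x. if x \<in> F then Q x else 0)" "place_below F Q \<in> places F"
proof -
  interpret place L Q by fact
  show r: "ram_index F Q = 1"
    unfolding ram_index_def using one by (intro Least_equality) (auto simp: Suc_le_eq)
  show pb: "place_below F Q = (\<lambda>x. if x \<in> F then Q x else 0)"
    by (rule ext) (simp add: place_below_def r[unfolded One_nat_def])
  have FL: "x \<in> L" if "x \<in> F" for x using F that by auto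
  show "place_below F Q \<in> places F"
    unfolding pb places_def
    using one P_mult P_add FL F(3) subfield_mult[OF F(1)] subfield_add[OF F(1)] by auto
qed

context burkhardt_point
begin

text \<open>The binary cubic q has a zero, possibly at infinity; if p vanished identically this
  would be a common zero.\<close>

lemma pp_nonzero: "pp \<noteq> 0"
proof
  assume 0: "pp = 0"
  have p0: "p x z = 0" for x z
  proof -
    have "p x z = coeff pp 0 * z^2 + coeff pp 1 * x * z + coeff pp 2 * x^2"
      by (simp add: pp_def p_def b_def c_def numeral_2_eq_2 power2_eq_square algebra_simps)
    then show ?thesis by (simp add: 0)
  qed
  show False
  proof (cases "degree qp > 0")
    case True
    then obtain c where "poly qp c = 0" using alg_closed_imp_poly_has_root by blast
    then show False using p_q_no_common_zero[OF p0, of c 1] by (simp add: poly_qp)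
  next
    case False
    then have "coeff qp 3 = 0" by (intro coeff_eq_0) simp
    moreover have "coeff qp 3 = q 1 0"
      by (simp add: qp_def bp_def cp_def q_def b_def c_def d_def numeral_3_eq_3
          power2_eq_square algebra_simps)
    ultimately show False using p_q_no_common_zero[OF p0, of 1 0] by simp
  qed
qed

end

text \<open>Otherwise the simplifier rewrites \<open>\<alpha> 1\<close> to \<open>\<alpha> (Suc 0)\<close> and the definitions of the two interpreted
  locales below no longer match.\<close>

declare One_nat_def [simp del]

section \<open>A point over k and the generic cubic attached to it\<close>

locale burkhardt_quartic_point =
  fixes \<alpha> :: "nat \<Rightarrow> 'k::field"
  assumes char2: "(2::'k) \<noteq> 0" and char3: "(3::'k) \<noteq> 0"
    and \<alpha>0: "\<alpha> 0 = 1"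
    and rel_k: "1 + \<alpha> 1^3 + \<alpha> 2^3 + \<alpha> 3^3 + \<alpha> 4^3 + 3 * \<alpha> 1 * \<alpha> 2 * \<alpha> 3 * \<alpha> 4 = 0"
    and \<alpha>4: "\<alpha> 4 \<noteq> 0"
    and nz_k: "1 + \<alpha> 1^3 \<noteq> 0" "1 + \<alpha> 2^3 \<noteq> 0" "1 + \<alpha> 3^3 \<noteq> 0" "1 + \<alpha> 4^3 \<noteq> 0"
begin

lemma cst_one_plus_cube: "cst (1 + \<alpha> i ^ 3) = 1 + cst (\<alpha> i) ^ 3"
  by (simp only: cst.hom_add cst.hom_one cst.hom_power)

lemma cst_rel: "1 + cst (\<alpha> 1)^3 + cst (\<alpha> 2)^3 + cst (\<alpha> 3)^3 + cst (\<alpha> 4)^3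
    + 3 * cst (\<alpha> 1) * cst (\<alpha> 2) * cst (\<alpha> 3) * cst (\<alpha> 4) = 0"
  using arg_cong[OF rel_k, of cst]
  by (simp only: cst.hom_add cst.hom_mult cst.hom_one cst.hom_power cst.hom_numeral cst.hom_zero)

lemma cst_nonzero: "(2::'k geo) \<noteq> 0" "(3::'k geo) \<noteq> 0" "cst (\<alpha> 4) \<noteq> 0"
  "1 + cst (\<alpha> 1)^3 \<noteq> 0" "1 + cst (\<alpha> 2)^3 \<noteq> 0" "1 + cst (\<alpha> 3)^3 \<noteq> 0" "1 + cst (\<alpha> 4)^3 \<noteq> 0"
proof -
  have "cst (2::'k) \<noteq> 0" "cst (3::'k) \<noteq> 0" using char2 char3 by auto
  then show "(2::'k geo) \<noteq> 0" "(3::'k geo) \<noteq> 0" by (simp_all only: cst.hom_numeral not_False_eq_True)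
  show "cst (\<alpha> 4) \<noteq> 0" using \<alpha>4 by simp
  show "1 + cst (\<alpha> 1)^3 \<noteq> 0" "1 + cst (\<alpha> 2)^3 \<noteq> 0" "1 + cst (\<alpha> 3)^3 \<noteq> 0" "1 + cst (\<alpha> 4)^3 \<noteq> 0"
    unfolding cst_one_plus_cube[symmetric] using nz_k by simp_all
qed

end

sublocale burkhardt_quartic_point \<subseteq> BP: burkhardt_point "cst (\<alpha> 1)" "cst (\<alpha> 2)" "cst (\<alpha> 3)" "cst (\<alpha> 4)"
  using cst_rel cst_nonzero by unfold_locales

text \<open>The symmetry \<open>y\<^sub>2 \<leftrightarrow> y\<^sub>3\<close> exchanges \<open>x\<close> and \<open>z\<close>, which moves the point at infinity to \<open>0\<close>.\<close>

sublocale burkhardt_quartic_point \<subseteq> BS: burkhardt_point "cst (\<alpha> 1)" "cst (\<alpha> 3)" "cst (\<alpha> 2)" "cst (\<alpha> 4)"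
  using cst_rel cst_nonzero by unfold_locales (simp_all add: algebra_simps)

context burkhardt_quartic_point
begin

lemma swap: "BS.p z x = BP.p x z" "BS.q z x = BP.q x z"
  by (simp_all add: BS.p_def BP.p_def BS.q_def BP.q_def BS.u_def BP.u_def BS.b_def BP.b_def
      BS.c_def BP.c_def BS.d_def BP.d_def algebra_simps)

lemma homogeneous: "BP.p (k * x) (k * z) = k^2 * BP.p x z" "BP.q (k * x) (k * z) = k^3 * BP.q x z"
  unfolding BP.p_def BP.q_def BP.b_def BP.c_def BP.d_def by Groebner_Basis.algebra+

definition "pt = BP.p tt 1"
definition "qt = BP.q tt 1"
definition "cubic = [:qt, 3 * pt, 0, 1:]"

lemma poly_cubic: "poly cubic x = x^3 + 3 * pt * x + qt"
  by (simp add: cubic_def power3_eq_cube algebra_simps)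

lemma range_cst_subring: "is_subring (range (cst :: 'k \<Rightarrow> 'k geo))"
  by (rule is_subfield_imp_subring[OF range_cst_subfield])

lemma coeffs_in_range_cst:
  "coeffs_in (range cst) BP.pp" "coeffs_in (range cst) BP.qp"
  "coeffs_in (range cst) BS.pp" "coeffs_in (range cst) BS.qp"
  unfolding BP.pp_def BP.qp_def BP.bp_def BP.cp_def BP.u_def BS.pp_def BS.qp_def BS.bp_def BS.cp_def BS.u_def
  by (intro coeffs_in_add[OF range_cst_subring] coeffs_in_smult[OF range_cst_subring]
      coeffs_in_mult[OF range_cst_subring] coeffs_in_power[OF range_cst_subring]
      coeffs_in_pCons[OF range_cst_subring, THEN iffD2] conjI coeffs_in_0[OF range_cst_subring]
      subfield_intros[OF range_cst_subfield] rangeI)+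

lemma polys_over_k:
  obtains f g f' g' where "BP.pp = cpoly f" "BP.qp = cpoly g" "BS.pp = cpoly f'" "BS.qp = cpoly g'"
  using coeffs_in_range_cst unfolding coeffs_in_range_cst_iff by blast

lemma pt_eq: "pt = poly BP.pp tt" and qt_eq: "qt = poly BP.qp tt"
  by (simp_all add: pt_def qt_def BP.poly_pp BP.poly_qp)

lemma pt_qt_line_field: "pt \<in> line_field" "qt \<in> line_field"
proof -
  obtain f g f' g' where "BP.pp = cpoly f" "BP.qp = cpoly g" "BS.pp = cpoly f'" "BS.qp = cpoly g'"
    by (rule polys_over_k)
  then show "pt \<in> line_field" "qt \<in> line_field" unfolding pt_eq qt_eq using poly_line_field by auto
qed

lemma pt_nonzero: "pt \<noteq> 0"
proof
  assume "pt = 0"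
  moreover have "coeffs_in constants_closure BP.pp"
    using coeffs_in_range_cst(1) coeffs_in_mono cst_constants_closure by blast
  ultimately show False using tt_transcendental_constants_closure BP.pp_nonzero unfolding pt_eq by blast
qed

text \<open>The function field of the line over the algebraic closure of k. Irreducibility is shown
  over it because triviality of classes and equality of covers are tested up to algebraic
  constants.\<close>

definition "geometric_line_field = gen_field (insert tt (constants_closure :: 'k geo set))"

lemma geometric_line_field_subfield: "is_subfield geometric_line_field"
  unfolding geometric_line_field_def by (rule gen_field_is_subfield)

lemma line_field_subset: "line_field \<subseteq> geometric_line_field"
  unfolding geometric_line_field_def line_field_def
  by (rule gen_field_mono) (use cst_constants_closure in auto)

lemma constants_closure_subset: "constants_closure \<subseteq> geometric_line_field"
  unfolding geometric_line_field_def by (rule order_trans[OF _ gen_field_incl]) auto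

text \<open>With denominators cleared a root becomes a polynomial relation for t with algebraic
  constant coefficients. Such a relation holds identically, against
  \<open>no_rational_root\<close>.\<close>

lemma no_root_geometric_line_field:
  assumes x: "x \<in> geometric_line_field"
  shows "poly cubic x \<noteq> 0"
proof
  assume root: "poly cubic x = 0"
  let ?k = "constants_closure :: 'k geo set"
  have R: "is_subring ?k" by (rule is_subfield_imp_subring[OF constants_closure_subfield])
  obtain f h where fh: "coeffs_in ?k f" "coeffs_in ?k h" "poly h tt \<noteq> 0" "x = poly f tt / poly h tt"
    using x unfolding geometric_line_field_def rational_functions_eq_gen_field[OF constants_closure_subfield]
      rational_functions_def by blast
  have c: "coeffs_in ?k BP.pp" "coeffs_in ?k BP.qp"
    using coeffs_in_range_cst(1,2) coeffs_in_mono cst_constants_closure by blast+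
  have three: "coeffs_in ?k 3"
    using subfield_numeral[OF constants_closure_subfield, of "num.Bit1 num.One"]
    by (simp add: numeral_poly coeffs_in_pCons[OF R] coeffs_in_0[OF R])
  define Z where "Z = f^3 + 3 * BP.pp * f * h^2 + BP.qp * h^3"
  have "coeffs_in ?k Z"
    unfolding Z_def by (intro coeffs_in_add[OF R] coeffs_in_mult[OF R] coeffs_in_power[OF R] fh c three)
  moreover have "poly Z tt = poly h tt ^ 3 * poly cubic x"
    unfolding poly_cubic fh(4) Z_def pt_eq qt_eq using fh(3) by (simp add: field_simps power2_eq_square power3_eq_cube)
  then have "poly Z tt = 0" using root by simp
  ultimately have "Z = 0" by (rule tt_transcendental_constants_closure)
  moreover have "h \<noteq> 0" using fh(3) by auto
  ultimately show False using BP.no_rational_root[of f h] unfolding Z_def by blast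
qed

text \<open>Along with r + s y its conjugate would be a root. The roots have sum zero, so the third
  one is -2 r, which lies in the smaller field.\<close>

lemma no_root_quadratic_extension:
  assumes y: "y^2 \<in> geometric_line_field" and x: "x \<in> adjoin geometric_line_field y"
  shows "poly cubic x \<noteq> 0"
proof
  assume root: "poly cubic x = 0"
  let ?M = geometric_line_field
  note M = geometric_line_field_subfield
  have pq: "pt \<in> ?M" "qt \<in> ?M" using pt_qt_line_field line_field_subset by auto
  obtain r s where rs: "r \<in> ?M" "s \<in> ?M" "x = r + s * y" using x unfolding adjoin_sqrt[OF M y] by blast
  have yM: "y \<notin> ?M"
    using root rs subfield_add[OF M] subfield_mult[OF M] no_root_geometric_line_field by blast
  define Y where "Y = y^2"
  define c1 where "c1 = 3*r^2*s + s^3*Y + 3*pt*s"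
  define c0 where "c0 = r^3 + 3*r*s^2*Y + 3*pt*r + qt"
  have cM: "c0 \<in> ?M" "c1 \<in> ?M"
    unfolding c0_def c1_def Y_def by (intro subfield_intros[OF M] rs pq y)+
  have e: "c0 + c1 * y = 0"
    using root unfolding poly_cubic rs(3) c0_def c1_def Y_def by Groebner_Basis.algebra
  have c1: "c1 = 0"
  proof (rule ccontr)
    assume n: "c1 \<noteq> 0"
    have "y = - c0 / c1" using e n by (simp add: field_simps eq_neg_iff_add_eq_0 add.commute)
    moreover have "- c0 / c1 \<in> ?M" by (intro subfield_intros[OF M] cM)
    ultimately show False using yM by simp
  qed
  then have c0: "c0 = 0" using e by simp
  show False
  proof (cases "s = 0")
    case True
    then show False using root rs no_root_geometric_line_field by simp
  next
    case False
    have "s * (3*r^2 + s^2*Y + 3*pt) = 0" using c1 unfolding c1_def by Groebner_Basis.algebra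
    then have "3*r^2 + s^2*Y + 3*pt = 0" using False by simp
    then have "poly cubic (- 2 * r) = 0" using c0 unfolding poly_cubic c0_def by Groebner_Basis.algebra
    moreover have "- 2 * r \<in> ?M" by (intro subfield_mult[OF M] subfield_uminus[OF M] subfield_numeral[OF M] rs)
    ultimately show False using no_root_geometric_line_field by blast
  qed
qed

lemma cubic_line_field: "coeffs_in line_field cubic" "degree cubic = 3"
  by (simp_all add: cubic_def pt_qt_line_field subfield_mult[OF line_field_subfield]
      subfield_numeral[OF line_field_subfield] subfield_0[OF line_field_subfield] subfield_1[OF line_field_subfield]
      coeffs_in_subfield_pCons[OF line_field_subfield] coeffs_in_subfield_0[OF line_field_subfield])

lemma cubic_minimal:
  assumes "poly cubic w = 0" "coeffs_in line_field f" "f \<noteq> 0" "poly f w = 0"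
  shows "degree f \<ge> 3"
  using rootless_cubic_minimal[OF line_field_subfield cubic_line_field assms(1) _ assms(2-)]
    no_root_geometric_line_field line_field_subset by blast

text \<open>By minimality every annihilator of a root is a multiple of the cubic, hence kills all
  its roots.\<close>

lemma cubic_roots_equivalent:
  assumes w: "poly cubic w = 0" and w': "poly cubic w' = 0"
  shows "equivalent_covers (adjoin line_field w) (adjoin line_field w')"
proof (rule adjoin_isomorphic)
  fix f :: "'k geo poly" assume f: "coeffs_in line_field f"
  have *: "poly f b = 0" if a: "poly cubic a = 0" "poly f a = 0" and b: "poly cubic b = 0" for a b
  proof -
    have c0: "cubic \<noteq> 0" using cubic_line_field(2) by auto
    obtain g r where gr: "coeffs_in line_field g" "coeffs_in line_field r" "f = g * cubic + r" "r = 0 \<or> degree r < 3"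
      using coeffs_in_subfield_division[OF line_field_subfield f cubic_line_field(1) c0]
      unfolding cubic_line_field(2) by blast
    have "poly r a = 0" using a unfolding gr(3) by simp
    then have "r = 0" using cubic_minimal[OF a(1) gr(2)] gr(4) by fastforce
    then show ?thesis using b gr(3) by simp
  qed
  show "poly f w = 0 \<longleftrightarrow> poly f w' = 0" using *[OF w _ w'] *[OF w' _ w] by blast
qed

lemma cubic_ext_degree:
  assumes w: "poly cubic w = 0"
  shows "ext_degree line_field (adjoin line_field w) 3"
  using ext_degree_3(1)[OF line_field_subfield cubic_line_field w cubic_minimal[OF w]] .

lemma cubic_gen_field:
  assumes "poly cubic w = 0"
  shows "gen_field (insert w line_field) = adjoin line_field w"
  using gen_field_insert[OF line_field_subfield cubic_line_field(1) _ assms] cubic_line_field(2) by fastforce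

end

section \<open>Function fields of the cubic and of the equation\<close>

context burkhardt_quartic_point
begin

lemma at_generic_H1: "at_generic (H1 \<alpha>) = - (BP.v * pt)"
proof -
  let ?a = "cst (\<alpha> 1)" and ?b = "cst (\<alpha> 2)" and ?c = "cst (\<alpha> 3)" and ?d = "cst (\<alpha> 4)"
  \<comment> \<open>The factors \<open>1\<close> stand for z and keep the shape of
    \<open>burkhardt_H1\<close>.\<close>
  have "at_generic (H1 \<alpha>) = (?a^3*?c*?d^3 + ?a^2*?b^2*?d^5 + ?a^2*?b^2*?d^2 + 2*?a*?b*?c^2*?d^4
      - ?a*?b*?c^2*?d - ?b^3*?c + ?c^4*?d^3) * tt^2
    + (?a^4*?d^4 + 2*?a^2*?b*?c*?d^5 - ?a^2*?b*?c*?d^2 + 2*?a*?b^3*?d^4 + ?a*?b^3*?d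
      + 2*?a*?c^3*?d^4 + ?a*?c^3*?d + 2*?b^2*?c^2*?d^3 + 2*?b^2*?c^2) * tt * 1
    + (?a^3*?b*?d^3 + ?a^2*?c^2*?d^5 + ?a^2*?c^2*?d^2 + 2*?a*?b^2*?c*?d^4
      - ?a*?b^2*?c*?d + ?b^4*?d^3 - ?b*?c^3) * 1^2"
    by (simp only: H1_def at_generic_simps cst.hom_add cst.hom_mult cst.hom_minus cst.hom_power cst.hom_numeral)
  also have "\<dots> = BP.v * (BP.b tt 1 ^ 2 + BP.u * BP.c tt 1)"
    unfolding burkhardt_H1[OF cst_rel] BP.v_def BP.u_def BP.b_def BP.c_def by simp
  also have "\<dots> = - (BP.v * pt)" by (simp add: pt_def BP.p_def algebra_simps)
  finally show ?thesis .
qed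

lemma at_generic_F: "at_generic (F_sextic \<alpha>) = (BP.v / BP.u)^2 * (qt^2 + 4 * pt^3)"
proof -
  let ?a1 = "cst (\<alpha> 1)" and ?a2 = "cst (\<alpha> 2)" and ?a3 = "cst (\<alpha> 3)" and ?a4 = "cst (\<alpha> 4)"
  define a where "a = ?a2^3 + ?a3^3 + ?a4^3 + 3*?a1*?a2*?a3*?a4"
  have "at_generic (F_sextic \<alpha>) =
    ((?a1^3*?a4^3 + 3*?a1*?a2*?a3*?a4^4 + 2*?a2^3*?a4^3 + ?a2^3 + ?a3^3*?a4^3) * tt^3
      + (3*?a2*(?a4^3 + 1)*(?a1^2*?a4^2 - ?a2*?a3)) * tt^2 * 1
      - (3*?a3*(?a4^3 + 1)*(?a1^2*?a4^2 - ?a2*?a3)) * tt * 1^2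
      + (-2*?a1^3*?a4^6 - ?a1^3*?a4^3 + 3*?a1*?a2*?a3*?a4^4 + ?a2^3*?a4^3 - ?a3^3) * 1^3)^2
    + 4 * (?a4^3*(?a4^3 + 1)*(?a1^3*?a4^3 - 3*?a1*?a2*?a3*?a4 - ?a2^3 - ?a3^3))
      * (?a2*tt^2 - ?a3*tt*1 - ?a1*?a4*1^2)^3"
    by (simp only: F_sextic_def G3_def H3_def lambda3_def N_of_def at_generic_simps cst.hom_add
        cst.hom_mult cst.hom_minus cst.hom_uminus cst.hom_power cst.hom_numeral cst.hom_one)
  also have "\<dots> = BP.v^2 * (a^2 * BP.d tt 1^2 - 6*a*BP.b tt 1*BP.c tt 1*BP.d tt 1 + 4*a*BP.c tt 1^3
      + 4*BP.b tt 1^3*BP.d tt 1 - 3*BP.b tt 1^2*BP.c tt 1^2)"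
    unfolding burkhardt_F[OF cst_rel] BP.v_def BP.b_def BP.c_def BP.d_def a_def by simp
  also have "a = - BP.u"
    using cst_rel unfolding a_def BP.u_def by (simp add: eq_neg_iff_add_eq_0 algebra_simps)
  finally have "BP.u^2 * at_generic (F_sextic \<alpha>) = BP.v^2 * (qt^2 + 4 * pt^3)"
    unfolding pt_def qt_def BP.p_def BP.q_def by Groebner_Basis.algebra
  then show ?thesis using BP.u_nz by (simp add: power_divide field_simps)
qed

lemma cst_lambda1: "cst (lambda1 \<alpha>) * BP.u^2 * BP.v = - 1"
proof -
  have "cst (lambda1 \<alpha> * (1 + \<alpha> 1 ^ 3) ^ 2 * (1 + \<alpha> 4 ^ 3)) = cst (- 1)"
    by (simp only: lambda1_mult[OF rel_k nz_k(1) nz_k(4)])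
  then show ?thesis
    by (simp only: BP.u_def BP.v_def cst.hom_mult cst.hom_add cst.hom_power cst.hom_one cst.hom_uminus)
qed

text \<open>G1 is known through its square only, so a sign is carried along.\<close>

lemma at_generic_G1:
  assumes "is_G1 \<alpha> G1"
  obtains \<epsilon> where "\<epsilon> ^ 2 = 1" "BP.u * at_generic G1 = \<epsilon> * BP.v * qt"
proof -
  have "at_generic (G1 ^ 2) = at_generic (F_sextic \<alpha> - 4 * Const (lambda1 \<alpha>) * H1 \<alpha> ^ 3)"
    using assms by (simp only: is_G1_def)
  then have "at_generic G1 ^ 2 = at_generic (F_sextic \<alpha>) - 4 * cst (lambda1 \<alpha>) * at_generic (H1 \<alpha>) ^ 3"
    by (simp only: at_generic_simps)
  moreover have "BP.u^2 * at_generic (F_sextic \<alpha>) = BP.v^2 * (qt^2 + 4 * pt^3)"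
    unfolding at_generic_F using BP.u_nz by (simp add: power_divide)
  ultimately have "(BP.u * at_generic G1)^2 = (BP.v * qt)^2"
    using cst_lambda1 unfolding at_generic_H1 by Groebner_Basis.algebra
  then have "BP.u * at_generic G1 = BP.v * qt \<or> BP.u * at_generic G1 = - (BP.v * qt)"
    by (simp add: power2_eq_iff)
  then show ?thesis using that[of 1] that[of "- 1"] by auto
qed

lemma constants_line_field: "BP.u \<in> line_field" "BP.v \<in> line_field" "BP.b tt 1 \<in> line_field"
  unfolding BP.u_def BP.v_def BP.b_def
  by (intro subfield_intros[OF line_field_subfield] tt_line_field cst_line_field)+

lemma gen_field_linear_change:
  assumes "is_subfield K" "r \<in> K" "s \<in> K" "s \<noteq> 0"
  shows "gen_field (insert (r + s * w) K) = gen_field (insert w K)"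
proof
  note S = gen_field_is_subfield
  have i: "K \<subseteq> gen_field (insert x K)" "x \<in> gen_field (insert x K)" for x
    using gen_field_incl[of "insert x K"] by auto
  have rs: "r \<in> gen_field (insert x K)" "s \<in> gen_field (insert x K)" for x
    using i(1)[of x] assms(2,3) by auto
  have "r + s * w \<in> gen_field (insert w K)"
    by (intro subfield_add[OF S] subfield_mult[OF S] rs i(2))
  then show "gen_field (insert (r + s * w) K) \<subseteq> gen_field (insert w K)"
    using i(1)[of w] by (intro gen_field_min[OF S]) simp
  have "(r + s * w - r) / s \<in> gen_field (insert (r + s * w) K)"
    by (intro subfield_divide[OF S] subfield_diff[OF S] rs i(2))
  then have "w \<in> gen_field (insert (r + s * w) K)" using assms(4) by simp
  then show "gen_field (insert w K) \<subseteq> gen_field (insert (r + s * w) K)"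
    using i(1)[of "r + s * w"] by (intro gen_field_min[OF S]) simp
qed

text \<open>Up to the scalar D / a4 the generic point is (1 + w a2 : t + w a3 : w a4), the point
  with parameter w = y4 / D on the projecting line. So w and the ratios of coordinates generate the
  same field over k(t).\<close>

lemma E_field_cubic_root:
  assumes \<eta>: "\<eta> \<in> E_generic_points \<alpha>"
  obtains x where "poly cubic x = 0" "E_field \<eta> = adjoin line_field x"
proof -
  let ?a2 = "cst (\<alpha> 2)" and ?a3 = "cst (\<alpha> 3)" and ?a4 = "cst (\<alpha> 4)"
  define D where "D = ?a4 * \<eta> 2 - ?a2 * \<eta> 4"
  define w where "w = \<eta> 4 / D"
  define x where "x = BP.b tt 1 - BP.u * w"
  have D0: "D \<noteq> 0" using \<eta> by (simp add: E_generic_points_def D_def)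
  have D3: "?a4 * \<eta> 3 - ?a3 * \<eta> 4 = tt * D" using \<eta> by (simp add: E_generic_points_def D_def)
  have a4: "?a4 \<noteq> 0" by (rule cst_nonzero(3))
  have Dw: "D * w = \<eta> 4" using D0 by (simp add: w_def)
  have "?a4 * \<eta> 2 = D + ?a2 * (D * w)" unfolding Dw by (simp add: D_def)
  then have "?a4 * \<eta> 2 = D * (1 + w * ?a2)" by (simp add: algebra_simps)
  then have e2: "\<eta> 2 = D / ?a4 * (1 + w * ?a2)" using a4 by (simp add: nonzero_eq_divide_eq mult.commute)
  have "?a4 * \<eta> 3 = tt * D + ?a3 * (D * w)" unfolding Dw D3[symmetric] by simp
  then have "?a4 * \<eta> 3 = D * (tt + w * ?a3)" by (simp add: algebra_simps)
  then have e3: "\<eta> 3 = D / ?a4 * (tt + w * ?a3)" using a4 by (simp add: nonzero_eq_divide_eq mult.commute)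
  have e4: "\<eta> 4 = D / ?a4 * (w * ?a4)" using a4 Dw by simp
  have "subst_mpoly cst \<eta> (E_cubic \<alpha>) = \<eta> 2^3 + \<eta> 3^3 + \<eta> 4^3 + 3 * cst (\<alpha> 1) * \<eta> 2 * \<eta> 3 * \<eta> 4"
  proof -
    interpret s: comm_ring_hom "subst_mpoly cst \<eta>" by (rule cst.subst_mpoly_comm_ring_hom)
    show ?thesis
      by (simp add: E_cubic_def s.hom_add s.hom_mult s.hom_power s.hom_numeral cst.subst_mpoly_Var
          cst.subst_mpoly_Const \<alpha>0)
  qed
  then have "BP.E (\<eta> 2) (\<eta> 3) (\<eta> 4) = 0" using \<eta> by (simp add: E_generic_points_def BP.E_def)
  moreover have "BP.E (s * y) (s * z) (s * t) = s^3 * BP.E y z t" for s y z t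
    unfolding BP.E_def by Groebner_Basis.algebra
  ultimately have "(D / ?a4)^3 * BP.E (1 + w * ?a2) (tt + w * ?a3) (w * ?a4) = 0"
    unfolding e2 e3 e4 by (simp only:)
  then have "BP.E (1 + w * ?a2) (tt + w * ?a3) (w * ?a4) = 0" using D0 a4 by simp
  then have root: "poly cubic x = 0"
    using BP.cubic_on_line[of tt 1 w] by (simp add: poly_cubic x_def pt_def qt_def)
  have "E_field \<eta> = gen_field (insert w line_field)"
  proof
    let ?G = "gen_field (insert w line_field)"
    note S = gen_field_is_subfield[of "insert w line_field"]
    have i: "insert w line_field \<subseteq> ?G" by (rule gen_field_incl)
    then have cG: "cst c \<in> ?G" "w \<in> ?G" "tt \<in> ?G" for c using cst_line_field tt_line_field by auto
    define e where "e i = (if i = 2 then 1 + w * ?a2 else if i = 3 then tt + w * ?a3 else w * ?a4)" for i :: nat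
    have e: "e i \<in> ?G" for i unfolding e_def by (auto intro!: subfield_intros[OF S] cG)
    have "\<eta> i = D / ?a4 * e i" if "i \<in> {2, 3, 4}" for i using that e2 e3 e4 by (auto simp: e_def)
    then have "\<eta> i / \<eta> j = e i / e j" if "i \<in> {2, 3, 4}" "j \<in> {2, 3, 4}" for i j
      using that D0 a4 by simp
    then have "\<eta> i / \<eta> j \<in> ?G" if "i \<in> {2, 3, 4}" "j \<in> {2, 3, 4}" for i j
      using that subfield_divide[OF S e e] by simp
    then show "E_field \<eta> \<subseteq> ?G" unfolding E_field_def using cG by (intro gen_field_min[OF S]) auto
    let ?E = "E_field \<eta>"
    have S': "is_subfield ?E" unfolding E_field_def by (rule gen_field_is_subfield)
    have i': "range cst \<subseteq> ?E" and r: "\<And>i j. i \<in> {2, 3, 4} \<Longrightarrow> j \<in> {2, 3, 4} \<Longrightarrow> \<eta> j \<noteq> 0 \<Longrightarrow> \<eta> i / \<eta> j \<in> ?E"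
      unfolding E_field_def by (rule order_trans[OF _ gen_field_incl], blast) (rule subsetD[OF gen_field_incl], blast)
    have "\<eta> 2 \<noteq> 0 \<or> \<eta> 4 \<noteq> 0" using D0 by (auto simp: D_def)
    then obtain j where j: "j \<in> {2, 3, 4}" "\<eta> j \<noteq> 0" by auto
    have c: "cst c \<in> ?E" for c using i' by blast
    have q: "\<eta> 2 / \<eta> j \<in> ?E" "\<eta> 3 / \<eta> j \<in> ?E" "\<eta> 4 / \<eta> j \<in> ?E" using r j by simp_all
    have Dj: "D / \<eta> j = ?a4 * (\<eta> 2 / \<eta> j) - ?a2 * (\<eta> 4 / \<eta> j)" by (simp add: D_def diff_divide_distrib)
    have DE: "D / \<eta> j \<in> ?E" unfolding Dj by (intro subfield_intros[OF S'] q c)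
    have "w = (\<eta> 4 / \<eta> j) / (D / \<eta> j)" using j D0 by (simp add: w_def)
    then have wE: "w \<in> ?E" using subfield_divide[OF S' q(3) DE] by simp
    have "tt = (?a4 * (\<eta> 3 / \<eta> j) - ?a3 * (\<eta> 4 / \<eta> j)) / (D / \<eta> j)"
      using j D0 D3 by (simp add: diff_divide_distrib[symmetric])
    moreover have "\<dots> \<in> ?E" by (intro subfield_intros[OF S'] q c DE)
    ultimately have "tt \<in> ?E" by simp
    then have "line_field \<subseteq> ?E" unfolding line_field_def by (intro gen_field_min[OF S']) (use c in auto)
    then show "gen_field (insert w line_field) \<subseteq> ?E" using wE by (intro gen_field_min[OF S']) auto
  qed
  also have "\<dots> = gen_field (insert x line_field)"
    using gen_field_linear_change[OF line_field_subfield constants_line_field(3) subfield_uminus[OF line_field_subfield constants_line_field(1)], of w] BP.u_nz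
    by (simp add: x_def)
  finally show ?thesis using that root cubic_gen_field[OF root] by simp
qed

lemma equation_field_cubic_root:
  assumes G1: "is_G1 \<alpha> G1" and w: "w \<in> equation_roots (cardano_equation \<alpha> G1)"
  obtains x where "poly cubic x = 0" "equation_field w = adjoin line_field x"
proof -
  obtain \<epsilon> where \<epsilon>: "\<epsilon> ^ 2 = 1" "BP.u * at_generic G1 = \<epsilon> * BP.v * qt" by (rule at_generic_G1[OF G1])
  let ?l = "cst (lambda1 \<alpha>)"
  have e: "w^3 + 3 * ?l * at_generic (H1 \<alpha>) * w + ?l * at_generic G1 = 0"
    using w by (simp add: equation_roots_def cardano_equation_def map_poly_pCons at_generic_simps
        power3_eq_cube algebra_simps)
  \<comment> \<open>The factor is forced by lambda1 u^2 v = -1: it turns lambda1 H1 into p and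
    lambda1 G1 into q. The summand 0 matches \<open>gen_field_linear_change\<close>.\<close>
  define x where "x = 0 + (- \<epsilon> * BP.u) * w"
  have root: "poly cubic x = 0"
    using e \<epsilon> cst_lambda1 unfolding poly_cubic x_def at_generic_H1 by Groebner_Basis.algebra
  have "(\<epsilon> - 1) * (\<epsilon> + 1) = 0" using \<epsilon>(1) by (simp add: algebra_simps power2_eq_square)
  then have "\<epsilon> = 1 \<or> \<epsilon> = - 1" by (simp add: eq_neg_iff_add_eq_0)
  then have s: "- \<epsilon> * BP.u \<in> line_field" "- \<epsilon> * BP.u \<noteq> 0"
    using constants_line_field(1) subfield_uminus[OF line_field_subfield constants_line_field(1)] BP.u_nz by auto
  have "equation_field w = gen_field (insert x line_field)"
    unfolding equation_field_def x_def
    by (rule gen_field_linear_change[OF line_field_subfield subfield_0[OF line_field_subfield] s, symmetric])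
  then show ?thesis using that root cubic_gen_field[OF root] by simp
qed

lemma E_cover_equivalent:
  assumes "is_G1 \<alpha> G1" "\<eta> \<in> E_generic_points \<alpha>" "w \<in> equation_roots (cardano_equation \<alpha> G1)"
  shows "ext_degree line_field (E_field \<eta>) 3" "equivalent_covers (E_field \<eta>) (equation_field w)"
proof -
  obtain x x' where "poly cubic x = 0" "E_field \<eta> = adjoin line_field x"
    and "poly cubic x' = 0" "equation_field w = adjoin line_field x'"
    using E_field_cubic_root[OF assms(2)] equation_field_cubic_root[OF assms(1,3)] by metis
  then show "ext_degree line_field (E_field \<eta>) 3" "equivalent_covers (E_field \<eta>) (equation_field w)"
    using cubic_ext_degree cubic_roots_equivalent by simp_all
qed

end

section \<open>The cover of the curve\<close>

lemma (in place) P_power_int: "x \<in> K \<Longrightarrow> x \<noteq> 0 \<Longrightarrow> P (x powi n) = n * P x"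
  by (cases "n \<ge> 0") (auto simp: power_int_def P_power P_inverse subfield_power[OF K] subfield_inverse[OF K])

lemma subfield_power_int: "is_subfield K \<Longrightarrow> x \<in> K \<Longrightarrow> x powi n \<in> K"
  by (simp add: power_int_def subfield_power subfield_inverse)

lemma compositum_scale:
  fixes F :: "'k::field geo set"
  assumes F: "is_subfield F" and c: "c \<in> constants_closure"
  shows "compositum constants_closure (adjoin F (c * z)) \<subseteq> compositum constants_closure (adjoin F z)"
proof -
  let ?G = "gen_field (constants_closure \<union> adjoin F z)"
  have S: "is_subfield ?G" by (rule gen_field_is_subfield)
  have i: "constants_closure \<union> adjoin F z \<subseteq> ?G" by (rule gen_field_incl)
  have "F \<subseteq> ?G" "z \<in> ?G" "c \<in> ?G" using i adjoin_incl[OF F] adjoin_mem[OF F] c by blast+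
  then have "adjoin F (c * z) \<subseteq> ?G" by (intro adjoin_min[OF F S] subfield_mult[OF S])
  then show ?thesis unfolding compositum_def using i by (intro gen_field_min[OF S]) auto
qed

text \<open>Here \<open>\<rho>\<close> is the coordinate y of C divided by a constant equal to v/u
  up to sign, which makes its square the expression under the root in Cardano's formula.\<close>

locale burkhardt_curve = burkhardt_quartic_point \<alpha> for \<alpha> :: "nat \<Rightarrow> 'k::field" +
  fixes \<rho> :: "'k geo"
  assumes \<rho>_square: "\<rho> ^ 2 = qt ^ 2 + 4 * pt ^ 3"
begin

definition "curve_field = adjoin line_field \<rho>"
definition "geometric_curve_field = adjoin geometric_line_field \<rho>"

text \<open>A cube root \<open>a\<close> of the radicand of Cardano's formula generates the cover: the
  roots of the cubic are \<open>a - pt / a\<close>.\<close>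

definition "radicand = (\<rho> - qt) / 2"

lemma \<rho>_square_line_field: "\<rho> ^ 2 \<in> line_field"
  unfolding \<rho>_square by (intro subfield_intros[OF line_field_subfield] pt_qt_line_field)

lemma curve_field_subfield: "is_subfield curve_field"
  and geometric_curve_field_subfield: "is_subfield geometric_curve_field"
proof -
  have c: "coeffs_in line_field [:- (\<rho>^2), 0, 1:]"
    using \<rho>_square_line_field
    by (simp add: coeffs_in_subfield_pCons[OF line_field_subfield] coeffs_in_subfield_0[OF line_field_subfield]
        subfield_0[OF line_field_subfield] subfield_1[OF line_field_subfield] subfield_uminus[OF line_field_subfield])
  have p: "poly [:- (\<rho>^2), 0, 1:] \<rho> = 0" by (simp add: power2_eq_square)
  show "is_subfield curve_field" unfolding curve_field_def
    by (rule adjoin_is_subfield[OF line_field_subfield c _ p]) simp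
  show "is_subfield geometric_curve_field" unfolding geometric_curve_field_def
    by (rule adjoin_is_subfield[OF geometric_line_field_subfield coeffs_in_mono[OF c line_field_subset] _ p]) simp
qed

lemma line_field_curve_field: "line_field \<subseteq> curve_field" and \<rho>_curve_field: "\<rho> \<in> curve_field"
  unfolding curve_field_def using adjoin_incl[OF line_field_subfield] adjoin_mem[OF line_field_subfield] by auto

lemma cst_curve_field: "cst c \<in> curve_field" and tt_curve_field: "tt \<in> curve_field"
  and pt_curve_field: "pt \<in> curve_field" and qt_curve_field: "qt \<in> curve_field"
  using line_field_curve_field cst_line_field tt_line_field pt_qt_line_field by auto

lemma curve_field_gen: "x \<in> curve_field \<Longrightarrow> \<exists>r\<in>line_field. \<exists>s\<in>line_field. x = r + s * \<rho>"
  unfolding curve_field_def adjoin_sqrt[OF line_field_subfield \<rho>_square_line_field] by auto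

lemma curve_field_geometric: "curve_field \<subseteq> geometric_curve_field"
  unfolding curve_field_def geometric_curve_field_def
  using adjoin_incl[OF geometric_line_field_subfield] adjoin_mem[OF geometric_line_field_subfield] line_field_subset
  by (intro adjoin_min[OF line_field_subfield] geometric_curve_field_subfield[unfolded geometric_curve_field_def]) auto

lemma constants_geometric_curve_field: "constants_closure \<subseteq> geometric_curve_field"
  unfolding geometric_curve_field_def
  using adjoin_incl[OF geometric_line_field_subfield] constants_closure_subset by blast

lemma radicand_curve_field: "radicand \<in> curve_field"
  unfolding radicand_def by (intro subfield_intros[OF curve_field_subfield] \<rho>_curve_field qt_curve_field)

lemma two_radicand: "2 * radicand = \<rho> - qt"
  using cst_nonzero(1) by (simp add: radicand_def)

lemma radicand_mult: "radicand * (radicand + qt) = pt ^ 3"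
proof -
  have "4 * (radicand * (radicand + qt)) = 4 * pt ^ 3"
    using two_radicand \<rho>_square by Groebner_Basis.algebra
  moreover have "(4 :: 'k geo) \<noteq> 0" using cst_nonzero(1) by (metis mult_2 mult_eq_0_iff numeral_Bit0)
  ultimately show ?thesis by simp
qed

lemma radicand_nonzero: "radicand \<noteq> 0"
  using radicand_mult pt_nonzero by auto

text \<open>A cube root r gives the root r - p/r of the cubic, which even the quadratic extension of
  the geometric line field does not contain.\<close>

lemma no_cube_root:
  assumes "r \<in> geometric_curve_field"
  shows "r ^ 3 \<noteq> radicand"
proof
  assume r: "r ^ 3 = radicand"
  have r0: "r \<noteq> 0" using r radicand_nonzero by auto
  have "r ^ 3 * poly cubic (r - pt / r) = r ^ 3 * (r ^ 3 + qt) - pt ^ 3"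
    unfolding poly_cubic using r0 by (simp add: field_simps power2_eq_square power3_eq_cube)
  also have "\<dots> = 0" unfolding r radicand_mult by simp
  finally have "poly cubic (r - pt / r) = 0" using r0 by simp
  moreover have "r - pt / r \<in> geometric_curve_field"
    using assms curve_field_geometric pt_curve_field
    by (intro subfield_diff[OF geometric_curve_field_subfield] subfield_divide[OF geometric_curve_field_subfield]) auto
  moreover have "\<rho> ^ 2 \<in> geometric_line_field" using \<rho>_square_line_field line_field_subset by auto
  ultimately show False using no_root_quadratic_extension unfolding geometric_curve_field_def by blast
qed

lemma no_cube_root_constant_multiple:
  assumes "r \<in> geometric_curve_field" "c \<in> constants_closure"
  shows "r ^ 3 * c \<noteq> radicand"
proof -
  obtain d where d: "d ^ 3 = c" using nth_root_exists[of 3 c] by auto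
  have "d \<in> constants_closure" by (rule constants_closure_root) (simp only: d assms(2))
  then have "r * d \<in> geometric_curve_field"
    using assms(1) constants_geometric_curve_field by (intro subfield_mult[OF geometric_curve_field_subfield]) auto
  from no_cube_root[OF this] show ?thesis by (simp add: power_mult_distrib d)
qed

text \<open>Having no cube root persists after adjoining algebraic constants, so the degree stays 3
  geometrically.\<close>

lemma cube_root_minimal:
  assumes z: "z ^ 3 * c = radicand" and c: "c \<in> constants_closure"
    and f: "coeffs_in curve_field f" "f \<noteq> 0" "poly f z = 0"
  shows "degree f \<ge> 3"
proof -
  let ?M = geometric_curve_field
  note M = geometric_curve_field_subfield
  have c0: "c \<noteq> 0" using z radicand_nonzero by auto
  have "z ^ 3 = radicand / c" using z c0 by (simp add: field_simps)
  moreover have "\<dots> \<in> ?M" using radicand_curve_field curve_field_geometric c constants_geometric_curve_field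
    by (intro subfield_divide[OF M]) auto
  ultimately have z3: "z ^ 3 \<in> ?M" by simp
  show ?thesis
  proof (rule rootless_cubic_minimal[OF M])
    show "coeffs_in ?M [:- (z ^ 3), 0, 0, 1:]"
      using z3 by (simp add: coeffs_in_subfield_pCons[OF M] coeffs_in_subfield_0[OF M]
          subfield_0[OF M] subfield_1[OF M] subfield_uminus[OF M])
    show "poly [:- (z ^ 3), 0, 0, 1:] z = 0" by (simp add: power3_eq_cube)
    show "poly [:- (z ^ 3), 0, 0, 1:] r \<noteq> 0" if "r \<in> ?M" for r
    proof
      assume "poly [:- (z ^ 3), 0, 0, 1:] r = 0"
      then have "r ^ 3 = z ^ 3" by (simp add: power3_eq_cube algebra_simps)
      then show False using no_cube_root_constant_multiple[OF that c] z by simp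
    qed
  qed (use f coeffs_in_mono curve_field_geometric in auto)
qed

text \<open>Cardano's formula read backwards: x = a - p/a makes a a root of T^2 - x T - p. The
  identity (x^2 + p)^2 (x^2 + 4 p) = q^2 + 4 p^3 exhibits a square root of its discriminant in the
  compositum.\<close>

lemma compositum_cube_root:
  assumes x: "poly cubic x = 0"
  obtains a where "a ^ 3 = radicand" "compositum curve_field (adjoin line_field x) = adjoin curve_field a"
proof -
  let ?K = curve_field
  note K = curve_field_subfield
  have c: "x ^ 3 + 3 * pt * x + qt = 0" using x by (simp add: poly_cubic)
  \<comment> \<open>Up to the factor 3 this is the derivative of the cubic at x. A double root would
    equal -q / (2 p) and lie in k(t).\<close>
  have e: "x ^ 2 + pt \<noteq> 0"
  proof
    assume 0: "x ^ 2 + pt = 0"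
    have q: "qt = - 2 * pt * x" using 0 c by Groebner_Basis.algebra
    have "\<rho> ^ 2 = 0" unfolding \<rho>_square q using 0 by Groebner_Basis.algebra
    then have "2 * radicand = 2 * (pt * x)" using two_radicand q by simp
    then have "radicand = pt * x" using cst_nonzero(1) by simp
    moreover have "radicand = - qt / 2" unfolding radicand_def using \<open>\<rho> ^ 2 = 0\<close> by simp
    ultimately have "x * pt = - qt / 2" by (simp add: mult.commute)
    then have "x = - qt / 2 / pt" using nonzero_eq_divide_eq[OF pt_nonzero, of x "- qt / 2"] by blast
    moreover have "\<dots> \<in> line_field" by (intro subfield_intros[OF line_field_subfield] pt_qt_line_field)
    ultimately have "x \<in> geometric_line_field" using line_field_subset by auto
    then show False using no_root_geometric_line_field x by blast
  qed
  \<comment> \<open>The square root of x^2 + 4 p announced by the identity.\<close>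
  define s where "s = \<rho> / (x ^ 2 + pt)"
  define a where "a = (x + s) / 2"
  have s: "s * (x ^ 2 + pt) = \<rho>" using e by (simp add: s_def)
  have a2: "2 * a = x + s" using cst_nonzero(1) by (simp add: a_def)
  have q: "qt = - (x ^ 3 + 3 * pt * x)" using c by (simp only: eq_neg_iff_add_eq_0 add.commute)
  have "(x ^ 2 + pt) ^ 2 * s ^ 2 = \<rho> ^ 2" unfolding s[symmetric] by (simp add: power_mult_distrib)
  also have "\<dots> = (x ^ 2 + pt) ^ 2 * (x ^ 2 + 4 * pt)" unfolding \<rho>_square q by Groebner_Basis.algebra
  finally have "(x ^ 2 + pt) ^ 2 * s ^ 2 = (x ^ 2 + pt) ^ 2 * (x ^ 2 + 4 * pt)" .
  then have s2: "s ^ 2 = x ^ 2 + 4 * pt" using e by simp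
  have "8 * a ^ 3 = (2 * a) ^ 3" by (simp add: power_mult_distrib)
  also have "\<dots> = x ^ 3 + 3 * x * s ^ 2 + s * (3 * x ^ 2 + s ^ 2)" unfolding a2 by Groebner_Basis.algebra
  also have "\<dots> = 4 * (s * (x ^ 2 + pt) - qt)" unfolding s2 q by Groebner_Basis.algebra
  also have "\<dots> = 8 * radicand" unfolding s two_radicand[symmetric] by simp
  finally have "8 * a ^ 3 = 8 * radicand" .
  moreover have "(8 :: 'k geo) = 2 ^ 3" by simp
  ultimately have a3: "a ^ 3 = radicand" using cst_nonzero(1) by (metis mult_cancel_left power_eq_0_iff)
  have a0: "a \<noteq> 0" using a3 radicand_nonzero by auto
  have "4 * (a * (a - x)) = 4 * pt" using a2 s2 by Groebner_Basis.algebra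
  moreover have "(4 :: 'k geo) = 2 ^ 2" by simp
  ultimately have "a * (a - x) = pt" using cst_nonzero(1) by (metis mult_cancel_left power_eq_0_iff)
  then have xa: "x = a - pt / a" using a0 by (simp add: field_simps)
  have ca: "coeffs_in ?K [:- radicand, 0, 0, 1:]"
    using radicand_curve_field
    by (simp add: coeffs_in_subfield_pCons[OF K] coeffs_in_subfield_0[OF K] subfield_0[OF K] subfield_1[OF K] subfield_uminus[OF K])
  have pa: "poly [:- radicand, 0, 0, 1:] a = 0" using a3 by (simp add: power3_eq_cube mult.assoc)
  have S: "is_subfield (adjoin ?K a)" by (rule adjoin_is_subfield[OF K ca _ pa]) simp
  have L: "compositum ?K (adjoin line_field x) = adjoin ?K a"
  proof
    have i: "?K \<subseteq> adjoin ?K a" "a \<in> adjoin ?K a" by (rule adjoin_incl[OF K], rule adjoin_mem[OF K])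
    have "x \<in> adjoin ?K a" unfolding xa using i pt_curve_field by (intro subfield_diff[OF S] subfield_divide[OF S]) auto
    then have "adjoin line_field x \<subseteq> adjoin ?K a"
      using i line_field_curve_field by (intro adjoin_min[OF line_field_subfield S]) auto
    then show "compositum ?K (adjoin line_field x) \<subseteq> adjoin ?K a"
      unfolding compositum_def using i by (intro gen_field_min[OF S]) auto
    let ?G = "gen_field (?K \<union> adjoin line_field x)"
    have G: "is_subfield ?G" by (rule gen_field_is_subfield)
    have j: "?K \<union> adjoin line_field x \<subseteq> ?G" by (rule gen_field_incl)
    then have kx: "?K \<subseteq> ?G" "x \<in> ?G" using adjoin_mem[OF line_field_subfield] by auto
    have "a \<in> ?G" unfolding a_def s_def using kx \<rho>_curve_field pt_curve_field
      by (intro subfield_intros[OF G]) auto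
    then show "adjoin ?K a \<subseteq> compositum ?K (adjoin line_field x)"
      unfolding compositum_def using kx by (intro adjoin_min[OF K G])
  qed
  show ?thesis by (rule that[OF a3 L])
qed

lemma cover_degree:
  assumes a: "a ^ 3 = radicand"
  shows "is_subfield (adjoin curve_field a)" "ext_degree curve_field (adjoin curve_field a) 3"
proof -
  note K = curve_field_subfield
  have ca: "coeffs_in curve_field [:- radicand, 0, 0, 1:]"
    using radicand_curve_field
    by (simp add: coeffs_in_subfield_pCons[OF K] coeffs_in_subfield_0[OF K] subfield_0[OF K] subfield_1[OF K] subfield_uminus[OF K])
  have pa: "poly [:- radicand, 0, 0, 1:] a = 0" using a by (simp add: power3_eq_cube mult.assoc)
  show "is_subfield (adjoin curve_field a)" by (rule adjoin_is_subfield[OF K ca _ pa]) simp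
  show "ext_degree curve_field (adjoin curve_field a) 3"
  proof (rule ext_degree_3(1)[OF K ca _ pa])
    show "3 \<le> degree f" if "coeffs_in curve_field f" "f \<noteq> 0" "poly f a = 0" for f
      by (rule cube_root_minimal[of a 1, OF _ subfield_1[OF constants_closure_subfield] that]) (simp add: a)
  qed simp
qed

lemma placeI:
  assumes "is_subfield L" "curve_field \<subseteq> L" "Q \<in> places L"
  shows "place L Q"
  using assms cst_curve_field by unfold_locales auto

text \<open>The element c is 1 or p over the affine chart, and t or p/t over infinity. Taking it in
  k(t) serves for the cover as well as for the curve. The third conjunct makes D effective, the last
  bounds its support.\<close>

lemma radicand_value:
  assumes "place L Q" and L: "curve_field \<subseteq> L"
  shows "\<exists>c\<in>line_field. c \<noteq> 0 \<and> Q radicand = 3 * Q c \<and> 0 \<le> Q c + max 0 (- Q tt) \<and>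
    (0 \<le> Q tt \<longrightarrow> Q radicand \<noteq> 0 \<longrightarrow> vanishes Q pt)"
proof -
  interpret Q: place L Q by fact
  note S = line_field_subfield
  obtain f g f' g' where fg: "BP.pp = cpoly f" "BP.qp = cpoly g" "BS.pp = cpoly f'" "BS.qp = cpoly g'"
    by (rule polys_over_k)
  have ttL: "tt \<in> L" and \<rho>L: "\<rho> \<in> L" using L tt_curve_field \<rho>_curve_field by auto
  show ?thesis
  proof (cases "0 \<le> Q tt")
    case True
    have "radicand \<in> Q.int_ring \<and> (Q radicand = 0 \<or> pt \<in> Q.max_ideal \<and> pt \<noteq> 0 \<and> Q radicand = 3 * Q pt)"
    proof (rule Q.cardano_radicand_value[OF char2 _ _ _ _ \<rho>L \<rho>_square radicand_def radicand_nonzero])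
      show "tt \<in> Q.int_ring" using True ttL by (simp add: Q.int_ring_def)
      show "poly (cpoly f) c = 0 \<Longrightarrow> poly (cpoly g) c = 0 \<Longrightarrow> False" for c
        using BP.p_q_no_common_zero[of c 1] by (simp add: BP.poly_pp[symmetric] BP.poly_qp[symmetric] fg)
      show "pt = poly (cpoly f) tt" "qt = poly (cpoly g) tt" using pt_eq qt_eq fg by simp_all
    qed
    then consider "Q radicand = 0" | "vanishes Q pt" "pt \<noteq> 0" "Q radicand = 3 * Q pt"
      by (auto simp: Q.max_ideal_def)
    then show ?thesis
    proof cases
      case 1
      then show ?thesis by (intro bexI[of _ 1]) (simp_all add: subfield_1[OF S])
    next
      case 2
      then show ?thesis by (intro bexI[of _ pt]) (auto simp: vanishes_def pt_qt_line_field)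
    qed
  next
    case False
    \<comment> \<open>In the chart at infinity p and q have weights 2 and 3, so
      \<open>\<rho>\<close> and the radicand are divided by t^3. The interpretation with exchanged
      coordinates rules out a common zero.\<close>
    define s where "s = inverse (tt :: 'k geo)"
    define p' where "p' = BP.p 1 s"
    define q' where "q' = BP.q 1 s"
    define r where "r = \<rho> / tt ^ 3"
    define A where "A = radicand / tt ^ 3"
    have t0: "tt \<noteq> (0 :: 'k geo)" by (rule tt_nonzero)
    have ts: "tt * s = 1" using t0 by (simp add: s_def)
    have pe: "pt = tt ^ 2 * p'" using homogeneous(1)[of tt 1 s] by (simp add: ts pt_def p'_def)
    have qe: "qt = tt ^ 3 * q'" using homogeneous(2)[of tt 1 s] by (simp add: ts qt_def q'_def)
    have "\<rho> = tt ^ 3 * r" using t0 by (simp add: r_def)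
    then have "(tt ^ 3) ^ 2 * r ^ 2 = (tt ^ 3) ^ 2 * (q' ^ 2 + 4 * p' ^ 3)"
      using \<rho>_square unfolding pe qe by Groebner_Basis.algebra
    then have r2: "r ^ 2 = q' ^ 2 + 4 * p' ^ 3" using t0 by simp
    have rL: "r \<in> L" unfolding r_def by (intro subfield_intros[OF Q.K] \<rho>L ttL)
    have Ae: "A = (r - q') / 2" using t0 by (simp add: A_def r_def radicand_def qe field_simps)
    have A0: "A \<noteq> 0" using radicand_nonzero t0 by (simp add: A_def)
    have "A \<in> Q.int_ring \<and> (Q A = 0 \<or> p' \<in> Q.max_ideal \<and> p' \<noteq> 0 \<and> Q A = 3 * Q p')"
    proof (rule Q.cardano_radicand_value[OF char2 _ _ _ _ rL r2 Ae A0])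
      show "s \<in> Q.int_ring" using False ttL Q.P_inverse[OF ttL] subfield_inverse[OF Q.K ttL]
        by (simp add: Q.int_ring_def s_def)
      show "poly (cpoly f') c = 0 \<Longrightarrow> poly (cpoly g') c = 0 \<Longrightarrow> False" for c
        using BS.p_q_no_common_zero[of c 1] by (simp add: BS.poly_pp[symmetric] BS.poly_qp[symmetric] fg)
      show "p' = poly (cpoly f') s" "q' = poly (cpoly g') s"
        unfolding p'_def q'_def swap[symmetric] fg[symmetric] BS.poly_pp BS.poly_qp by (rule refl)+
    qed
    then consider "Q A = 0" | "vanishes Q p'" "p' \<noteq> 0" "Q A = 3 * Q p'"
      by (auto simp: Q.max_ideal_def)
    moreover have "radicand \<in> L" using radicand_curve_field L by auto
    then have QA: "Q A = Q radicand - 3 * Q tt"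
      using Q.P_divide[of radicand "tt ^ 3"] radicand_nonzero t0 ttL subfield_power[OF Q.K ttL, of 3] Q.P_power[of tt 3]
      by (simp add: A_def)
    moreover have "p' = pt / tt ^ 2" using t0 by (simp add: pe)
    then have p': "p' \<in> line_field" using subfield_divide[OF S] subfield_power[OF S] pt_qt_line_field tt_line_field by metis
    ultimately show ?thesis
    proof cases
      case 1
      then show ?thesis using QA t0 False by (intro bexI[of _ tt]) (simp_all add: tt_line_field)
    next
      case 2
      have "Q (tt * p') = Q tt + Q p'"
        using Q.P_mult[of tt p'] ttL t0 2 p' line_field_curve_field L by auto
      then show ?thesis using QA 2 t0 False p'
        by (intro bexI[of _ "tt * p'"]) (auto simp: vanishes_def tt_line_field intro: subfield_mult[OF S])
    qed
  qed
qed

lemma constant_of_zero_valuations: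
  assumes L: "is_subfield L" "curve_field \<subseteq> L"
    and alg: "\<And>z. z \<in> L \<Longrightarrow> \<exists>f. coeffs_in curve_field f \<and> f \<noteq> 0 \<and> degree f \<le> 3 \<and> poly f z = 0"
    and x: "x \<in> L" "\<And>Q. Q \<in> places L \<Longrightarrow> Q x = 0"
  shows "x \<in> constants_closure"
proof (rule valuations_zero_imp_constant[where L = L and K = curve_field and F = line_field])
  show "range cst \<subseteq> L" "tt \<in> L" using L(2) cst_curve_field tt_curve_field by auto
  show "\<exists>f. coeffs_in line_field f \<and> f \<noteq> 0 \<and> degree f \<le> 2 \<and> poly f z = 0" if z: "z \<in> curve_field" for z
  proof -
    note S = line_field_subfield
    obtain r s where rs: "r \<in> line_field" "s \<in> line_field" "z = r + s * \<rho>" using curve_field_gen[OF z] by blast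
    let ?f = "[:r^2 - s^2 * \<rho>^2, - 2 * r, 1:]"
    have "r^2 - s^2 * \<rho>^2 \<in> line_field" "- 2 * r \<in> line_field"
      by (intro subfield_diff[OF S] subfield_mult[OF S] subfield_uminus[OF S] subfield_numeral[OF S]
          subfield_power[OF S] rs \<rho>_square_line_field)+
    then have "coeffs_in line_field ?f"
      by (simp add: subfield_1[OF S] subfield_0[OF S] coeffs_in_subfield_pCons[OF S] coeffs_in_subfield_0[OF S])
    moreover have "poly ?f z = 0" unfolding rs(3) by (simp add: algebra_simps power2_eq_square)
    ultimately show ?thesis by (intro exI[of _ ?f]) simp
  qed
  show "\<exists>f g. z = poly (cpoly f) s / poly (cpoly g) s \<and> poly (cpoly g) s \<noteq> 0"
    if "s = tt \<or> s = inverse tt" "z \<in> line_field" for s z :: "'k geo"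
    by (rule line_field_fraction[OF that])
  show "poly (cpoly f) s \<in> line_field" if "s = tt \<or> s = inverse tt" for s :: "'k geo" and f
    by (rule poly_line_field[OF that])
  show "Q x = 0" if "Q \<in> places L" for Q by (rule x(2)[OF that])
  show "\<exists>f. coeffs_in curve_field f \<and> f \<noteq> 0 \<and> degree f \<le> 3 \<and> poly f z = 0" if "z \<in> L" for z
    by (rule alg[OF that])
qed (rule L x line_field_subfield line_field_curve_field curve_field_subfield)+

end

section \<open>Divisor classes\<close>

context burkhardt_curve
begin

lemma radicand_value_div3:
  assumes "place L Q" "curve_field \<subseteq> L"
  shows "3 * (Q radicand div 3) = Q radicand"
  using radicand_value[OF assms] by auto

lemma cover_value:
  assumes L: "place L Q" "curve_field \<subseteq> L" and a: "a \<in> L" "a ^ 3 * c = radicand"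
    and c: "Q c = 0" "c \<in> L"
  shows "Q a = Q radicand div 3"
proof -
  interpret Q: place L Q by fact
  have "a \<noteq> 0" "c \<noteq> 0" using a radicand_nonzero by auto
  then have "Q (a ^ 3 * c) = 3 * Q a"
    using Q.P_mult[of "a ^ 3" c] Q.P_power[of a 3] a c subfield_power[OF Q.K, of a 3] by auto
  then show ?thesis using a by simp
qed

lemma degree_3_relation:
  assumes "is_subfield L" "ext_degree curve_field L 3" "z \<in> L"
  shows "\<exists>f. coeffs_in curve_field f \<and> f \<noteq> 0 \<and> degree f \<le> 3 \<and> poly f z = 0"
  using dimension_relation[OF curve_field_subfield assms(2,1,3)] .

lemma cover_unramified:
  assumes a: "a ^ 3 = radicand"
  shows "unramified curve_field (adjoin curve_field a)"
    and "\<And>Q. Q \<in> places (adjoin curve_field a) \<Longrightarrow> \<exists>x\<in>curve_field. Q x = 1"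
proof -
  let ?K = curve_field and ?L = "adjoin curve_field a"
  note K = curve_field_subfield
  note L = cover_degree[OF a]
  have KL: "?K \<subseteq> ?L" and aL: "a \<in> ?L" using adjoin_incl[OF K] adjoin_mem[OF K] by auto
  have a0: "a \<noteq> 0" using a radicand_nonzero by auto
  show one: "\<exists>x\<in>?K. Q x = 1" if Q: "Q \<in> places ?L" for Q
  proof -
    have pl: "place ?L Q" by (rule placeI[OF L(1) KL Q])
    obtain c where "c \<in> line_field" "c \<noteq> 0" "Q radicand = 3 * Q c" using radicand_value[OF pl KL] by blast
    then show ?thesis
      using cube_root_value_group[OF pl K KL char3 aL a0 refl, of c] line_field_curve_field radicand_curve_field a by auto
  qed
  show "unramified ?K ?L"
    unfolding unramified_def
  proof
    fix Q assume Q: "Q \<in> places ?L"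
    have pl: "place ?L Q" by (rule placeI[OF L(1) KL Q])
    have "range cst \<subseteq> ?K" using cst_curve_field by auto
    from restrict_place(1)[OF pl K KL this one[OF Q]]
    show "ram_index ?K Q = 1 \<and> separable_residue ?K ?L Q"
      using residue_separable[OF pl K KL char2 char3 degree_3_relation[OF L]] by blast
  qed
qed

text \<open>One third of the divisor of \<open>radicand\<close>, exact by
  \<open>radicand_value_div3\<close>; it represents the class of D - kappa.\<close>

definition J_class_divisor :: "'k divisor" where
  "J_class_divisor P = (if P \<in> places curve_field then P radicand div 3 else 0)"

definition J_divisor :: "'k divisor" where
  "J_divisor P = J_class_divisor P + kappa curve_field P"

lemma J_divisor_minus_kappa: "(\<lambda>P. J_divisor P - kappa curve_field P) = J_class_divisor"
  by (simp add: fun_eq_iff J_divisor_def)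

lemma curve_place: "P \<in> places curve_field \<Longrightarrow> place curve_field P"
  by (rule placeI[OF curve_field_subfield]) auto

lemma three_J_class_divisor: "3 * J_class_divisor P = principal_divisor curve_field radicand P"
  using radicand_value_div3[OF curve_place] by (simp add: J_class_divisor_def principal_divisor_def)

lemma J_divisor_nonneg: "0 \<le> J_divisor P"
  using radicand_value[OF curve_place, of P] by (auto simp: J_divisor_def J_class_divisor_def kappa_def)

text \<open>A pole of t is a zero of 1/t, so both sets are instances of
  \<open>finite_places_over_zeros\<close>, in the two charts of the line.\<close>

lemma finite_pole_places: "finite {P \<in> places curve_field. P tt < 0}" (is "finite ?A")
  and finite_pt_zeros: "finite {P \<in> places curve_field. 0 \<le> P tt \<and> vanishes P pt}" (is "finite ?B")
proof -
  note K = curve_field_subfield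
  have cK: "range cst \<subseteq> curve_field" using cst_curve_field by auto
  obtain f where f: "BP.pp = cpoly f" by (rule polys_over_k)
  have fin: "finite {P \<in> places curve_field. 0 \<le> P s \<and> vanishes P (poly (cpoly h) s)}"
    if s: "s = tt \<or> s = inverse tt" and h: "h \<noteq> 0" for s h
  proof (rule finite_places_over_zeros[OF K cK line_field_subfield line_field_curve_field char2 _ _ _ h])
    show "\<exists>r\<in>line_field. \<exists>t\<in>line_field. x = r + t * \<rho>" if "x \<in> curve_field" for x
      by (rule curve_field_gen[OF that])
    show "s \<in> curve_field" using s tt_curve_field subfield_inverse[OF K tt_curve_field] by auto
    show "\<exists>f g. x = poly (cpoly f) s / poly (cpoly g) s \<and> poly (cpoly g) s \<noteq> 0" if "x \<in> line_field" for x
      by (rule line_field_fraction[OF s that])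
  qed
  have "f \<noteq> 0" using f BP.pp_nonzero by auto
  then show "finite ?B" using fin[of tt f] by (simp add: pt_eq f)
  have inv: "P (inverse tt) = - P tt" if "P \<in> places curve_field" for P
    using place.P_inverse[OF curve_place[OF that] tt_curve_field] .
  have "?A \<subseteq> {P \<in> places curve_field. 0 \<le> P (inverse tt) \<and> vanishes P (poly (cpoly [:0, 1:]) (inverse tt))}"
    by (auto simp: vanishes_def inv)
  then show "finite ?A" by (rule finite_subset) (rule fin; simp)
qed

lemma J_class_divisor_support:
  assumes "J_class_divisor P \<noteq> 0 \<or> kappa curve_field P \<noteq> 0"
  shows "P \<in> {P \<in> places curve_field. P tt < 0} \<union> {P \<in> places curve_field. 0 \<le> P tt \<and> vanishes P pt}"
proof -
  have P: "P \<in> places curve_field" using assms by (auto simp: J_class_divisor_def kappa_def split: if_splits)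
  show ?thesis
  proof (cases "0 \<le> P tt")
    case True
    then have "P radicand \<noteq> 0" using assms by (auto simp: J_class_divisor_def kappa_def split: if_splits)
    then show ?thesis using P True radicand_value[OF curve_place[OF P]] by auto
  qed (use P in auto)
qed

lemma J_divisors: "J_divisor \<in> divisors curve_field" "J_class_divisor \<in> divisors curve_field"
proof -
  have fin: "finite ({P \<in> places curve_field. P tt < 0} \<union> {P \<in> places curve_field. 0 \<le> P tt \<and> vanishes P pt})" (is "finite ?U")
    using finite_pole_places finite_pt_zeros by simp
  have "{P. J_divisor P \<noteq> 0} \<subseteq> ?U" "{P. J_class_divisor P \<noteq> 0} \<subseteq> ?U"
    using J_class_divisor_support unfolding J_divisor_def by (intro subsetI; force)+
  moreover have "?U \<subseteq> places curve_field" by auto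
  ultimately show "J_divisor \<in> divisors curve_field" "J_class_divisor \<in> divisors curve_field"
    unfolding divisors_def using finite_subset[OF _ fin] by blast+
qed

text \<open>The quotient of g^3 by the m-th power of \<open>radicand\<close> has value 0 everywhere,
  so it is a constant. For m prime to 3 the radicand would be a cube times a constant.\<close>

lemma principal_multiple:
  assumes g: "g \<in> curve_field" "g \<noteq> 0"
    and eq: "\<And>P. m * J_class_divisor P = principal_divisor curve_field g P"
  shows "3 dvd m"
proof -
  let ?K = curve_field
  note K = curve_field_subfield
  define \<kappa> where "\<kappa> = g ^ 3 / radicand powi m"
  have A0: "radicand powi m \<noteq> 0" using radicand_nonzero by simp
  have \<kappa>K: "\<kappa> \<in> ?K" unfolding \<kappa>_def
    by (intro subfield_divide[OF K] subfield_power[OF K] subfield_power_int[OF K] g radicand_curve_field)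
  have "P \<kappa> = 0" if P: "P \<in> places ?K" for P
  proof -
    interpret P: place ?K P by (rule curve_place[OF P])
    have "P \<kappa> = 3 * P g - m * P radicand"
      unfolding \<kappa>_def using P.P_divide[of "g ^ 3" "radicand powi m"] P.P_power[OF g, of 3]
        P.P_power_int[OF radicand_curve_field radicand_nonzero, of m]
        subfield_power[OF K g(1)] subfield_power_int[OF K radicand_curve_field] g A0 by simp
    moreover have "m * (3 * J_class_divisor P) = 3 * P g"
      using eq[of P] P by (simp add: principal_divisor_def)
    then have "m * P radicand = 3 * P g"
      unfolding three_J_class_divisor using P by (simp add: principal_divisor_def)
    ultimately show ?thesis by simp
  qed
  moreover have "\<exists>f. coeffs_in ?K f \<and> f \<noteq> 0 \<and> degree f \<le> 3 \<and> poly f z = 0" if "z \<in> ?K" for z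
    using that by (intro exI[of _ "[:- z, 1:]"])
      (simp add: coeffs_in_subfield_pCons[OF K] coeffs_in_subfield_0[OF K] subfield_1[OF K] subfield_uminus[OF K])
  ultimately have \<kappa>: "\<kappa> \<in> constants_closure"
    using constant_of_zero_valuations[OF K order_refl _ \<kappa>K] by blast
  have g3: "g ^ 3 = \<kappa> * radicand powi m" using A0 by (simp add: \<kappa>_def)
  have \<kappa>0: "\<kappa> \<noteq> 0" using g3 g(2) by auto
  have no: "False" if "r \<in> ?K" "r ^ 3 * c = radicand" "c \<in> constants_closure" for r c
    using no_cube_root_constant_multiple[OF _ that(3)] curve_field_geometric that(1,2) by blast
  show ?thesis
  proof (rule ccontr)
    assume n: "\<not> 3 dvd m"
    \<comment> \<open>m / 3 rounded to the nearest integer.\<close>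
    define k where "k = (m + 1) div 3"
    have "m = 3 * k - 1 \<or> m = 3 * k + 1" using n unfolding k_def by presburger
    then show False
    proof
      assume m: "m = 3 * k - 1"
      define r where "r = radicand powi k / g"
      have "r \<in> ?K" unfolding r_def by (intro subfield_divide[OF K] subfield_power_int[OF K] g radicand_curve_field)
      moreover have "radicand powi m = (radicand powi k) ^ 3 / radicand"
        unfolding m using radicand_nonzero by (simp add: power_int_diff power_int_power' mult.commute)
      then have "r ^ 3 * \<kappa> = radicand"
        unfolding r_def power_divide g3 using \<kappa>0 radicand_nonzero by (simp add: field_simps)
      ultimately show False using no \<kappa> by blast
    next
      assume m: "m = 3 * k + 1"
      define r where "r = g / radicand powi k"
      have "r \<in> ?K" unfolding r_def by (intro subfield_divide[OF K] subfield_power_int[OF K] g radicand_curve_field)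
      moreover have "radicand powi m = (radicand powi k) ^ 3 * radicand"
        unfolding m using radicand_nonzero by (simp add: power_int_add power_int_power' mult.commute)
      then have "r ^ 3 * inverse \<kappa> = radicand"
        unfolding r_def power_divide g3 using \<kappa>0 radicand_nonzero by (simp add: field_simps)
      ultimately show False using no subfield_inverse[OF constants_closure_subfield \<kappa>] by blast
    qed
  qed
qed

definition "J_class n = divisor_class curve_field (\<lambda>P. n * J_class_divisor P)"

lemma J_class_mem: "(\<lambda>P. n * J_class_divisor P) \<in> J_class n"
proof -
  have "{P. n * J_class_divisor P \<noteq> 0} \<subseteq> {P. J_class_divisor P \<noteq> 0}" by auto
  then have "(\<lambda>P. n * J_class_divisor P) \<in> divisors curve_field"
    using J_divisors(2) unfolding divisors_def by (auto intro: finite_subset)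
  moreover have "principal_divisor curve_field 1 P = 0" for P
    using place.P_1[OF curve_place] by (simp add: principal_divisor_def)
  ultimately show ?thesis
    unfolding J_class_def divisor_class_def using subfield_1[OF curve_field_subfield] by (auto intro!: bexI[of _ 1])
qed

text \<open>\<open>3 * k\<close> times \<open>J_class_divisor\<close> is the divisor of
  \<open>radicand powi k\<close>.\<close>

lemma J_class_shift: "J_class (n + 3 * k) \<subseteq> J_class n"
proof
  fix B assume B: "B \<in> J_class (n + 3 * k)"
  note K = curve_field_subfield
  obtain g where g: "g \<in> curve_field" "g \<noteq> 0" "B \<in> divisors curve_field"
    "\<And>P. B P = (n + 3 * k) * J_class_divisor P + principal_divisor curve_field g P"
    using B unfolding J_class_def divisor_class_def by auto
  let ?h = "radicand powi k * g"
  have h: "?h \<in> curve_field - {0}"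
    using g radicand_nonzero subfield_mult[OF K] subfield_power_int[OF K radicand_curve_field] by auto
  have "B P = n * J_class_divisor P + principal_divisor curve_field ?h P" for P
  proof (cases "P \<in> places curve_field")
    case True
    interpret P: place curve_field P by (rule curve_place[OF True])
    have "P ?h = k * P radicand + P g"
      using P.P_mult[of "radicand powi k" g] P.P_power_int[OF radicand_curve_field radicand_nonzero, of k]
        subfield_power_int[OF K radicand_curve_field] g radicand_nonzero by auto
    moreover have "k * (3 * J_class_divisor P) = k * P radicand"
      unfolding three_J_class_divisor using True by (simp add: principal_divisor_def)
    ultimately show ?thesis unfolding g(4) using True by (simp add: principal_divisor_def algebra_simps)
  next
    case False
    then show ?thesis unfolding g(4) by (simp add: principal_divisor_def J_class_divisor_def)
  qed
  then show "B \<in> J_class n" using g(3) h unfolding J_class_def divisor_class_def by blast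
qed

lemma J_class_eq_iff: "J_class n = J_class m \<longleftrightarrow> 3 dvd (n - m)"
proof
  assume "J_class n = J_class m"
  then have "(\<lambda>P. n * J_class_divisor P) \<in> J_class m" using J_class_mem[of n] by simp
  then obtain g where "g \<in> curve_field" "g \<noteq> 0"
    "\<And>P. n * J_class_divisor P = m * J_class_divisor P + principal_divisor curve_field g P"
    unfolding J_class_def divisor_class_def by auto
  then show "3 dvd (n - m)" by (intro principal_multiple[of g]) (auto simp: left_diff_distrib)
next
  assume "3 dvd (n - m)"
  then obtain k where "n - m = 3 * k" by (rule dvdE)
  then have k: "n = m + 3 * k" "m = n + 3 * (- k)" by simp_all
  show "J_class n = J_class m"
    using J_class_shift[of m k] J_class_shift[of n "- k"] k by (metis subset_antisym)
qed

definition "J_classes = {J_class n | n. True}"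

lemma generated_class_group_eq: "generated_class_group curve_field J_class_divisor = J_classes"
  by (simp add: generated_class_group_def J_classes_def J_class_def)

lemma card_J_classes: "card J_classes = 3"
proof -
  have "J_class n \<in> J_class ` {0, 1, 2}" for n
  proof -
    have e: "J_class n = J_class (n mod 3)" unfolding J_class_eq_iff by presburger
    have "n mod 3 = 0 \<or> n mod 3 = 1 \<or> n mod 3 = 2" by presburger
    then have "n mod 3 \<in> {0, 1, 2}" by (simp only: insert_iff empty_iff simp_thms)
    then show ?thesis unfolding e by (rule imageI)
  qed
  then have "J_classes = J_class ` {0, 1, 2}" unfolding J_classes_def by blast
  moreover have "inj_on J_class {0, 1, 2}" by (auto simp: inj_on_def J_class_eq_iff)
  ultimately show ?thesis by (simp add: card_image)
qed

lemma cover_capitalizes: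
  assumes a: "a ^ 3 = radicand"
  shows "capitalizes curve_field (adjoin curve_field a) J_classes"
  unfolding capitalizes_def
proof (intro ballI)
  let ?K = curve_field and ?L = "adjoin curve_field a"
  note K = curve_field_subfield
  note L = cover_degree(1)[OF a]
  have KL: "?K \<subseteq> ?L" and aL: "a \<in> ?L" using adjoin_incl[OF K] adjoin_mem[OF K] by auto
  have a0: "a \<noteq> 0" using a radicand_nonzero by auto
  have cK: "range cst \<subseteq> ?K" using cst_curve_field by auto
  fix S B assume "S \<in> J_classes" "B \<in> S"
  then obtain n where "B \<in> J_class n" unfolding J_classes_def by blast
  then obtain g where g: "g \<in> ?K" "g \<noteq> 0"
    "\<And>P. B P = n * J_class_divisor P + principal_divisor ?K g P"
    unfolding J_class_def divisor_class_def by auto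
  let ?h = "a powi n * g"
  have "pullback_divisor ?K ?L B Q = principal_divisor ?L ?h Q" for Q
  proof (cases "Q \<in> places ?L")
    case True
    interpret Q: place ?L Q by (rule placeI[OF L KL True])
    note r = restrict_place[OF Q.place_axioms K KL cK cover_unramified(2)[OF a True]]
    have "B (place_below ?K Q) = n * (Q radicand div 3) + Q g"
      unfolding g(3) using r(3) g(1) radicand_curve_field
      by (simp add: r(2) J_class_divisor_def principal_divisor_def)
    moreover have "Q ?h = n * Q a + Q g"
      using Q.P_mult[of "a powi n" g] Q.P_power_int[OF aL a0, of n] subfield_power_int[OF L aL] g a0 KL by auto
    moreover have "Q a = Q radicand div 3"
      by (rule cover_value[OF Q.place_axioms KL aL, of 1]) (simp_all add: a subfield_1[OF L])
    ultimately show ?thesis using True r(1) by (simp add: pullback_divisor_def principal_divisor_def)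
  next
    case False
    then show ?thesis by (simp add: pullback_divisor_def principal_divisor_def)
  qed
  moreover have "?h \<in> ?L - {0}"
    using subfield_mult[OF L subfield_power_int[OF L aL]] g KL a0 by auto
  ultimately show "\<exists>h\<in>?L - {0}. pullback_divisor ?K ?L B = principal_divisor ?L h" by blast
qed

lemma capitalizing_cover_unique:
  assumes L: "is_subfield L" "curve_field \<subseteq> L" "ext_degree curve_field L 3"
    and unr: "unramified curve_field L" and cap: "capitalizes curve_field L J_classes"
    and a: "a ^ 3 = radicand"
  shows "compositum constants_closure L = compositum constants_closure (adjoin curve_field a)"
proof -
  let ?K = curve_field
  note K = curve_field_subfield
  have cK: "range cst \<subseteq> ?K" using cst_curve_field by auto
  have AL: "radicand \<in> L" using radicand_curve_field L(2) by auto
  have rel: "\<And>z. z \<in> L \<Longrightarrow> \<exists>f. coeffs_in ?K f \<and> f \<noteq> 0 \<and> degree f \<le> 3 \<and> poly f z = 0"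
    by (rule degree_3_relation[OF L(1,3)])
  have "J_class 1 \<in> J_classes" unfolding J_classes_def by blast
  moreover have "J_class_divisor \<in> J_class 1" using J_class_mem[of 1] by simp
  ultimately obtain g where g: "g \<in> L" "g \<noteq> 0"
    "pullback_divisor ?K L J_class_divisor = principal_divisor L g"
    using cap unfolding capitalizes_def by blast
  define \<kappa> where "\<kappa> = radicand / g ^ 3"
  have \<kappa>L: "\<kappa> \<in> L" unfolding \<kappa>_def by (intro subfield_divide[OF L(1)] subfield_power[OF L(1)] AL g)
  have "Q \<kappa> = 0" if Q: "Q \<in> places L" for Q
  proof -
    interpret Q: place L Q by (rule placeI[OF L(1,2) Q])
    have "ram_index ?K Q = 1" using unr Q by (simp add: unramified_def)
    \<comment> \<open>\<open>ram_index\<close> is a \<open>LEAST\<close>: its being 1 yields an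
      element of value 1 only if some positive value is attained on K.\<close>
    moreover have "\<exists>e>0. \<exists>x\<in>?K. Q x = int e"
      using rel by (intro place_nontrivial_below[OF Q.place_axioms K L(2)]) blast
    then have "\<exists>x\<in>?K. Q x = int (ram_index ?K Q)"
      unfolding ram_index_def by (rule LeastI2_ex) blast
    ultimately have "\<exists>x\<in>?K. Q x = 1" by simp
    note r = restrict_place[OF Q.place_axioms K L(2) cK this]
    have "Q g = Q radicand div 3"
      using fun_cong[OF g(3), of Q] Q r radicand_curve_field
      by (simp add: pullback_divisor_def principal_divisor_def J_class_divisor_def)
    then have "3 * Q g = Q radicand" using radicand_value_div3[OF Q.place_axioms L(2)] by simp
    then show ?thesis
      unfolding \<kappa>_def using Q.P_divide[of radicand "g ^ 3"] Q.P_power[OF g(1,2), of 3]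
        subfield_power[OF L(1) g(1)] AL radicand_nonzero g(2) by simp
  qed
  then have \<kappa>: "\<kappa> \<in> constants_closure" using constant_of_zero_valuations[OF L(1,2) rel \<kappa>L] by blast
  have g3: "g ^ 3 * \<kappa> = radicand" using g(2) by (simp add: \<kappa>_def)
  have gL: "adjoin ?K g \<subseteq> L" by (intro adjoin_min[OF K L(1,2)] g)
  \<comment> \<open>Up to a constant g is a cube root of the radicand, so 1, g, g^2 are independent
    and fill the three-dimensional L.\<close>
  have "L \<subseteq> adjoin ?K g"
    using cube_root_minimal[OF g3 \<kappa>] by (intro dimension_3_adjoin[OF K L(3,1) g(1)]) blast
  then have Lg: "L = adjoin ?K g" using gL by blast
  define c where "c = a / g"
  have a0: "a \<noteq> 0" using a radicand_nonzero by auto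
  have "c ^ 3 = \<kappa>" using a g(2) by (simp add: c_def \<kappa>_def power_divide)
  then have c: "c \<in> constants_closure" using \<kappa> by (intro constants_closure_root[of c]) (simp only:)
  have cg: "c * g = a" "inverse c * a = g" using g(2) a0 by (simp_all add: c_def)
  show ?thesis
    unfolding Lg
    using compositum_scale[OF K c, of g] compositum_scale[OF K subfield_inverse[OF constants_closure_subfield c], of a]
    unfolding cg by (rule subset_antisym[rotated])
qed

lemma is_the_capitalizing_cover_cube_root:
  assumes "a ^ 3 = radicand"
  shows "is_the_capitalizing_cover curve_field (adjoin curve_field a) J_classes"
  unfolding is_the_capitalizing_cover_def subfield_iff_is_subfield
  using cover_degree(2)[OF assms] cover_unramified(1)[OF assms] cover_capitalizes[OF assms]
    capitalizing_cover_unique[OF _ _ _ _ _ assms] by blast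

end

text \<open>One constant of k, v/u with the sign of G1 absorbed, rescales y to a square root of q^2
  + 4 p^3 and G1 to q at once. Hence y - G1 is a constant multiple of the radicand.\<close>

lemma (in burkhardt_quartic_point) curve_model:
  assumes G1: "is_G1 \<alpha> G1" and y: "y ^ 2 = at_generic (F_sextic \<alpha>)"
  obtains \<rho> e where "burkhardt_curve \<alpha> \<rho>" "C_field y = adjoin line_field \<rho>" "e \<noteq> 0"
    "y - at_generic G1 = cst e * (\<rho> - qt) / 2"
proof -
  obtain \<epsilon> where \<epsilon>: "\<epsilon> ^ 2 = 1" "BP.u * at_generic G1 = \<epsilon> * BP.v * qt" by (rule at_generic_G1[OF G1])
  have "(\<epsilon> - 1) * (\<epsilon> + 1) = 0" using \<epsilon>(1) by (simp add: algebra_simps power2_eq_square)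
  then have "\<epsilon> = 1 \<or> \<epsilon> = - 1" by (simp add: eq_neg_iff_add_eq_0)
  then obtain \<epsilon>' :: 'k where \<epsilon>': "\<epsilon> = cst \<epsilon>'" "\<epsilon>' \<noteq> 0"
    by (metis cst.hom_one cst.hom_uminus one_neq_zero neg_equal_0_iff_equal)
  define e where "e = \<epsilon>' * (1 + \<alpha> 4 ^ 3) / (1 + \<alpha> 1 ^ 3)"
  have e0: "e \<noteq> 0" using \<epsilon>' nz_k by (simp add: e_def)
  have "e * (1 + \<alpha> 1 ^ 3) = \<epsilon>' * (1 + \<alpha> 4 ^ 3)" using nz_k by (simp add: e_def)
  then have "cst (e * (1 + \<alpha> 1 ^ 3)) = cst (\<epsilon>' * (1 + \<alpha> 4 ^ 3))" by simp
  then have ce: "cst e * BP.u = \<epsilon> * BP.v"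
    by (simp only: cst.hom_mult cst_one_plus_cube BP.u_def BP.v_def \<epsilon>')
  have ce0: "cst e \<noteq> 0" using e0 by simp
  have "BP.u * at_generic G1 = BP.u * (cst e * qt)" using \<epsilon>(2) ce by Groebner_Basis.algebra
  then have g: "at_generic G1 = cst e * qt" using BP.u_nz by simp
  define \<rho> where "\<rho> = y / cst e"
  have y\<rho>: "y = 0 + cst e * \<rho>" using ce0 by (simp add: \<rho>_def)
  have "BP.u^2 * y^2 = BP.v^2 * (qt^2 + 4 * pt^3)"
    unfolding y at_generic_F using BP.u_nz by (simp add: power_divide)
  then have "(cst e * BP.u)^2 * \<rho>^2 = (cst e * BP.u)^2 * (qt^2 + 4 * pt^3)"
    unfolding y\<rho> using ce \<epsilon>(1) by Groebner_Basis.algebra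
  then have r2: "\<rho>^2 = qt^2 + 4 * pt^3" using ce0 BP.u_nz by simp
  interpret C: burkhardt_curve \<alpha> \<rho> by unfold_locales (rule r2)
  note S = line_field_subfield
  have "C_field y = gen_field (insert \<rho> line_field)"
    unfolding C_field_def y\<rho>
    by (rule gen_field_linear_change[OF S subfield_0[OF S] cst_line_field ce0])
  also have "\<dots> = adjoin line_field \<rho>"
  proof (rule gen_field_insert[OF S])
    show "coeffs_in line_field [:- (\<rho>^2), 0, 1:]"
      using C.\<rho>_square_line_field
      by (simp add: coeffs_in_subfield_pCons[OF S] coeffs_in_subfield_0[OF S]
          subfield_0[OF S] subfield_1[OF S] subfield_uminus[OF S])
  qed (simp_all add: power2_eq_square)
  finally have CF: "C_field y = adjoin line_field \<rho>" .
  \<comment> \<open>The factor 2 offsets the half in \<open>(\<rho> - qt) / 2\<close>.\<close>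
  define e' where "e' = 2 * e"
  have "y - at_generic G1 = cst e' * (\<rho> - qt) / 2"
    using cst_nonzero(1) by (simp add: e'_def y\<rho> g cst.hom_mult cst.hom_numeral algebra_simps)
  moreover have "e' \<noteq> 0" using e0 char2 by (simp add: e'_def)
  ultimately show ?thesis using that C.burkhardt_curve_axioms CF by blast
qed

lemma (in burkhardt_quartic_point) fibre_product_capitalizes:
  assumes G1: "is_G1 \<alpha> G1" and \<eta>: "\<eta> \<in> E_generic_points \<alpha>" and y: "y ^ 2 = at_generic (F_sextic \<alpha>)"
  shows "\<exists>D. is_J_divisor y G1 D \<and> card (J_subgroup y D) = 3 \<and>
    is_the_capitalizing_cover (C_field y) (compositum (C_field y) (E_field \<eta>)) (J_subgroup y D)"
proof -
  obtain \<rho> e where \<rho>: "burkhardt_curve \<alpha> \<rho>" "C_field y = adjoin line_field \<rho>" "e \<noteq> 0"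
    "y - at_generic G1 = cst e * (\<rho> - qt) / 2" by (rule curve_model[OF G1 y])
  interpret C: burkhardt_curve \<alpha> \<rho> by (rule \<rho>(1))
  have CF: "C_field y = C.curve_field" by (simp add: \<rho>(2) C.curve_field_def)
  have yG: "y - at_generic G1 = cst e * C.radicand" by (simp add: \<rho>(4) C.radicand_def)
  have "principal_divisor C.curve_field (y - at_generic G1) P = principal_divisor C.curve_field C.radicand P" for P
  proof (cases "P \<in> places C.curve_field")
    case True
    interpret P: place C.curve_field P by (rule C.curve_place[OF True])
    show ?thesis unfolding yG principal_divisor_def
      using P.P_mult[of "cst e" C.radicand] \<rho>(3) C.radicand_nonzero C.radicand_curve_field P.cst_in by simp
  qed (simp add: principal_divisor_def)
  moreover have "J_subgroup y C.J_divisor = C.J_classes"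
    by (simp add: J_subgroup_def CF C.J_divisor_minus_kappa C.generated_class_group_eq)
  moreover obtain x where x: "poly cubic x = 0" "E_field \<eta> = adjoin line_field x"
    by (rule E_field_cubic_root[OF \<eta>])
  moreover obtain a where "a ^ 3 = C.radicand" "compositum C.curve_field (adjoin line_field x) = adjoin C.curve_field a"
    by (rule C.compositum_cube_root[OF x(1)])
  moreover have "3 * (C.J_divisor P - kappa C.curve_field P) = principal_divisor C.curve_field C.radicand P" for P
    using C.three_J_class_divisor[of P] fun_cong[OF C.J_divisor_minus_kappa, of P] by simp
  ultimately show ?thesis
    using C.is_the_capitalizing_cover_cube_root C.card_J_classes C.J_divisors(1) C.J_divisor_nonneg
    by (intro exI[of _ C.J_divisor]) (simp add: is_J_divisor_def CF)
qed

theorem proposition2p8: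
  fixes \<alpha> :: "nat \<Rightarrow> 'k::field"
  assumes "CHAR('k) \<noteq> 2" and "CHAR('k) \<noteq> 3"
    and "\<exists>i\<le>4. \<alpha> i \<noteq> 0"
    and "subst_mpoly id \<alpha> burkhardt = 0"
  shows "restrict_to_J (cubic_polar \<alpha>) = E_cubic \<alpha> \<and>
    (subst_mpoly id \<alpha> burkhardt_hessian \<noteq> 0 \<and> \<alpha> 0 = 1 \<and> \<alpha> 4 \<noteq> 0 \<longrightarrow>
      (\<exists>c. c \<noteq> 0 \<and> cubic_discriminant (E_equation \<alpha>) = Const c * F_sextic \<alpha>) \<and>
      (\<exists>G1. is_G1 \<alpha> G1) \<and>
      (\<forall>G1. is_G1 \<alpha> G1 \<longrightarrow>
        (\<forall>\<eta>\<in>E_generic_points \<alpha>. \<forall>w\<in>equation_roots (cardano_equation \<alpha> G1).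
          ext_degree line_field (E_field \<eta>) 3 \<and>
          equivalent_covers (E_field \<eta>) (equation_field w)) \<and>
        (\<forall>y. \<forall>\<eta>\<in>E_generic_points \<alpha>. y ^ 2 = at_generic (F_sextic \<alpha>) \<longrightarrow>
          (\<exists>D. is_J_divisor y G1 D \<and> card (J_subgroup y D) = 3 \<and>
            is_the_capitalizing_cover (C_field y) (compositum (C_field y) (E_field \<eta>))
              (J_subgroup y D)))))"
proof (intro conjI impI)
  show "restrict_to_J (cubic_polar \<alpha>) = E_cubic \<alpha>" by (rule restrict_to_J_cubic_polar)
  assume "subst_mpoly id \<alpha> burkhardt_hessian \<noteq> 0 \<and> \<alpha> 0 = 1 \<and> \<alpha> 4 \<noteq> 0"
  then have h: "subst_mpoly id \<alpha> burkhardt_hessian \<noteq> 0" and \<alpha>0: "\<alpha> 0 = 1" and \<alpha>4: "\<alpha> 4 \<noteq> 0" by auto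
  \<comment> \<open>At the point the Hessian is a scalar multiple of the product of these four
    factors.\<close>
  have nz: "1 + \<alpha> 1^3 \<noteq> 0" "1 + \<alpha> 2^3 \<noteq> 0" "1 + \<alpha> 3^3 \<noteq> 0" "1 + \<alpha> 4^3 \<noteq> 0"
    using h unfolding subst_burkhardt_hessian[OF \<alpha>0 assms(4)] by auto
  have char: "of_nat n \<noteq> (0 :: 'k)" if "prime n" "CHAR('k) \<noteq> n" for n
  proof -
    have "CHAR('k) \<noteq> 1" using CHAR_not_1'[where 'a = 'k] unfolding One_nat_def .
    then have "\<not> CHAR('k) dvd n" using that unfolding prime_nat_iff by blast
    then show ?thesis unfolding of_nat_eq_0_iff_char_dvd .
  qed
  have c2: "(2::'k) \<noteq> 0" using char[of 2] assms(1) by simp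
  have c3: "(3::'k) \<noteq> 0" using char[of 3] assms(2) by (simp add: prime_nat_numeral_eq)
  interpret burkhardt_quartic_point \<alpha>
    using c2 c3 \<alpha>0 \<alpha>4 nz assms(4) unfolding subst_burkhardt[of \<alpha>, OF \<alpha>0] by unfold_locales
  have "(27 :: 'k) = 3 ^ 3" by simp
  then have "- 27 / (1 + \<alpha> 4 ^ 3) ^ 2 \<noteq> 0" using c3 nz by (metis divide_eq_0_iff neg_equal_0_iff_equal power_eq_0_iff)
  then show "\<exists>c. c \<noteq> 0 \<and> cubic_discriminant (E_equation \<alpha>) = Const c * F_sextic \<alpha>"
    using disc_E_equation[of \<alpha>, OF \<alpha>0 assms(4) nz(4)] by blast
  show "\<exists>G1. is_G1 \<alpha> G1" by (rule ex_G1[of \<alpha>, OF \<alpha>0 assms(4) nz(4,1)])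
  show "\<forall>G1. is_G1 \<alpha> G1 \<longrightarrow>
        (\<forall>\<eta>\<in>E_generic_points \<alpha>. \<forall>w\<in>equation_roots (cardano_equation \<alpha> G1).
          ext_degree line_field (E_field \<eta>) 3 \<and>
          equivalent_covers (E_field \<eta>) (equation_field w)) \<and>
        (\<forall>y. \<forall>\<eta>\<in>E_generic_points \<alpha>. y ^ 2 = at_generic (F_sextic \<alpha>) \<longrightarrow>
          (\<exists>D. is_J_divisor y G1 D \<and> card (J_subgroup y D) = 3 \<and>
            is_the_capitalizing_cover (C_field y) (compositum (C_field y) (E_field \<eta>))
              (J_subgroup y D)))"
    using E_cover_equivalent fibre_product_capitalizes by blast
qed

end
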